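(* (i) Let $G$ be an $n$-vertex graph with diversity $D\ge 2$ and maximum clique size $S$. For any positive integer $x$ with $x=o(\log S)$, there is a deterministic distributed algorithm in the LOCAL model that computes a proper vertex coloring of $G$ with $D^{x+1}S$ colors within $\tilde O\big(x\cdot\sqrt{D\,S^{1/(x+1)}}\big)+O(\log^* n)$ rounds. (ii) Let $G$ be an $n$-vertex graph of maximum degree $\Delta$. For any positive integer $x$ with $x=o(\log\Delta)$, there is a deterministic distributed algorithm in the LOCAL model that computes a proper edge coloring of $G$ with $2^{x+1}\Delta$ colors within $\tilde O\big(x\cdot\Delta^{1/(2x+2)}\big)+O(\log^* n)$ rounds.
   Context: LOCAL model: the input graph is the communication network; each vertex is a processor with a unique ID of $O(\log n)$ bits and unbounded local computation; computation proceeds in synchronous rounds, in each of which every vertex may send a message of arbitrary size to each neighbor; running time is the number of rounds until all vertices terminate. Global parameters are assumed known to all vertices. In edge coloring, adjacent edges (sharing an endpoint) receive distinct colors and both endpoints of an edge must learn its color. The diversity of a vertex is the number of maximal cliques containing it; $D(G)$ is the maximum over all vertices. $\tilde O(f)$ hides factors polylogarithmic in the maximum degree of $G$. *)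

theory Defs
  imports Complex_Main "HOL-Library.Landau_Symbols"
begin

text \<open>Simple graphs whose vertices are identified with their unique IDs (natural numbers).
  E is a set of ordered pairs, symmetric and irreflexive.\<close>

definition simple_graph :: "nat set \<Rightarrow> (nat \<times> nat) set \<Rightarrow> bool" where
  "simple_graph V E \<longleftrightarrow> finite V \<and> V \<noteq> {} \<and> E \<subseteq> V \<times> V \<and> sym E \<and> irrefl E"

definition nbrs :: "(nat \<times> nat) set \<Rightarrow> nat \<Rightarrow> nat set" where
  "nbrs E v = {w. (v, w) \<in> E}"

definition max_degree :: "nat set \<Rightarrow> (nat \<times> nat) set \<Rightarrow> nat" where
  "max_degree V E = Max ((\<lambda>v. card (nbrs E v)) ` V)"

definition is_clique :: "nat set \<Rightarrow> (nat \<times> nat) set \<Rightarrow> nat set \<Rightarrow> bool" where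
  "is_clique V E K \<longleftrightarrow> K \<subseteq> V \<and> (\<forall>a\<in>K. \<forall>b\<in>K. a \<noteq> b \<longrightarrow> (a, b) \<in> E)"

definition is_maximal_clique :: "nat set \<Rightarrow> (nat \<times> nat) set \<Rightarrow> nat set \<Rightarrow> bool" where
  "is_maximal_clique V E K \<longleftrightarrow> is_clique V E K \<and> (\<forall>K'. is_clique V E K' \<and> K \<subseteq> K' \<longrightarrow> K' = K)"

definition clique_number :: "nat set \<Rightarrow> (nat \<times> nat) set \<Rightarrow> nat" where
  "clique_number V E = Max {card K | K. is_clique V E K}"

definition vertex_diversity :: "nat set \<Rightarrow> (nat \<times> nat) set \<Rightarrow> nat \<Rightarrow> nat" where
  "vertex_diversity V E v = card {K. is_maximal_clique V E K \<and> v \<in> K}"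

definition diversity :: "nat set \<Rightarrow> (nat \<times> nat) set \<Rightarrow> nat" where
  "diversity V E = Max (vertex_diversity V E ` V)"

text \<open>Knowledge of vertex v after r synchronous LOCAL rounds: its own ID and all edges
  having an endpoint at distance less than r from v (vertices are their IDs).\<close>
definition local_view :: "(nat \<times> nat) set \<Rightarrow> nat \<Rightarrow> nat \<Rightarrow> nat \<times> (nat \<times> nat) set" where
  "local_view E r v = (v, {(a, b) \<in> E. \<exists>k<r. (v, a) \<in> E ^^ k})"

definition log_star :: "nat \<Rightarrow> nat" where
  "log_star n = (LEAST k. ((\<lambda>y. log 2 y) ^^ k) (real n) \<le> 1)"

definition proper_vertex_coloring :: "nat set \<Rightarrow> (nat \<times> nat) set \<Rightarrow> (nat \<Rightarrow> nat) \<Rightarrow> nat \<Rightarrow> bool" where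
  "proper_vertex_coloring V E col q \<longleftrightarrow>
     (\<forall>v\<in>V. col v < q) \<and> (\<forall>(u, w)\<in>E. col u \<noteq> col w)"

text \<open>Edge coloring given locally: col u w is the color that u assigns to edge {u,w};
  both endpoints must agree, and adjacent edges (sharing an endpoint) differ.\<close>
definition proper_edge_coloring :: "nat set \<Rightarrow> (nat \<times> nat) set \<Rightarrow> (nat \<Rightarrow> nat \<Rightarrow> nat) \<Rightarrow> nat \<Rightarrow> bool" where
  "proper_edge_coloring V E col q \<longleftrightarrow>
     (\<forall>(u, w)\<in>E. col u w < q \<and> col u w = col w u) \<and>
     (\<forall>u\<in>V. \<forall>w\<in>nbrs E u. \<forall>w'\<in>nbrs E u. w \<noteq> w' \<longrightarrow> col u w \<noteq> col u w')"

end

theory Submission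
  imports Defs "HOL-Library.FuncSet" "HOL-Library.Nat_Bijection"
begin

text \<open>Both parts are instances of colouring a graph equipped with a local clique cover in which every
  vertex lies in at most D cliques of size at most S: the maximal cliques for (i), the stars of the
  line graph (D = 2, S the maximum degree) for (ii).  Splitting each clique into blocks of size t
  leaves a graph of degree at most D(t-1); a proper colouring of it with D(t-1)+1 colours leaves at
  most one vertex per block in each colour class, so the clique size drops by the factor t.  At most
  x+1 repetitions with t about S^(1/(x+1)) reduce it to 1.

  Each block graph, of degree at most h, is coloured with h+1 colours in about sqrt h rounds.  Linial's
  colour reduction provides, once and for all, a proper colouring psi with poly(degree) colours.
  Functions f psi with pairwise few agreements then serve twice: time slots x with proposed classes
  f psi x produce about sqrt h classes of small arbdefect, and the shifts of the graphs of such
  functions in the sqrt h by sqrt h grid of colours provide nearly conflict-free candidate sets within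
  each class.  A vertex postponed by a pass has lost half of the uncoloured degree bound, so log h
  passes suffice.\<close>

section \<open>Local operators\<close>

text \<open>Three decisions shape the development. Algorithms that run on intermediate graphs with
  labels computed earlier are modelled as operators \<open>G H g\<close> whose value at a vertex
  depends on a ball of H and on the labels inside it; they compose by adding radii and can be
  simulated on any locally computable subgraph. The functions with few agreements stand in for
  low-degree polynomials over a finite field: they come from a counting argument with a factorial,
  so q may be any integer near sqrt h and no prime has to be found; being chosen from global
  parameters alone, they are common knowledge. Finally, the colour count has to be D^(x+1) S
  exactly, while S^(1/(x+1)) must be rounded up to an integer block size b. Repeating b to the end
  can exceed the budget, so once the cliques have size at most 2 b^2 the last two block sizes are
  balanced around the square root of what is left.\<close>

definition hood :: "(nat \<times> nat) set \<Rightarrow> nat \<Rightarrow> nat \<Rightarrow> nat set" where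
  "hood E k v = {u. \<exists>j\<le>k. (v, u) \<in> E ^^ j}"

text \<open>E ranges over arbitrary relations, not only over simple graphs, so the property composes
  without side conditions.\<close>

definition locally_determined :: "nat \<Rightarrow> ((nat \<times> nat) set \<Rightarrow> nat \<Rightarrow> 'a) \<Rightarrow> bool" where
  "locally_determined r F \<longleftrightarrow>
     (\<forall>E E' v. local_view E r v = local_view E' r v \<longrightarrow> F E v = F E' v)"

text \<open>Models k rounds in which input labels travel along with the edges. Labels are read at
  distance up to k, one step beyond the last vertices whose edges all belong to the view.\<close>

definition local_op :: "nat \<Rightarrow> ((nat \<times> nat) set \<Rightarrow> (nat \<Rightarrow> 'a) \<Rightarrow> nat \<Rightarrow> 'b) \<Rightarrow> bool" where
  "local_op k G \<longleftrightarrow>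
     (\<forall>E E' g g' v. local_view E k v = local_view E' k v \<longrightarrow> (\<forall>u\<in>hood E k v. g u = g' u)
        \<longrightarrow> G E g v = G E' g' v)"

lemma local_view_edgeD:
  assumes "local_view E r v = local_view E' r v" "(v, a) \<in> E ^^ k" "k < r" "(a, b) \<in> E"
  shows "(a, b) \<in> E'"
proof -
  have "(a, b) \<in> snd (local_view E r v)"
    using assms unfolding local_view_def by auto
  then have "(a, b) \<in> snd (local_view E' r v)" using assms by simp
  then show ?thesis unfolding local_view_def by auto
qed

lemma local_view_relpow:
  assumes "local_view E (k + l) v = local_view E' (k + l) v" "(v, u) \<in> E ^^ i" "i \<le> l"
    and "(u, a) \<in> E ^^ j" "j \<le> k"
  shows "(u, a) \<in> E' ^^ j"
  using assms(4,5)
proof (induction j arbitrary: a)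
  case 0
  then show ?case by simp
next
  case (Suc j)
  then obtain b where b: "(u, b) \<in> E ^^ j" "(b, a) \<in> E" by auto
  then have "(u, b) \<in> E' ^^ j" using Suc by simp
  moreover have "(v, b) \<in> E ^^ (i + j)" using assms(2) b(1) by (auto simp: relpow_add)
  then have "(b, a) \<in> E'"
    by (rule local_view_edgeD[OF assms(1)]) (use Suc.prems assms(3) b in auto)
  ultimately show ?case by auto
qed

text \<open>An edge starting at distance less than k from u starts at distance less than k + l from
  v, so the smaller view can be read off the larger one. \<open>aux\<close> is stated for arbitrary
  relations so that E and E' can be swapped.\<close>

lemma local_view_shift:
  assumes "local_view E (k + l) v = local_view E' (k + l) v" "u \<in> hood E l v"
  shows "local_view E k u = local_view E' k u"
proof -
  have aux: "{(a, b) \<in> E. \<exists>j<k. (u, a) \<in> E ^^ j} \<subseteq> {(a, b) \<in> E'. \<exists>j<k. (u, a) \<in> E' ^^ j}"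
    if eq: "local_view E (k + l) v = local_view E' (k + l) v" and u: "u \<in> hood E l v" for E E'
  proof clarify
    fix a b j assume ab: "(a, b) \<in> E" "j < k" "(u, a) \<in> E ^^ j"
    obtain i where i: "i \<le> l" "(v, u) \<in> E ^^ i" using u unfolding hood_def by auto
    have "(u, a) \<in> E' ^^ j" using local_view_relpow[OF eq i(2,1) ab(3)] ab(2) by simp
    moreover have "(v, a) \<in> E ^^ (i + j)" using i ab by (auto simp: relpow_add)
    then have "(a, b) \<in> E'"
      by (rule local_view_edgeD[OF eq]) (use i ab in auto)
    ultimately show "(a, b) \<in> E' \<and> (\<exists>j<k. (u, a) \<in> E' ^^ j)" using ab by auto
  qed
  \<comment> \<open>Swapping E and E' in \<open>aux\<close> requires u to be near v in E' as
    well.\<close>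
  have "u \<in> hood E' l v"
  proof -
    obtain i where i: "i \<le> l" "(v, u) \<in> E ^^ i" using assms(2) unfolding hood_def by auto
    have "(v, u) \<in> E' ^^ i"
      using local_view_relpow[of E "k + l" 0 v E' v 0 u i] assms(1) i by auto
    then show ?thesis using i unfolding hood_def by auto
  qed
  then show ?thesis
    using aux[OF assms] aux[OF assms(1)[symmetric]] unfolding local_view_def by auto
qed

lemma hood_self: "v \<in> hood E k v"
  unfolding hood_def by (auto intro: exI[of _ 0])

lemma local_view_mono:
  assumes "local_view E r v = local_view E' r v" "s \<le> r"
  shows "local_view E s v = local_view E' s v"
  using local_view_shift[of E s "r - s" v E' v] assms hood_self by auto

lemma hood_add: "u \<in> hood E l v \<Longrightarrow> w \<in> hood E k u \<Longrightarrow> w \<in> hood E (k + l) v"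
proof -
  assume "u \<in> hood E l v" "w \<in> hood E k u"
  then obtain i j where "i \<le> l" "(v, u) \<in> E ^^ i" "j \<le> k" "(u, w) \<in> E ^^ j"
    unfolding hood_def by auto
  then have "(v, w) \<in> E ^^ (i + j)" "i + j \<le> k + l" by (auto simp: relpow_add)
  then show ?thesis unfolding hood_def by blast
qed

lemma hood_1: "hood E 1 v = insert v (nbrs E v)"
  unfolding hood_def nbrs_def by (auto simp: le_Suc_eq)

lemma local_view_1: "local_view E (Suc 0) v = (v, {v} \<times> nbrs E v)"
  unfolding local_view_def nbrs_def by auto

lemma local_view_nbrs:
  assumes "local_view E r v = local_view E' r v" "1 \<le> r"
  shows "nbrs E v = nbrs E' v"
  using local_view_mono[OF assms] by (auto simp: local_view_1)

lemma local_op_one_round: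
  assumes "\<And>E E' g g' v. nbrs E v = nbrs E' v \<Longrightarrow> (\<And>u. u \<in> insert v (nbrs E v) \<Longrightarrow> g u = g' u)
    \<Longrightarrow> G E g v = G E' g' v"
  shows "local_op (Suc 0) G"
  unfolding local_op_def
proof (intro allI impI)
  fix E E' :: "(nat \<times> nat) set" and g g' :: "nat \<Rightarrow> 'a" and v
  assume "local_view E (Suc 0) v = local_view E' (Suc 0) v" "\<forall>u\<in>hood E (Suc 0) v. g u = g' u"
  then show "G E g v = G E' g' v"
    using hood_1[of E v] by (intro assms) (auto simp: local_view_1)
qed

text \<open>G reads the output of F only at distance at most l, and each such output depends on a
  ball of radius k around its own vertex.\<close>

lemma local_op_comp:
  assumes "local_op k F" "local_op l G"
  shows "local_op (k + l) (\<lambda>E g. G E (F E g))"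
  unfolding local_op_def
proof (intro allI impI)
  fix E E' :: "(nat \<times> nat) set" and g g' :: "nat \<Rightarrow> 'a" and v
  assume A: "local_view E (k + l) v = local_view E' (k + l) v" "\<forall>u\<in>hood E (k + l) v. g u = g' u"
  have "F E g u = F E' g' u" if u: "u \<in> hood E l v" for u
    using assms(1)[unfolded local_op_def, rule_format, OF local_view_shift[OF A(1) u]]
      A(2) hood_add[OF u] by blast
  then show "G E (F E g) v = G E' (F E' g') v"
    using assms(2)[unfolded local_op_def, rule_format, OF local_view_mono[OF A(1)]] by auto
qed

lemma local_op_map:
  assumes "local_op k F"
  shows "local_op k (\<lambda>E g v. h (F E g v))"
  unfolding local_op_def
proof (intro allI impI)
  fix E E' :: "(nat \<times> nat) set" and g g' :: "nat \<Rightarrow> 'a" and v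
  assume "local_view E k v = local_view E' k v" "\<forall>u\<in>hood E k v. g u = g' u"
  then have "F E g v = F E' g' v" using assms unfolding local_op_def by blast
  then show "h (F E g v) = h (F E' g' v)" by simp
qed

lemma local_op_input: "local_op k (\<lambda>E g v. h (g v))"
  unfolding local_op_def using hood_self by fastforce

lemma local_op_pair:
  assumes "local_op k F" "local_op k G"
  shows "local_op k (\<lambda>E g v. (F E g v, G E g v))"
  using assms unfolding local_op_def prod.inject by blast

lemma locally_determined_mono:
  assumes "locally_determined k F" "k \<le> l"
  shows "locally_determined l F"
  using assms(1) local_view_mono[OF _ assms(2)] unfolding locally_determined_def by blast

text \<open>Simulation on a subgraph: a walk in \<open>H E\<close> is a walk in E of the same
  length, so \<rho> rounds on \<open>H E\<close> cost \<rho> rounds on E, once r rounds have told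
  every vertex its neighbours in \<open>H E\<close> and its input.\<close>

lemma locally_determined_subgraph:
  assumes nb: "locally_determined r (\<lambda>E. nbrs (H E))" and sub: "\<And>E. H E \<subseteq> E"
    and g: "locally_determined r g" and G: "local_op \<rho> G"
  shows "locally_determined (r + \<rho>) (\<lambda>E. G (H E) (g E))"
  unfolding locally_determined_def
proof (intro allI impI)
  fix E E' :: "(nat \<times> nat) set" and v
  assume eq: "local_view E (r + \<rho>) v = local_view E' (r + \<rho>) v"
  have pow: "R ^^ k \<subseteq> R' ^^ k" if "R \<subseteq> R'" for R R' :: "(nat \<times> nat) set" and k :: nat
    using that by (induction k) auto
  have inH: "u \<in> hood E \<rho> v" if "(v, u) \<in> H E ^^ k" "k \<le> \<rho>" for u E and k :: nat
    using that pow[OF sub] unfolding hood_def by blast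
  have nbeq: "nbrs (H E) u = nbrs (H E') u"
    if "local_view E (r + \<rho>) v = local_view E' (r + \<rho>) v" "u \<in> hood E \<rho> v" for u E E'
    using nb[unfolded locally_determined_def] local_view_shift[OF that] by blast
  \<comment> \<open>A walk carries over one edge at a time: each vertex on it is so close to v that
    the view fixes its neighbourhood in the subgraph.\<close>
  have path: "(v, a) \<in> H E' ^^ k"
    if "local_view E (r + \<rho>) v = local_view E' (r + \<rho>) v" "(v, a) \<in> H E ^^ k" "k \<le> \<rho>" for a E E' and k :: nat
    using that(2,3)
  proof (induction k arbitrary: a)
    case (Suc k)
    then obtain b where b: "(v, b) \<in> H E ^^ k" "(b, a) \<in> H E" by auto
    then have "nbrs (H E) b = nbrs (H E') b"
      using nbeq[OF that(1)] inH[OF b(1)] Suc.prems by auto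
    then have "(b, a) \<in> H E'" using b(2) by (auto simp: nbrs_def)
    then show ?case using Suc b by auto
  qed simp
  have sub1: "{(a, b) \<in> H E. \<exists>k<\<rho>. (v, a) \<in> H E ^^ k} \<subseteq> {(a, b) \<in> H E'. \<exists>k<\<rho>. (v, a) \<in> H E' ^^ k}"
    if e: "local_view E (r + \<rho>) v = local_view E' (r + \<rho>) v" for E E'
  proof clarify
    fix a b k assume k: "(a, b) \<in> H E" "k < \<rho>" "(v, a) \<in> H E ^^ k"
    have "nbrs (H E) a = nbrs (H E') a" using nbeq[OF e] inH[OF k(3)] k by auto
    then have "(a, b) \<in> H E'" using k by (auto simp: nbrs_def)
    then show "(a, b) \<in> H E' \<and> (\<exists>k<\<rho>. (v, a) \<in> H E' ^^ k)" using path[OF e k(3)] k by auto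
  qed
  have "local_view (H E) \<rho> v = local_view (H E') \<rho> v"
    using sub1[OF eq] sub1[OF eq[symmetric]] unfolding local_view_def by auto
  moreover have "g E u = g E' u" if u: "u \<in> hood (H E) \<rho> v" for u
  proof -
    obtain j where "(v, u) \<in> H E ^^ j" "j \<le> \<rho>" using u unfolding hood_def by auto
    then have "u \<in> hood E \<rho> v" by (rule inH)
    then show ?thesis using g[unfolded locally_determined_def] local_view_shift[OF eq] by blast
  qed
  ultimately show "G (H E) (g E) v = G (H E') (g E') v"
    using G unfolding local_op_def by blast
qed

text \<open>For quantities computed from the values of g at v and its neighbours, whose collection
  costs one round. K stands for a family of cliques at v that two rounds reveal.\<close>

lemma locally_determined_nbr_inputs:
  assumes "locally_determined r g" "locally_determined 2 K" "1 \<le> r"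
    and "\<And>E E' v. local_view E 2 v = local_view E' 2 v \<Longrightarrow> (\<And>u. u \<in> insert v (nbrs E v) \<Longrightarrow> g E u = g E' u)
      \<Longrightarrow> K E v = K E' v \<Longrightarrow> F E v = F E' v"
  shows "locally_determined (r + 1) F"
  unfolding locally_determined_def
proof (intro allI impI)
  fix E E' v
  assume eq: "local_view E (r + 1) v = local_view E' (r + 1) v"
  have 2: "local_view E 2 v = local_view E' 2 v" using local_view_mono[OF eq] assms(3) by simp
  show "F E v = F E' v"
  proof (rule assms(4)[OF 2])
    show "K E v = K E' v" using assms(2) 2 unfolding locally_determined_def by blast
  next
    fix u assume "u \<in> insert v (nbrs E v)"
    then show "g E u = g E' u"
      using local_view_shift[OF eq] assms(1) hood_1 unfolding locally_determined_def by blast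
  qed
qed

section \<open>Functions with few agreements\<close>

text \<open>Union bound. A fixed g and a fixed t-set on which f copies g leave q^(q-t) functions f;
  there are at most q^t / t! such sets, so the bad functions form a fraction of at most |Z| / t! <
  1. If t exceeds q, every function works.\<close>

lemma exists_few_agreements:
  fixes q t :: nat
  assumes fin: "finite Z" and q: "q \<ge> 1" and Z: "card Z < fact t"
  shows "\<exists>f\<in>{..<q::nat} \<rightarrow>\<^sub>E {..<q}. \<forall>g\<in>Z. card {x\<in>{..<q}. f x = g x} < (t::nat)"
proof (cases "t \<le> q")
  case False
  have "card {x\<in>{..<q}. f x = g x} \<le> q" for f g :: "nat \<Rightarrow> nat"
    using card_mono[of "{..<q}" "{x\<in>{..<q}. f x = g x}"] by auto
  then have "card {x\<in>{..<q}. f x = g x} < t" for f g :: "nat \<Rightarrow> nat"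
    using False by (meson le_less_trans not_le)
  moreover have "(\<lambda>x\<in>{..<q}. 0) \<in> {..<q} \<rightarrow>\<^sub>E {..<q}" using q by auto
  ultimately show ?thesis by blast
next
  case True
  let ?P = "{..<q} \<rightarrow>\<^sub>E {..<q}"
  define fix_on where "fix_on g T = {f \<in> ?P. \<forall>x\<in>T. f x = g x}" for g :: "nat \<Rightarrow> nat" and T
  define Ts where "Ts = {T. T \<subseteq> {..<q} \<and> card T = t}"
  define Bad where "Bad = (\<Union>g\<in>Z. \<Union>T\<in>Ts. fix_on g T)"
  have finBad: "finite Bad"
    unfolding Bad_def fix_on_def Ts_def using fin by (auto intro!: finite_PiE)
  have cT: "card Ts = q choose t" unfolding Ts_def using n_subsets[of "{..<q}" t] by simp
  have finT: "finite Ts" unfolding Ts_def by simp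
  have cfix: "card (fix_on g T) \<le> q ^ (q - t)" if "T \<in> Ts" for g T
  proof -
    have T: "T \<subseteq> {..<q}" "card T = t" "finite T"
      using that unfolding Ts_def by (auto intro: finite_subset)
    let ?Q = "PiE {..<q} (\<lambda>x. if x \<in> T then {g x} else {..<q})"
    have "fix_on g T \<subseteq> ?Q" unfolding fix_on_def PiE_def Pi_def by auto
    then have "card (fix_on g T) \<le> card ?Q" by (rule card_mono[rotated]) (auto intro: finite_PiE)
    also have "card ?Q = (\<Prod>x\<in>{..<q}. if x \<in> T then 1 else q)"
      by (subst card_PiE) (auto intro!: prod.cong)
    also have "\<dots> = q ^ card ({..<q} - T)"
      using T by (subst prod.If_cases) (auto simp: Int_def Diff_eq)
    also have "card ({..<q} - T) = q - t" using T by (simp add: card_Diff_subset)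
    finally show ?thesis .
  qed
  have "card Bad \<le> (\<Sum>g\<in>Z. card (\<Union>T\<in>Ts. fix_on g T))"
    unfolding Bad_def by (rule card_UN_le[OF fin])
  also have "\<dots> \<le> (\<Sum>g\<in>Z. \<Sum>T\<in>Ts. card (fix_on g T))"
    by (intro sum_mono card_UN_le[OF finT])
  also have "\<dots> \<le> (\<Sum>g\<in>Z. \<Sum>T\<in>Ts. q ^ (q - t))" by (intro sum_mono cfix)
  also have "\<dots> = card Z * ((q choose t) * q ^ (q - t))" by (simp add: cT)
  finally have "card Bad * fact t \<le> card Z * (((q choose t) * fact t) * q ^ (q - t))"
    using mult_le_mono1[of "card Bad" _ "fact t"] by (simp add: ac_simps)
  also have "\<dots> \<le> card Z * (q ^ t * q ^ (q - t))"
    by (intro mult_le_mono le_refl binomial_fact_pow)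
  also have "q ^ t * q ^ (q - t) = q ^ q" using True by (simp flip: power_add)
  also have "card Z * q ^ q < fact t * q ^ q" using Z q by simp
  finally have "card Bad < q ^ q" by (simp add: mult.commute)
  also have "q ^ q = card ?P" by (simp add: card_PiE)
  finally have lt: "card Bad < card ?P" .
  have "\<not> ?P \<subseteq> Bad"
  proof
    assume "?P \<subseteq> Bad"
    then have "card ?P \<le> card Bad" by (rule card_mono[OF finBad])
    then show False using lt by simp
  qed
  then obtain f where f: "f \<in> ?P" "f \<notin> Bad" by (meson subsetI)
  have "card {x\<in>{..<q}. f x = g x} < t" if "g \<in> Z" for g
  proof (rule ccontr)
    assume "\<not> ?thesis"
    then have "t \<le> card {x\<in>{..<q}. f x = g x}" by simp
    then obtain T where "T \<subseteq> {x\<in>{..<q}. f x = g x}" "card T = t"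
      by (rule obtain_subset_with_card_n)
    then have "f \<in> fix_on g T" "T \<in> Ts" using f(1) unfolding fix_on_def Ts_def by blast+
    then show False using f(2) that unfolding Bad_def by blast
  qed
  then show ?thesis using f(1) by blast
qed

text \<open>Plays the role of a family of low-degree polynomials. The clause on a single value c
  controls a neighbour that has settled on a value; the shifts in the last clause give plain
  agreements for \<open>a = b = 0\<close> and overlaps of shifted graphs in general.\<close>

definition low_agreement :: "nat \<Rightarrow> nat \<Rightarrow> nat \<Rightarrow> (nat \<Rightarrow> nat \<Rightarrow> nat) \<Rightarrow> bool" where
  "low_agreement m q t f \<longleftrightarrow>
     (\<forall>i<m. (\<forall>x<q. f i x < q) \<and> (\<forall>c. card {x. x < q \<and> f i x = c} < t) \<and>
       (\<forall>j<m. \<forall>a b. i \<noteq> j \<longrightarrow> card {x. x < q \<and> (f i x + a) mod q = (f j x + b) mod q} < t))"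

text \<open>Brings the shift a to the other side, so that q shifts of one function replace all pairs
  of shifts.\<close>

lemma mod_shift_cancel:
  assumes "q \<ge> 1" "(u + a) mod q = (w + b) mod q" "u < (q::nat)"
  shows "u = (w + (b + (q - a mod q)) mod q) mod q"
proof -
  have "a mod q \<le> q" using assms(1) by (simp add: less_imp_le)
  then have "a + (q - a mod q) = q * (a div q + 1)"
    using mult_div_mod_eq[of q a] by (simp only: distrib_left mult_1_right)
  then have "u = (u + (a + (q - a mod q))) mod q" using assms(3) by (simp only: mod_mult_self2 mod_less)
  also have "\<dots> = ((u + a) mod q + (q - a mod q)) mod q" by (simp add: mod_simps add.assoc)
  also have "\<dots> = ((w + b) mod q + (q - a mod q)) mod q" using assms(2) by simp
  also have "\<dots> = (w + (b + (q - a mod q)) mod q) mod q" by (simp add: mod_simps add.assoc)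
  finally show ?thesis .
qed

text \<open>Greedy choice. The next function must agree rarely with the q shifts of each of the m
  earlier ones and with the q constants, (m + 1) q functions in all.\<close>

lemma exists_low_agreement:
  assumes "q \<ge> 1" "(m + 1) * q < fact t"
  shows "\<exists>f. low_agreement m q t f"
  using assms(2)
proof (induction m)
  case 0
  then show ?case unfolding low_agreement_def by auto
next
  case (Suc m)
  have "(m + 1) * q \<le> (Suc m + 1) * q" by simp
  then obtain f where f: "low_agreement m q t f" using Suc by fastforce
  define sh where "sh = (\<lambda>(j, s) x. (f j x + s) mod q)"
  define Z where "Z = sh ` ({..<m} \<times> {..<q}) \<union> (\<lambda>c x. c) ` {..<q}"
  have "card Z \<le> card (sh ` ({..<m} \<times> {..<q})) + card ((\<lambda>c (x::nat). c) ` {..<q})"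
    unfolding Z_def by (rule card_Un_le)
  also have "\<dots> \<le> m * q + q"
    using card_image_le[of "{..<m} \<times> {..<q}" sh] card_image_le[of "{..<q}" "\<lambda>c (x::nat). c"]
    by (auto simp: card_cartesian_product)
  also have "\<dots> < fact t" using Suc.prems by (simp add: algebra_simps)
  finally have "card Z < fact t" .
  moreover have "finite Z" unfolding Z_def by simp
  ultimately obtain h where h: "h \<in> {..<q} \<rightarrow>\<^sub>E {..<q}" "\<And>g. g \<in> Z \<Longrightarrow> card {x\<in>{..<q}. h x = g x} < t"
    using exists_few_agreements[OF _ assms(1)] by meson
  have hq: "h x < q" if "x < q" for x using PiE_mem[OF h(1)] that by simp
  have const: "card {x. x < q \<and> h x = c} < t" for c
  proof (cases "c < q")
    case True
    then have "(\<lambda>x. c) \<in> Z" unfolding Z_def by (intro UnI2 image_eqI[of _ _ c]) auto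
    from h(2)[OF this] show ?thesis by simp
  next
    case False
    then have e: "{x. x < q \<and> h x = c} = {}" using hq by auto
    \<comment> \<open>The preimage of c is empty; any member of Z yields t > 0, and the constant 0
      is one.\<close>
    have "(\<lambda>x. 0) \<in> Z"
      unfolding Z_def using assms(1) by (intro UnI2 image_eqI[of _ _ 0]) auto
    then have "t > 0" using h(2) by (metis gr0I not_less0)
    then show ?thesis unfolding e by simp
  qed
  have new: "card {x. x < q \<and> (h x + a) mod q = (f j x + b) mod q} < t" if "j < m" for j a b
  proof -
    let ?s = "(b + (q - a mod q)) mod q"
    have "{x. x < q \<and> (h x + a) mod q = (f j x + b) mod q} \<subseteq> {x\<in>{..<q}. h x = sh (j, ?s) x}"
      using mod_shift_cancel[OF assms(1)] hq unfolding sh_def by auto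
    then have "card {x. x < q \<and> (h x + a) mod q = (f j x + b) mod q} \<le> card {x\<in>{..<q}. h x = sh (j, ?s) x}"
      by (rule card_mono[rotated]) simp
    also have "\<dots> < t" using that assms(1) by (intro h(2)) (auto simp: Z_def)
    finally show ?thesis .
  qed
  have new': "card {x. x < q \<and> (f j x + b) mod q = (h x + a) mod q} < t" if "j < m" for j a b
    using new[OF that, of a b] by (simp add: eq_commute)
  have old: "f i x < q" if "i < m" "x < q" for i x
    using f that unfolding low_agreement_def by blast
  have old_const: "card {x. x < q \<and> f i x = c} < t" if "i < m" for i c
    using f that unfolding low_agreement_def by blast
  have old_pair: "card {x. x < q \<and> (f i x + a) mod q = (f j x + b) mod q} < t"
    if "i < m" "j < m" "i \<noteq> j" for i j a b
    using f that unfolding low_agreement_def by blast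
  have "low_agreement (Suc m) q t (f(m := h))"
    unfolding low_agreement_def less_Suc_eq
    using const hq new new' old old_const old_pair by (intro allI impI conjI) auto
  then show ?case by blast
qed

section \<open>Linial's colour reduction\<close>

definition proper_on :: "(nat \<times> nat) set \<Rightarrow> (nat \<Rightarrow> nat) \<Rightarrow> bool" where
  "proper_on H c \<longleftrightarrow> (\<forall>u w. (u, w) \<in> H \<longrightarrow> c u \<noteq> c w)"

definition degree_le :: "(nat \<times> nat) set \<Rightarrow> nat \<Rightarrow> bool" where
  "degree_le H h \<longleftrightarrow> (\<forall>v. finite (nbrs H v) \<and> card (nbrs H v) \<le> h)"

definition lg :: "nat \<Rightarrow> nat" where
  "lg n = nat \<lceil>log 2 (real n)\<rceil>"

lemma le_two_power_lg: "n \<le> 2 ^ lg n"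
proof (cases "n = 0")
  case False
  have "log 2 (real n) \<le> real (lg n)"
    unfolding lg_def by (simp add: real_nat_ceiling_ge)
  then have "real n \<le> 2 powr real (lg n)" using False by (simp add: log_le_iff)
  also have "\<dots> = real (2 ^ lg n)" by (simp add: powr_realpow)
  finally show ?thesis by (simp only: of_nat_le_iff)
qed simp

lemma lg_le: "n \<ge> 1 \<Longrightarrow> real (lg n) \<le> log 2 (real n) + 1"
proof -
  assume "n \<ge> 1"
  then have "0 \<le> log 2 (real n)" by simp
  then have "0 \<le> \<lceil>log 2 (real n)\<rceil>" by linarith
  then have "real (lg n) = of_int \<lceil>log 2 (real n)\<rceil>" unfolding lg_def by simp
  then show ?thesis using of_int_ceiling_le_add_one[of "log 2 (real n)"] by simp
qed

lemma two_power_le_fact: "2 ^ n \<le> (fact (Suc n) :: nat)"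
proof (induction n)
  case (Suc n)
  have "2 * 2 ^ n \<le> Suc (Suc n) * (fact (Suc n) :: nat)" by (intro mult_le_mono Suc) simp
  then show ?case by simp
qed simp

lemma less_fact_lg: "n < fact (lg n + 2)"
proof -
  have "n < 2 ^ (lg n + 1)"
    using le_two_power_lg[of n] by (simp add: less_le_trans le_less_trans)
  also have "\<dots> \<le> fact (lg n + 2)" using two_power_le_fact[of "lg n + 1"] by simp
  finally show ?thesis .
qed

text \<open>\<open>lg y + 2\<close> makes the factorial exceed y by \<open>less_fact_lg\<close>; one
  more unit supplies the factor t for the Q = \<Delta> t + 1 \<le> (\<Delta> + 1) t points of the
  functions in \<open>linial_step\<close>.\<close>

definition linial_param :: "nat \<Rightarrow> nat \<Rightarrow> nat" where
  "linial_param \<Delta> m = lg ((m + 1) * (\<Delta> + 1)) + 3"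

text \<open>Each neighbour spoils fewer than t of the Q > \<Delta> t points, so some x separates v
  from all of them. The new colour encodes x and the value there: neighbours with the same x have
  different values.\<close>

lemma linial_step:
  "\<exists>G. local_op (Suc 0) G \<and> (\<forall>H \<psi>. degree_le H \<Delta> \<longrightarrow> (\<forall>v. \<psi> v < m) \<longrightarrow> proper_on H \<psi> \<longrightarrow>
     (\<forall>v. G H \<psi> v < (\<Delta> * linial_param \<Delta> m + 1)\<^sup>2) \<and> proper_on H (G H \<psi>))"
proof -
  define t where "t = linial_param \<Delta> m"
  define Q where "Q = \<Delta> * t + 1"
  have "(m + 1) * Q \<le> (m + 1) * (\<Delta> + 1) * t"
    unfolding Q_def t_def linial_param_def by (simp add: algebra_simps)
  also have "\<dots> < fact (t - 1) * t"
    using less_fact_lg[of "(m + 1) * (\<Delta> + 1)"] unfolding t_def linial_param_def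
    by (intro mult_strict_right_mono) (simp_all add: numeral_3_eq_3 numeral_2_eq_2)
  also have "\<dots> = fact t"
    using fact_reduce[of t, where 'a = nat] unfolding t_def linial_param_def by simp
  finally have "(m + 1) * Q < fact t" .
  then obtain f where f: "low_agreement m Q t f"
    using exists_low_agreement[of Q m t] unfolding Q_def by auto
  define good where "good H \<psi> v x \<longleftrightarrow> x < Q \<and> (\<forall>u\<in>nbrs H v. f (\<psi> u) x \<noteq> f (\<psi> v) x)"
    for H and \<psi> :: "nat \<Rightarrow> nat" and v x
  define G where "G H \<psi> v = (let x = (SOME x. good H \<psi> v x) in x * Q + f (\<psi> v) x)" for H \<psi> v
  have "local_op (Suc 0) G"
  proof (rule local_op_one_round)
    fix E E' :: "(nat \<times> nat) set" and g g' :: "nat \<Rightarrow> nat" and v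
    assume A: "nbrs E v = nbrs E' v" "\<And>u. u \<in> insert v (nbrs E v) \<Longrightarrow> g u = g' u"
    then have "good E g v = good E' g' v" unfolding good_def by (auto simp: fun_eq_iff)
    then show "G E g v = G E' g' v" unfolding G_def using A(2)[of v] by simp
  qed
  moreover have "(\<forall>v. G H \<psi> v < Q\<^sup>2) \<and> proper_on H (G H \<psi>)"
    if deg: "degree_le H \<Delta>" and m: "\<And>v. \<psi> v < m" and pr: "proper_on H \<psi>" for H \<psi>
  proof -
    have ex: "\<exists>x. good H \<psi> v x" for v
    proof (rule ccontr)
      assume "\<nexists>x. good H \<psi> v x"
      then have "{..<Q} \<subseteq> (\<Union>u\<in>nbrs H v. {x. x < Q \<and> (f (\<psi> u) x + 0) mod Q = (f (\<psi> v) x + 0) mod Q})"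
        unfolding good_def by fastforce
      then have "card {..<Q} \<le> card (\<Union>u\<in>nbrs H v. {x. x < Q \<and> (f (\<psi> u) x + 0) mod Q = (f (\<psi> v) x + 0) mod Q})"
        using deg unfolding degree_le_def by (intro card_mono) auto
      also have "\<dots> \<le> (\<Sum>u\<in>nbrs H v. card {x. x < Q \<and> (f (\<psi> u) x + 0) mod Q = (f (\<psi> v) x + 0) mod Q})"
        using deg unfolding degree_le_def by (intro card_UN_le) auto
      also have "\<dots> \<le> (\<Sum>u\<in>nbrs H v. t)"
      proof (rule sum_mono)
        fix u assume "u \<in> nbrs H v"
        then have "\<psi> u \<noteq> \<psi> v" using pr unfolding proper_on_def nbrs_def by fastforce
        then show "card {x. x < Q \<and> (f (\<psi> u) x + 0) mod Q = (f (\<psi> v) x + 0) mod Q} \<le> t"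
          using f m unfolding low_agreement_def by (meson less_imp_le)
      qed
      also have "\<dots> \<le> \<Delta> * t" using deg unfolding degree_le_def by simp
      finally show False unfolding Q_def by simp
    qed
    define X where "X v = (SOME x. good H \<psi> v x)" for v
    have X: "good H \<psi> v (X v)" for v unfolding X_def using ex by (rule someI_ex)
    have GX: "G H \<psi> v = X v * Q + f (\<psi> v) (X v)" for v unfolding G_def X_def Let_def ..
    have fQ: "f (\<psi> v) (X v) < Q" for v
      using f m X[of v] unfolding low_agreement_def good_def by blast
    have "G H \<psi> v < Q\<^sup>2" for v
    proof -
      have "G H \<psi> v < X v * Q + Q" unfolding GX using fQ by simp
      also have "\<dots> = Suc (X v) * Q" by simp
      also have "\<dots> \<le> Q * Q" using X[of v] unfolding good_def by (intro mult_le_mono1) simp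
      finally show ?thesis by (simp add: power2_eq_square)
    qed
    moreover have "G H \<psi> u \<noteq> G H \<psi> w" if "(u, w) \<in> H" for u w
    proof
      assume e: "G H \<psi> u = G H \<psi> w"
      have "X v = G H \<psi> v div Q" "f (\<psi> v) (X v) = G H \<psi> v mod Q" for v
        unfolding GX using fQ[of v] by simp_all
      then have "X u = X w" "f (\<psi> u) (X u) = f (\<psi> w) (X w)" using e by metis+
      then show False using X[of u] that unfolding good_def nbrs_def by auto
    qed
    ultimately show ?thesis unfolding proper_on_def by blast
  qed
  ultimately show ?thesis unfolding Q_def t_def by blast
qed

primrec linial_colours :: "nat \<Rightarrow> nat \<Rightarrow> nat \<Rightarrow> nat" where
  "linial_colours \<Delta> m 0 = m" |
  "linial_colours \<Delta> m (Suc i) = (\<Delta> * linial_param \<Delta> (linial_colours \<Delta> m i) + 1)\<^sup>2"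

lemma linial_iterated:
  "\<exists>G. local_op T G \<and> (\<forall>H \<psi>. degree_le H \<Delta> \<longrightarrow> (\<forall>v. \<psi> v < m) \<longrightarrow> proper_on H \<psi> \<longrightarrow>
     (\<forall>v. G H \<psi> v < linial_colours \<Delta> m T) \<and> proper_on H (G H \<psi>))"
proof (induction T)
  case 0
  have "local_op 0 (\<lambda>(H::(nat \<times> nat) set) (\<psi>::nat \<Rightarrow> nat) v. \<psi> v)" by (rule local_op_input)
  then show ?case by (intro exI[of _ "\<lambda>H \<psi> v. \<psi> v"]) auto
next
  case (Suc T)
  obtain F where F: "local_op T F" "\<And>H \<psi>. degree_le H \<Delta> \<Longrightarrow> (\<forall>v. \<psi> v < m) \<Longrightarrow> proper_on H \<psi> \<Longrightarrow>
     (\<forall>v. F H \<psi> v < linial_colours \<Delta> m T) \<and> proper_on H (F H \<psi>)"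
    using Suc by blast
  obtain G where G: "local_op (Suc 0) G" "\<And>H \<psi>. degree_le H \<Delta> \<Longrightarrow>
      (\<forall>v. \<psi> v < linial_colours \<Delta> m T) \<Longrightarrow> proper_on H \<psi> \<Longrightarrow>
     (\<forall>v. G H \<psi> v < linial_colours \<Delta> m (Suc T)) \<and> proper_on H (G H \<psi>)"
    using linial_step[of \<Delta> "linial_colours \<Delta> m T"] unfolding linial_colours.simps by blast
  have "local_op (Suc T) (\<lambda>H \<psi>. G H (F H \<psi>))" using local_op_comp[OF F(1) G(1)] by simp
  then show ?case
    using F(2) G(2) by (intro exI[of _ "\<lambda>H \<psi>. G H (F H \<psi>)"]) blast
qed

section \<open>Arbdefective colouring\<close>

text \<open>At time x an active vertex v proposes the class f (psi v) x and keeps it forever if at most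
  b neighbours propose it at the same time or own it already.  Labels are pairs of the colour psi
  and a flag for membership in the vertex set under consideration.\<close>

definition conflicts ::
  "(nat \<Rightarrow> nat \<Rightarrow> nat) \<Rightarrow> (nat \<times> nat) set \<Rightarrow> (nat \<Rightarrow> nat \<times> bool) \<Rightarrow> (nat \<Rightarrow> nat option) \<Rightarrow> nat \<Rightarrow> nat \<Rightarrow> nat set"
where
  "conflicts f H g \<tau> x v = {u \<in> nbrs H v. snd (g u) \<and>
     (case \<tau> u of None \<Rightarrow> f (fst (g u)) x = f (fst (g v)) x | Some y \<Rightarrow> f (fst (g u)) y = f (fst (g v)) x)}"

primrec stop_time ::
  "(nat \<Rightarrow> nat \<Rightarrow> nat) \<Rightarrow> nat \<Rightarrow> (nat \<times> nat) set \<Rightarrow> (nat \<Rightarrow> nat \<times> bool) \<Rightarrow> nat \<Rightarrow> nat \<Rightarrow> nat option"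
where
  "stop_time f b H g 0 = (\<lambda>v. None)" |
  "stop_time f b H g (Suc x) = (\<lambda>v. case stop_time f b H g x v of Some y \<Rightarrow> Some y |
     None \<Rightarrow> if card (conflicts f H g (stop_time f b H g x) x v) \<le> b then Some x else None)"

lemma local_op_stop_time: "local_op x (\<lambda>H g. stop_time f b H g x)"
proof (induction x)
  case 0
  then show ?case by (simp add: local_op_def)
next
  case (Suc x)
  define S where "S H p v = (case snd (p v) of Some y \<Rightarrow> Some y |
     None \<Rightarrow> if card (conflicts f H (fst \<circ> p) (snd \<circ> p) x v) \<le> b then Some x else None)"
    for H and p :: "nat \<Rightarrow> (nat \<times> bool) \<times> nat option" and v
  have "local_op (Suc 0) S"
  proof (rule local_op_one_round)
    fix E E' :: "(nat \<times> nat) set" and g g' :: "nat \<Rightarrow> (nat \<times> bool) \<times> nat option" and v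
    assume A: "nbrs E v = nbrs E' v" "\<And>u. u \<in> insert v (nbrs E v) \<Longrightarrow> g u = g' u"
    then have "conflicts f E (fst \<circ> g) (snd \<circ> g) x v = conflicts f E' (fst \<circ> g') (snd \<circ> g') x v"
      unfolding conflicts_def comp_def by (intro Collect_cong) (auto split: option.splits)
    then show "S E g v = S E' g' v" unfolding S_def using A(2)[of v] by simp
  qed
  moreover have "local_op x (\<lambda>H g v. (g v, stop_time f b H g x v))"
    by (intro local_op_pair local_op_input Suc)
  ultimately have "local_op (x + Suc 0) (\<lambda>H g. S H (\<lambda>v. (g v, stop_time f b H g x v)))"
    by (rule local_op_comp[rotated])
  moreover have "S H (\<lambda>v. (g v, stop_time f b H g x v)) = stop_time f b H g (Suc x)" for H g
    by (rule ext) (simp add: S_def comp_def)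
  ultimately show ?case by simp
qed

lemma stop_time_SomeD:
  assumes "stop_time f b H g x v = Some y"
  shows "y < x" "stop_time f b H g y v = None"
    "card (conflicts f H g (stop_time f b H g y) y v) \<le> b"
  using assms by (induction x) (auto split: option.splits if_splits simp: less_Suc_eq)

lemma stop_time_mono:
  assumes "stop_time f b H g x v = Some y" "x \<le> z"
  shows "stop_time f b H g z v = Some y"
  using assms(2,1) by (induction z rule: dec_induct) auto

lemma stop_time_eq:
  assumes "stop_time f b H g k v = Some y" "x \<le> k"
  shows "stop_time f b H g x v = (if y < x then Some y else None)"
proof (cases "stop_time f b H g x v")
  case None
  have "\<not> y < x"
  proof
    assume "y < x"
    have "stop_time f b H g (Suc y) v = Some y" using stop_time_SomeD[OF assms(1)] by simp
    then have "stop_time f b H g x v = Some y" by (rule stop_time_mono) (use \<open>y < x\<close> in simp)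
    then show False using None by simp
  qed
  then show ?thesis using None by simp
next
  case (Some z)
  then have "z = y" using stop_time_mono[OF Some assms(2)] assms(1) by simp
  then show ?thesis using Some stop_time_SomeD(1)[OF Some] by simp
qed

text \<open>Double counting of conflicts. A neighbour conflicts with v in at most t slots while it
  is active, since two functions rarely agree, and in at most t slots after it has stopped, since
  the function of v rarely takes a fixed value. A vertex turned away in all k slots would have at
  least k (b + 1) conflicts, against at most 2 t \<delta>.\<close>

lemma stop_time_defined:
  assumes f: "low_agreement m k t f" and k: "2 * t * \<delta> < k * (b + 1)"
    and H: "\<And>v. finite (nbrs H v)" and m: "\<And>v. fst (g v) < m" and pr: "proper_on H (fst \<circ> g)"
    and deg: "card {u \<in> nbrs H v. snd (g u)} \<le> \<delta>"
  shows "\<exists>y. stop_time f b H g k v = Some y"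
proof (rule ccontr)
  assume "\<nexists>y. stop_time f b H g k v = Some y"
  then have none: "stop_time f b H g k v = None" by auto
  let ?C = "\<lambda>x. conflicts f H g (stop_time f b H g x) x v"
  let ?U = "{u \<in> nbrs H v. snd (g u)}"
  have gt: "b + 1 \<le> card (?C x)" if "x < k" for x
  proof (rule ccontr)
    assume "\<not> b + 1 \<le> card (?C x)"
    then have "\<exists>y. stop_time f b H g (Suc x) v = Some y" by (auto split: option.splits)
    then show False using stop_time_mono[of f b H g "Suc x" v _ k] that none by auto
  qed
  have "k * (b + 1) = (\<Sum>x<k. b + 1)" by simp
  also have "\<dots> \<le> (\<Sum>x<k. card (?C x))" by (intro sum_mono gt) simp
  also have "\<dots> = (\<Sum>x<k. card {u \<in> ?U. u \<in> ?C x})"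
    by (intro sum.cong refl arg_cong[where f = card]) (auto simp: conflicts_def)
  also have "\<dots> = (\<Sum>u\<in>?U. card {x \<in> {..<k}. u \<in> ?C x})"
    by (rule sum_multicount_gen) (use H in auto)
  also have "\<dots> \<le> (\<Sum>u\<in>?U. 2 * t)"
  proof (rule sum_mono)
    fix u assume u: "u \<in> ?U"
    then have ne: "fst (g u) \<noteq> fst (g v)" using pr unfolding proper_on_def nbrs_def by fastforce
    \<comment> \<open>For a neighbour that never stops, \<open>c\<close> is an unspecified value;
      the bound on preimages holds for every value.\<close>
    define c where "c = f (fst (g u)) (the (stop_time f b H g k u))"
    let ?A = "{x. x < k \<and> (f (fst (g u)) x + 0) mod k = (f (fst (g v)) x + 0) mod k}"
    let ?B = "{x. x < k \<and> f (fst (g v)) x = c}"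
    have "{x \<in> {..<k}. u \<in> ?C x} \<subseteq> ?A \<union> ?B"
    proof
      fix x assume "x \<in> {x \<in> {..<k}. u \<in> ?C x}"
      then have x: "x < k" "u \<in> ?C x" by auto
      show "x \<in> ?A \<union> ?B"
      proof (cases "stop_time f b H g x u")
        case None
        then show ?thesis using x unfolding conflicts_def by auto
      next
        case (Some y)
        then have "stop_time f b H g k u = Some y" using stop_time_mono x by (metis less_imp_le)
        then show ?thesis using x Some unfolding conflicts_def c_def by auto
      qed
    qed
    then have "card {x \<in> {..<k}. u \<in> ?C x} \<le> card (?A \<union> ?B)" by (rule card_mono[rotated]) simp
    also have "\<dots> \<le> card ?A + card ?B" by (rule card_Un_le)
    also have "card ?A \<le> t" using f m ne unfolding low_agreement_def by (meson less_imp_le)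
    also have "card ?B \<le> t" using f m unfolding low_agreement_def by (meson less_imp_le)
    finally show "card {x \<in> {..<k}. u \<in> ?C x} \<le> 2 * t" by simp
  qed
  also have "\<dots> = card ?U * (2 * t)" by simp
  also have "\<dots> \<le> \<delta> * (2 * t)" using deg by (rule mult_le_mono1)
  finally show False using k by (simp add: ac_simps)
qed

text \<open>Edges inside a class are oriented towards the earlier stopping time, ties in both
  directions. A neighbour that stopped before v in the same class owned the class when v took it,
  and one that stopped in the same slot proposed it then; both are conflicts, of which v tolerated
  at most b. The number k counts slots and classes alike.\<close>

lemma arbdefective_colouring:
  assumes f: "low_agreement m k t f" and k: "2 * t * \<delta> < k * (b + 1)"
  shows "\<exists>G :: (nat \<times> nat) set \<Rightarrow> (nat \<Rightarrow> nat \<times> bool) \<Rightarrow> nat \<Rightarrow> nat \<times> nat. local_op k G \<and>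
    (\<forall>H g. (\<forall>v. finite (nbrs H v)) \<longrightarrow> (\<forall>v. fst (g v) < m) \<longrightarrow> proper_on H (fst \<circ> g) \<longrightarrow>
      (\<forall>v. snd (g v) \<longrightarrow> card {u \<in> nbrs H v. snd (g u)} \<le> \<delta>) \<longrightarrow>
      (\<forall>v. snd (g v) \<longrightarrow> snd (G H g v) < k \<and>
        card {u \<in> nbrs H v. snd (g u) \<and> snd (G H g u) = snd (G H g v) \<and> fst (G H g u) \<le> fst (G H g v)} \<le> b))"
proof -
  define \<tau> where "\<tau> H g v = the (stop_time f b H g k v)" for H g v
  define G where "G H g v = (\<tau> H g v, f (fst (g v)) (\<tau> H g v))" for H and g :: "nat \<Rightarrow> nat \<times> bool" and v
  have "local_op k (\<lambda>H g v. (stop_time f b H g k v, g v))"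
    by (rule local_op_pair[OF local_op_stop_time local_op_input])
  from local_op_map[OF this, of "\<lambda>(y, p). (the y, f (fst p) (the y))"]
  have "local_op k G" unfolding G_def \<tau>_def by simp
  moreover have "snd (G H g v) < k \<and>
        card {u \<in> nbrs H v. snd (g u) \<and> snd (G H g u) = snd (G H g v) \<and> fst (G H g u) \<le> fst (G H g v)} \<le> b"
    if H: "\<And>v. finite (nbrs H v)" and m: "\<And>v. fst (g v) < m" and pr: "proper_on H (fst \<circ> g)"
      and deg: "\<And>v. snd (g v) \<Longrightarrow> card {u \<in> nbrs H v. snd (g u)} \<le> \<delta>" and v: "snd (g v)" for H g v
  proof -
    have \<tau>: "stop_time f b H g k u = Some (\<tau> H g u)" if "snd (g u)" for u
      using stop_time_defined[OF f k H m pr deg[OF that]] unfolding \<tau>_def by auto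
    let ?x = "\<tau> H g v"
    note x = stop_time_SomeD[OF \<tau>[OF v]]
    have "{u \<in> nbrs H v. snd (g u) \<and> snd (G H g u) = snd (G H g v) \<and> fst (G H g u) \<le> fst (G H g v)}
        \<subseteq> conflicts f H g (stop_time f b H g ?x) ?x v"
    proof clarify
      fix u assume u: "u \<in> nbrs H v" "snd (g u)" "snd (G H g u) = snd (G H g v)" "fst (G H g u) \<le> fst (G H g v)"
      have "stop_time f b H g ?x u = (if \<tau> H g u < ?x then Some (\<tau> H g u) else None)"
        by (rule stop_time_eq[OF \<tau>[OF u(2)]]) (use x in simp)
      then show "u \<in> conflicts f H g (stop_time f b H g ?x) ?x v"
        using u unfolding conflicts_def G_def by (auto split: if_splits)
    qed
    then have "card {u \<in> nbrs H v. snd (g u) \<and> snd (G H g u) = snd (G H g v) \<and> fst (G H g u) \<le> fst (G H g v)}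
        \<le> card (conflicts f H g (stop_time f b H g ?x) ?x v)"
      by (rule card_mono[rotated]) (use H in \<open>auto simp: conflicts_def\<close>)
    also have "\<dots> \<le> b" by (rule x)
    finally show ?thesis using f m x unfolding low_agreement_def G_def by auto
  qed
  ultimately show ?thesis by blast
qed

section \<open>Colouring with degree plus one colours\<close>

type_synonym label = "nat \<times> nat \<times> nat \<times> nat option"

abbreviation "psi_of \<equiv> \<lambda>l::label. fst l"
abbreviation "time_of \<equiv> \<lambda>l::label. fst (snd l)"
abbreviation "class_of \<equiv> \<lambda>l::label. fst (snd (snd l))"
abbreviation "col_of \<equiv> \<lambda>l::label. snd (snd (snd l))"

section \<open>Palettes, shifts of the colour grid, and the step of one class\<close>

definition avail :: "nat \<Rightarrow> (nat \<times> nat) set \<Rightarrow> (nat \<Rightarrow> label) \<Rightarrow> nat \<Rightarrow> nat set" where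
  "avail h H L v = {c. c \<le> h \<and> (\<forall>u\<in>nbrs H v. col_of (L u) \<noteq> Some c)}"

definition uncoloured :: "(nat \<times> nat) set \<Rightarrow> (nat \<Rightarrow> nat option) \<Rightarrow> nat \<Rightarrow> nat set" where
  "uncoloured H c v = {u \<in> nbrs H v. c u = None}"

text \<open>Colours are read as points (c div q, c mod q) of a q by q grid; the shifts of the graph of a
  function partition the grid.\<close>

definition on_shift :: "(nat \<Rightarrow> nat \<Rightarrow> nat) \<Rightarrow> nat \<Rightarrow> nat \<Rightarrow> nat \<Rightarrow> nat \<Rightarrow> bool" where
  "on_shift f q i s c \<longleftrightarrow> c mod q = (f i (c div q) + s) mod q"

text \<open>v restricts itself to the part of its palette on one shift, chosen with at least the
  average share. Candidate sets of vertices with different \<open>psi_of\<close> values overlap in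
  few colours.\<close>

definition announce :: "(nat \<Rightarrow> nat \<Rightarrow> nat) \<Rightarrow> nat \<Rightarrow> nat \<Rightarrow> (nat \<times> nat) set \<Rightarrow> (nat \<Rightarrow> label) \<Rightarrow> nat \<Rightarrow> nat" where
  "announce f q h H L v =
     (SOME s. card (avail h H L v) \<le> q * card {c \<in> avail h H L v. on_shift f q (psi_of (L v)) s c})"

text \<open>The whole candidate set of an out-neighbour is avoided, not just the colour it takes,
  because both colours are chosen in the same round.\<close>

definition pick :: "(nat \<Rightarrow> nat \<Rightarrow> nat) \<Rightarrow> nat \<Rightarrow> nat \<Rightarrow> nat \<Rightarrow> nat \<Rightarrow> (nat \<times> nat) set \<Rightarrow>
    (nat \<Rightarrow> label) \<Rightarrow> (nat \<Rightarrow> nat) \<Rightarrow> nat \<Rightarrow> nat" where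
  "pick f q h \<theta> y H L s v =
     (SOME c. c \<in> avail h H L v \<and> on_shift f q (psi_of (L v)) (s v) c \<and>
        (\<forall>u\<in>nbrs H v. col_of (L u) = None \<and> class_of (L u) = y \<and> time_of (L u) \<le> time_of (L v)
           \<longrightarrow> \<not> on_shift f q (psi_of (L u)) (s u) c))"

text \<open>The threshold \<theta> guarantees a palette large enough for \<open>pick\<close>; a
  vertex below it waits for the next pass, which works with a smaller bound on uncoloured
  neighbours.\<close>

definition class_step :: "(nat \<Rightarrow> nat \<Rightarrow> nat) \<Rightarrow> nat \<Rightarrow> nat \<Rightarrow> nat \<Rightarrow> nat \<Rightarrow> (nat \<times> nat) set \<Rightarrow>
    (nat \<Rightarrow> label) \<Rightarrow> nat \<Rightarrow> nat option" where
  "class_step f q h \<theta> y H L v =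
     (if class_of (L v) = y \<and> col_of (L v) = None \<and> \<theta> \<le> card (uncoloured H (col_of \<circ> L) v)
      then Some (pick f q h \<theta> y H L (announce f q h H L) v) else col_of (L v))"

text \<open>One round to learn the colours around v and fix its shift, one to read the shifts of the
  neighbours.\<close>

lemma local_op_class_step: "local_op 2 (class_step f q h \<theta> y)"
proof -
  define S where "S H p v =
     (if class_of (fst (p v)) = y \<and> col_of (fst (p v)) = None \<and> \<theta> \<le> card (uncoloured H (col_of \<circ> fst \<circ> p) v)
      then Some (pick f q h \<theta> y H (fst \<circ> p) (snd \<circ> p) v) else col_of (fst (p v)))"
    for H and p :: "nat \<Rightarrow> label \<times> nat" and v
  have av: "avail h E g v = avail h E' g' v"
    if "nbrs E v = nbrs E' v" "\<And>u. u \<in> insert v (nbrs E v) \<Longrightarrow> g u = g' u" for E E' g g' v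
    unfolding avail_def using that by auto
  have "local_op (Suc 0) (announce f q h)"
  proof (rule local_op_one_round)
    fix E E' :: "(nat \<times> nat) set" and g g' :: "nat \<Rightarrow> label" and v
    assume A: "nbrs E v = nbrs E' v" "\<And>u. u \<in> insert v (nbrs E v) \<Longrightarrow> g u = g' u"
    show "announce f q h E g v = announce f q h E' g' v"
      unfolding announce_def using av[of E v E' g g'] A A(2)[of v] by simp
  qed
  then have "local_op (Suc 0) (\<lambda>H L v. (L v, announce f q h H L v))"
    by (rule local_op_pair[OF local_op_input])
  moreover have "local_op (Suc 0) S"
  proof (rule local_op_one_round)
    fix E E' :: "(nat \<times> nat) set" and g g' :: "nat \<Rightarrow> label \<times> nat" and v
    assume A: "nbrs E v = nbrs E' v" "\<And>u. u \<in> insert v (nbrs E v) \<Longrightarrow> g u = g' u"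
    have 1: "uncoloured E (col_of \<circ> fst \<circ> g) v = uncoloured E' (col_of \<circ> fst \<circ> g') v"
      unfolding uncoloured_def using A by auto
    have 2: "avail h E (fst \<circ> g) v = avail h E' (fst \<circ> g') v"
      by (rule av) (use A in auto)
    have 3: "g v = g' v" using A by simp
    have "pick f q h \<theta> y E (fst \<circ> g) (snd \<circ> g) v = pick f q h \<theta> y E' (fst \<circ> g') (snd \<circ> g') v"
      unfolding pick_def using 2 3 A by (simp add: comp_def)
    then show "S E g v = S E' g' v" unfolding S_def 1 using 3 by simp
  qed
  ultimately have "local_op (Suc 0 + Suc 0) (\<lambda>H L. S H (\<lambda>v. (L v, announce f q h H L v)))"
    by (rule local_op_comp)
  moreover have "S H (\<lambda>v. (L v, announce f q h H L v)) = class_step f q h \<theta> y H L" for H L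
    by (rule ext) (simp add: S_def class_step_def comp_def)
  ultimately show ?thesis by (simp add: numeral_2_eq_2)
qed

definition partial_proper :: "nat \<Rightarrow> (nat \<times> nat) set \<Rightarrow> (nat \<Rightarrow> nat option) \<Rightarrow> bool" where
  "partial_proper h H c \<longleftrightarrow> (\<forall>v a. c v = Some a \<longrightarrow> a \<le> h) \<and>
     (\<forall>u w a. (u, w) \<in> H \<longrightarrow> c u = Some a \<longrightarrow> c w \<noteq> Some a)"

text \<open>A colour missing from the palette is worn by a coloured neighbour, so of the h + 1
  colours at most h minus the number of uncoloured neighbours are lost.\<close>

lemma card_avail:
  assumes "degree_le H h"
  shows "card (uncoloured H (col_of \<circ> L) v) < card (avail h H L v)"
proof -
  let ?U = "uncoloured H (col_of \<circ> L) v" and ?N = "nbrs H v"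
  have fin: "finite ?N" and deg: "card ?N \<le> h" using assms unfolding degree_le_def by auto
  have "{..h} - avail h H L v \<subseteq> (\<lambda>u. the (col_of (L u))) ` (?N - ?U)"
  proof
    fix c assume "c \<in> {..h} - avail h H L v"
    then obtain u where u: "u \<in> ?N" "col_of (L u) = Some c" unfolding avail_def by auto
    then have "u \<in> ?N - ?U" unfolding uncoloured_def by simp
    then show "c \<in> (\<lambda>u. the (col_of (L u))) ` (?N - ?U)" using u by (intro image_eqI[of _ _ u]) auto
  qed
  then have "card ({..h} - avail h H L v) \<le> card (?N - ?U)"
    using fin by (meson card_image_le card_mono finite_Diff finite_imageI le_trans)
  moreover have "card (?N - ?U) = card ?N - card ?U" "card ?U \<le> card ?N"
    using fin by (auto simp: uncoloured_def intro!: card_Diff_subset card_mono)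
  moreover have "card ({..h} - avail h H L v) = Suc h - card (avail h H L v)"
    by (subst card_Diff_subset) (auto simp: avail_def)
  ultimately show ?thesis using deg by linarith
qed

text \<open>The q shifts of one function cover the grid, hence A, and some shift has at least the
  average share.\<close>

lemma exists_large_shift:
  assumes "finite A" "q \<ge> 1"
  shows "\<exists>s. card A \<le> q * card {c \<in> A. on_shift f q i s c}"
proof (rule ccontr)
  assume "\<not> ?thesis"
  then have lt: "q * card {c \<in> A. on_shift f q i s c} < card A" for s by (simp add: not_le)
  have "A \<subseteq> (\<Union>s<q. {c \<in> A. on_shift f q i s c})"
  proof
    fix c assume c: "c \<in> A"
    let ?w = "f i (c div q)"
    have "c mod q = (?w + (c mod q + (q - ?w mod q)) mod q) mod q"
      using mod_shift_cancel[of q "c mod q" ?w ?w "c mod q"] assms(2) by (simp add: add.commute)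
    then have "on_shift f q i ((c mod q + (q - ?w mod q)) mod q) c" unfolding on_shift_def .
    then show "c \<in> (\<Union>s<q. {c \<in> A. on_shift f q i s c})" using c assms(2) by auto
  qed
  then have "card A \<le> card (\<Union>s<q. {c \<in> A. on_shift f q i s c})"
    using assms(1) by (intro card_mono) auto
  also have "\<dots> \<le> (\<Sum>s<q. card {c \<in> A. on_shift f q i s c})" by (rule card_UN_le) simp
  finally have "q * card A \<le> (\<Sum>s<q. q * card {c \<in> A. on_shift f q i s c})"
    by (simp add: sum_distrib_left[symmetric])
  also have "\<dots> < (\<Sum>s<q. card A)" using lt assms(2) by (intro sum_strict_mono) (auto simp: lessThan_empty_iff)
  finally show False by simp
qed

text \<open>A colour on a shift is determined by its row \<open>c div q\<close>, and the row of a
  common colour is a point where the shifted functions agree. The bound on h keeps the rows below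
  q.\<close>

lemma card_common_shift:
  assumes f: "low_agreement m q t f" and ij: "i < m" "j < m" "i \<noteq> j" and h: "h < q * q"
  shows "card {c. c \<le> h \<and> on_shift f q i a c \<and> on_shift f q j b c} \<le> t"
proof -
  let ?X = "{c. c \<le> h \<and> on_shift f q i a c \<and> on_shift f q j b c}"
  let ?Y = "{x. x < q \<and> (f i x + a) mod q = (f j x + b) mod q}"
  have "inj_on (\<lambda>c. c div q) ?X"
  proof (rule inj_onI)
    fix c d assume "c \<in> ?X" "d \<in> ?X" "c div q = d div q"
    then have "c mod q = d mod q" "c div q = d div q" unfolding on_shift_def by auto
    then show "c = d" by (metis div_mult_mod_eq)
  qed
  moreover have "(\<lambda>c. c div q) ` ?X \<subseteq> ?Y"
    using h by (auto simp: on_shift_def intro: less_mult_imp_div_less le_less_trans)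
  ultimately have "card ?X \<le> card ?Y" by (intro card_inj_on_le) auto
  also have "\<dots> \<le> t" using f ij unfolding low_agreement_def by (meson less_imp_le)
  finally show ?thesis .
qed

text \<open>An acting vertex has more than \<theta> \<ge> q t b available colours, hence more than t
  b candidates, and each of its at most b out-neighbours excludes at most t of them. Of two adjacent
  acting vertices, one whose time is not earlier avoids all candidates of the other.\<close>

lemma class_step_correct:
  assumes f: "low_agreement m q t f" and q: "h < q * q" and b: "q * t * b \<le> \<theta>"
    and H: "sym H" "degree_le H h" and psi: "\<And>v. psi_of (L v) < m" "proper_on H (psi_of \<circ> L)"
    and pp: "partial_proper h H (col_of \<circ> L)"
    and out: "\<And>v. col_of (L v) = None \<Longrightarrow> class_of (L v) = y \<Longrightarrow>
      card {u \<in> nbrs H v. col_of (L u) = None \<and> class_of (L u) = y \<and> time_of (L u) \<le> time_of (L v)} \<le> b"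
  shows "partial_proper h H (class_step f q h \<theta> y H L)"
    and "\<And>v a. col_of (L v) = Some a \<Longrightarrow> class_step f q h \<theta> y H L v = Some a"
    and "\<And>v. class_of (L v) = y \<Longrightarrow> class_step f q h \<theta> y H L v = None \<Longrightarrow>
      card (uncoloured H (col_of \<circ> L) v) < \<theta>"
proof -
  let ?s = "announce f q h H L" and ?new = "class_step f q h \<theta> y H L"
  let ?P = "pick f q h \<theta> y H L ?s"
  define act where "act v \<longleftrightarrow> class_of (L v) = y \<and> col_of (L v) = None \<and>
      \<theta> \<le> card (uncoloured H (col_of \<circ> L) v)" for v
  have new: "?new v = (if act v then Some (?P v) else col_of (L v))" for v
    unfolding class_step_def act_def ..
  have q1: "q \<ge> 1" using q by (cases q) auto
  have P: "?P v \<in> avail h H L v \<and> on_shift f q (psi_of (L v)) (?s v) (?P v) \<and>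
        (\<forall>u\<in>nbrs H v. col_of (L u) = None \<and> class_of (L u) = y \<and> time_of (L u) \<le> time_of (L v)
           \<longrightarrow> \<not> on_shift f q (psi_of (L u)) (?s u) (?P v))" if v: "act v" for v
  proof -
    let ?A = "avail h H L v"
    let ?C = "{c \<in> ?A. on_shift f q (psi_of (L v)) (?s v) c}"
    let ?O = "{u \<in> nbrs H v. col_of (L u) = None \<and> class_of (L u) = y \<and> time_of (L u) \<le> time_of (L v)}"
    let ?B = "\<lambda>u. {c. c \<le> h \<and> on_shift f q (psi_of (L u)) (?s u) c \<and> on_shift f q (psi_of (L v)) (?s v) c}"
    have finA: "finite ?A" unfolding avail_def by simp
    have "card ?A \<le> q * card ?C"
      unfolding announce_def by (rule someI_ex[OF exists_large_shift[OF finA q1]])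
    moreover have "q * t * b < card ?A"
      using card_avail[OF H(2), of L v] v b unfolding act_def by linarith
    ultimately have "q * (t * b) < q * card ?C" by (metis mult.assoc order_less_le_trans)
    then have C: "t * b < card ?C" by simp
    have finO: "finite ?O" using H(2) unfolding degree_le_def by simp
    have "card (\<Union>u\<in>?O. ?B u) \<le> (\<Sum>u\<in>?O. card (?B u))" by (rule card_UN_le[OF finO])
    also have "\<dots> \<le> (\<Sum>u\<in>?O. t)"
    proof (rule sum_mono)
      fix u assume "u \<in> ?O"
      then have "psi_of (L u) \<noteq> psi_of (L v)" using psi(2) unfolding proper_on_def nbrs_def by fastforce
      then show "card (?B u) \<le> t" by (intro card_common_shift[OF f psi(1) psi(1) _ q])
    qed
    also have "\<dots> = card ?O * t" by simp
    also have "\<dots> \<le> b * t" using out[of v] v unfolding act_def by (intro mult_le_mono1) auto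
    also have "\<dots> < card ?C" using C by (simp add: mult.commute)
    finally have "\<not> ?C \<subseteq> (\<Union>u\<in>?O. ?B u)" using card_mono[of "\<Union>u\<in>?O. ?B u" ?C] finO by fastforce
    then obtain c where c: "c \<in> ?C" "c \<notin> (\<Union>u\<in>?O. ?B u)" by (meson subsetI)
    have "c \<le> h" using c(1) unfolding avail_def by simp
    define R where "R c \<longleftrightarrow> c \<in> ?A \<and> on_shift f q (psi_of (L v)) (?s v) c \<and>
        (\<forall>u\<in>nbrs H v. col_of (L u) = None \<and> class_of (L u) = y \<and> time_of (L u) \<le> time_of (L v)
           \<longrightarrow> \<not> on_shift f q (psi_of (L u)) (?s u) c)" for c
    have "R c" unfolding R_def using c \<open>c \<le> h\<close> by auto
    then have "R (SOME c. R c)" by (rule someI)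
    moreover have "?P v = (SOME c. R c)" unfolding pick_def R_def ..
    ultimately have "R (?P v)" by simp
    then show ?thesis unfolding R_def .
  qed
  have no_clash: "?P u \<noteq> ?P w" if uw: "(u, w) \<in> H" and a: "act u" "act w" and t: "time_of (L u) \<le> time_of (L w)" for u w
  proof -
    have "u \<in> nbrs H w" using uw H(1) unfolding nbrs_def sym_def by auto
    then have "\<not> on_shift f q (psi_of (L u)) (?s u) (?P w)" using P[OF a(2)] a(1) t unfolding act_def by blast
    then show ?thesis using P[OF a(1)] by metis
  qed
  have cases: "?new w \<noteq> Some a" if uw: "(u, w) \<in> H" and u: "?new u = Some a" for u w a
  proof
    assume w: "?new w = Some a"
    have wu: "(w, u) \<in> H" using uw H(1) unfolding sym_def by auto
    consider "act u" "act w" | "act u" "\<not> act w" | "\<not> act u" "act w" | "\<not> act u" "\<not> act w" by blast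
    then show False
    proof cases
      case 1
      then have "?P u = ?P w" using u w new by simp
      then show False using no_clash[OF uw 1] no_clash[OF wu 1(2,1)] by (metis nat_le_linear)
    next
      case 2
      then have "?P u = a" "col_of (L w) = Some a" using u w new by auto
      then show False using P[OF 2(1)] uw unfolding avail_def nbrs_def by auto
    next
      case 3
      then have "?P w = a" "col_of (L u) = Some a" using u w new by auto
      then show False using P[OF 3(2)] wu unfolding avail_def nbrs_def by auto
    next
      case 4
      then have "col_of (L u) = Some a" "col_of (L w) = Some a" using u w new by auto
      then show False using pp uw unfolding partial_proper_def by auto
    qed
  qed
  have "a \<le> h" if "?new v = Some a" for v a
    using that P[of v] pp unfolding new partial_proper_def avail_def by (auto split: if_splits)
  then show "partial_proper h H ?new" unfolding partial_proper_def using cases by blast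
  show "\<And>v a. col_of (L v) = Some a \<Longrightarrow> ?new v = Some a" unfolding new act_def by auto
  show "\<And>v. class_of (L v) = y \<Longrightarrow> ?new v = None \<Longrightarrow> card (uncoloured H (col_of \<circ> L) v) < \<theta>"
    unfolding new act_def by (auto split: if_splits simp: not_le)
qed

section \<open>A pass over all classes, and the halving of the uncoloured degree\<close>

primrec class_sweep :: "(nat \<Rightarrow> nat \<Rightarrow> nat) \<Rightarrow> nat \<Rightarrow> nat \<Rightarrow> nat \<Rightarrow> nat \<Rightarrow> (nat \<times> nat) set \<Rightarrow>
    (nat \<Rightarrow> label) \<Rightarrow> nat \<Rightarrow> nat option" where
  "class_sweep f q h \<theta> 0 H L = (\<lambda>v. col_of (L v))" |
  "class_sweep f q h \<theta> (Suc y) H L =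
     class_step f q h \<theta> y H (\<lambda>v. (psi_of (L v), time_of (L v), class_of (L v), class_sweep f q h \<theta> y H L v))"

lemma local_op_class_sweep: "local_op (2 * y) (class_sweep f q h \<theta> y)"
proof (induction y)
  case 0
  have "local_op 0 (\<lambda>(H::(nat \<times> nat) set) L v. col_of (L v))" by (rule local_op_input)
  moreover have "class_sweep f q h \<theta> 0 = (\<lambda>H L v. col_of (L v))" by (intro ext) simp
  ultimately show ?case by simp
next
  case (Suc y)
  have "local_op (2 * y) (\<lambda>(H::(nat \<times> nat) set) L v. (L v, class_sweep f q h \<theta> y H L v))"
    by (rule local_op_pair[OF local_op_input Suc])
  from local_op_map[OF this, of "\<lambda>(l, c). (psi_of l, time_of l, class_of l, c)"]
  have "local_op (2 * y) (\<lambda>H L v. (psi_of (L v), time_of (L v), class_of (L v), class_sweep f q h \<theta> y H L v))"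
    by simp
  from local_op_comp[OF this local_op_class_step[of f q h \<theta> y]]
  have "local_op (2 * Suc y) (\<lambda>H L. class_step f q h \<theta> y H
      (\<lambda>v. (psi_of (L v), time_of (L v), class_of (L v), class_sweep f q h \<theta> y H L v)))"
    by simp
  moreover have "class_sweep f q h \<theta> (Suc y) = (\<lambda>H L. class_step f q h \<theta> y H
      (\<lambda>v. (psi_of (L v), time_of (L v), class_of (L v), class_sweep f q h \<theta> y H L v)))"
    by (intro ext) simp
  ultimately show ?case by metis
qed

text \<open>A vertex passed over at its turn had fewer than \<theta> uncoloured neighbours, a number
  that only falls later. The outdegree bound survives the sweep because the set of uncoloured
  vertices shrinks.\<close>

lemma class_sweep_correct:
  assumes f: "low_agreement m q t f" and q: "h < q * q" and b: "q * t * b \<le> \<theta>"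
    and H: "sym H" "degree_le H h" and psi: "\<And>v. psi_of (L v) < m" "proper_on H (psi_of \<circ> L)"
    and pp: "partial_proper h H (col_of \<circ> L)"
    and out: "\<And>v. col_of (L v) = None \<Longrightarrow>
      card {u \<in> nbrs H v. col_of (L u) = None \<and> class_of (L u) = class_of (L v) \<and> time_of (L u) \<le> time_of (L v)} \<le> b"
  shows "partial_proper h H (class_sweep f q h \<theta> k H L) \<and>
    (\<forall>v a. col_of (L v) = Some a \<longrightarrow> class_sweep f q h \<theta> k H L v = Some a) \<and>
    (\<forall>v. class_of (L v) < k \<longrightarrow> class_sweep f q h \<theta> k H L v = None \<longrightarrow>
      card (uncoloured H (class_sweep f q h \<theta> k H L) v) < \<theta>)"
proof (induction k)
  case 0
  then show ?case using pp by (simp add: comp_def)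
next
  case (Suc k)
  let ?c = "class_sweep f q h \<theta> k H L" and ?c' = "class_sweep f q h \<theta> (Suc k) H L"
  let ?L = "\<lambda>v. (psi_of (L v), time_of (L v), class_of (L v), ?c v)"
  have fin: "finite (nbrs H v)" for v using H unfolding degree_le_def by simp
  have keep: "?c v = Some a" if "col_of (L v) = Some a" for v a using Suc that by blast
  have out': "card {u \<in> nbrs H v. col_of (?L u) = None \<and> class_of (?L u) = k \<and> time_of (?L u) \<le> time_of (?L v)} \<le> b"
    if v: "col_of (?L v) = None" "class_of (?L v) = k" for v
  proof -
    have "col_of (L v) = None" using v keep by (cases "col_of (L v)") auto
    moreover have "col_of (L u) = None" if "?c u = None" for u using that keep by (cases "col_of (L u)") auto
    then have "{u \<in> nbrs H v. col_of (?L u) = None \<and> class_of (?L u) = k \<and> time_of (?L u) \<le> time_of (?L v)}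
      \<subseteq> {u \<in> nbrs H v. col_of (L u) = None \<and> class_of (L u) = class_of (L v) \<and> time_of (L u) \<le> time_of (L v)}"
      using v by auto
    then have "card {u \<in> nbrs H v. col_of (?L u) = None \<and> class_of (?L u) = k \<and> time_of (?L u) \<le> time_of (?L v)}
      \<le> card {u \<in> nbrs H v. col_of (L u) = None \<and> class_of (L u) = class_of (L v) \<and> time_of (L u) \<le> time_of (L v)}"
      by (rule card_mono[rotated]) (use fin in simp)
    ultimately show ?thesis using out[of v] by linarith
  qed
  have psi': "\<And>v. psi_of (?L v) < m" "proper_on H (psi_of \<circ> ?L)" using psi by (simp_all add: comp_def)
  have pp': "partial_proper h H (col_of \<circ> ?L)" using Suc by (simp add: comp_def)
  note step = class_step_correct[OF f q b H psi' pp' out']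
  have keep': "?c' v = Some a" if "?c v = Some a" for v a using step(2) that by simp
  have "uncoloured H ?c' v \<subseteq> uncoloured H ?c v" for v
  proof -
    have "?c u = None" if "?c' u = None" for u using that keep'[of u] by (cases "?c u") auto
    then show ?thesis unfolding uncoloured_def by auto
  qed
  then have mono: "card (uncoloured H ?c' v) \<le> card (uncoloured H ?c v)" for v
    by (intro card_mono) (auto simp: uncoloured_def fin)
  have "card (uncoloured H ?c' v) < \<theta>" if v: "class_of (L v) < Suc k" "?c' v = None" for v
  proof (cases "class_of (L v) = k")
    case True
    then have "card (uncoloured H (col_of \<circ> ?L) v) < \<theta>" using step(3)[of v] v by simp
    then show ?thesis using mono[of v] by (simp add: comp_def)
  next
    case False
    have "?c v = None" using v keep'[of v] by (cases "?c v") auto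
    then have "card (uncoloured H ?c v) < \<theta>" using Suc False v by simp
    then show ?thesis using mono[of v] by simp
  qed
  moreover have "partial_proper h H ?c'" using step(1) by simp
  ultimately show ?case using keep keep' by blast
qed

text \<open>One pass takes k slots to form the classes and two rounds for each of the k classes. The
  outdegree b is about \<delta> / (2 q t), so a class step, which requires q t b \<le> \<theta>, can
  use half of \<delta> as threshold; this dictates k = 4 q t^2.\<close>

lemma colouring_phase:
  assumes f: "low_agreement m q t f" "low_agreement m k t f'" and k: "k = 4 * q * t * t" "t \<ge> 1"
    and q: "h < q * q"
  shows "\<exists>G :: (nat \<times> nat) set \<Rightarrow> (nat \<Rightarrow> nat \<times> nat option) \<Rightarrow> nat \<Rightarrow> nat option. local_op (3 * k) G \<and>
    (\<forall>H g. sym H \<longrightarrow> degree_le H h \<longrightarrow> (\<forall>v. fst (g v) < m) \<longrightarrow> proper_on H (fst \<circ> g) \<longrightarrow>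
      partial_proper h H (snd \<circ> g) \<longrightarrow>
      (\<forall>v. snd (g v) = None \<longrightarrow> card (uncoloured H (snd \<circ> g) v) \<le> \<delta>) \<longrightarrow>
      partial_proper h H (G H g) \<and>
      (\<forall>v. G H g v = None \<longrightarrow> card (uncoloured H (G H g) v) < (\<delta> + 1) div 2))"
proof -
  \<comment> \<open>The smallest b that the double counting in \<open>stop_time_defined\<close>
    permits.\<close>
  define b where "b = 2 * t * \<delta> div k"
  have q1: "q \<ge> 1" using q by (cases q) auto
  have k0: "k > 0" using q1 k by simp
  have kb: "2 * t * \<delta> < k * (b + 1)"
    using dividend_less_times_div[OF k0, of "2 * t * \<delta>"] unfolding b_def by (simp add: algebra_simps)
  have bth: "q * t * b \<le> (\<delta> + 1) div 2"
  proof -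
    have "b = (2 * t) * \<delta> div ((2 * t) * (2 * q * t))" unfolding b_def k by (simp add: ac_simps)
    also have "\<dots> = \<delta> div (2 * q * t)" using k(2) by (intro div_mult_mult1) simp
    finally have "(2 * q * t) * b \<le> \<delta>" by (simp add: times_div_less_eq_dividend)
    then show ?thesis by simp
  qed
  obtain A where A: "local_op k A" "\<And>H g v. (\<And>v. finite (nbrs H v)) \<Longrightarrow> (\<And>v. fst (g v) < m) \<Longrightarrow>
      proper_on H (fst \<circ> g) \<Longrightarrow> (\<And>v. snd (g v) \<Longrightarrow> card {u \<in> nbrs H v. snd (g u)} \<le> \<delta>) \<Longrightarrow> snd (g v) \<Longrightarrow>
      snd (A H g v :: nat \<times> nat) < k \<and>
      card {u \<in> nbrs H v. snd (g u) \<and> snd (A H g u) = snd (A H g v) \<and> fst (A H g u) \<le> fst (A H g v)} \<le> b"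
    using arbdefective_colouring[OF f(2) kb] by blast
  define A' where "A' H g = A H (\<lambda>v. (fst (g v), snd (g v) = None))"
    for H and g :: "nat \<Rightarrow> nat \<times> nat option"
  define Lb where "Lb H g v = (fst (g v), fst (A' H g v), snd (A' H g v), snd (g v))"
    for H and g :: "nat \<Rightarrow> nat \<times> nat option" and v
  define G where "G H g = class_sweep f q h ((\<delta> + 1) div 2) k H (Lb H g)" for H g
  have "local_op k A'"
    using local_op_comp[OF local_op_input[of 0 "\<lambda>p. (fst p, snd p = (None :: nat option))"] A(1)]
    unfolding A'_def by simp
  then have "local_op k (\<lambda>H g v. (g v, A' H g v))" by (rule local_op_pair[OF local_op_input])
  from local_op_map[OF this, of "\<lambda>(p, a). (fst p, fst a, snd a, snd p)"]
  have "local_op k Lb" unfolding Lb_def by simp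
  from local_op_comp[OF this local_op_class_sweep[of k f q h "(\<delta> + 1) div 2"]]
  have "local_op (3 * k) G" unfolding G_def by simp
  moreover have "partial_proper h H (G H g) \<and>
      (\<forall>v. G H g v = None \<longrightarrow> card (uncoloured H (G H g) v) < (\<delta> + 1) div 2)"
    if H: "sym H" "degree_le H h" and psi: "\<And>v. fst (g v) < m" "proper_on H (fst \<circ> g)"
      and pp: "partial_proper h H (snd \<circ> g)"
      and unc: "\<And>v. snd (g v) = None \<Longrightarrow> card (uncoloured H (snd \<circ> g) v) \<le> \<delta>" for H g
  proof -
    have fin: "finite (nbrs H v)" for v using H unfolding degree_le_def by simp
    have arb: "snd (A' H g v) < k \<and> card {u \<in> nbrs H v. snd (g u) = None \<and>
        snd (A' H g u) = snd (A' H g v) \<and> fst (A' H g u) \<le> fst (A' H g v)} \<le> b" if "snd (g v) = None" for v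
      using A(2)[of H "\<lambda>v. (fst (g v), snd (g v) = None)" v] fin psi unc that
      unfolding A'_def uncoloured_def by (simp add: comp_def)
    have "partial_proper h H (class_sweep f q h ((\<delta> + 1) div 2) k H (Lb H g)) \<and>
      (\<forall>v a. col_of (Lb H g v) = Some a \<longrightarrow> class_sweep f q h ((\<delta> + 1) div 2) k H (Lb H g) v = Some a) \<and>
      (\<forall>v. class_of (Lb H g v) < k \<longrightarrow> class_sweep f q h ((\<delta> + 1) div 2) k H (Lb H g) v = None \<longrightarrow>
        card (uncoloured H (class_sweep f q h ((\<delta> + 1) div 2) k H (Lb H g)) v) < (\<delta> + 1) div 2)"
      by (rule class_sweep_correct[OF f(1) q bth H])
        (use psi pp arb in \<open>simp_all add: Lb_def comp_def\<close>)
    then have c: "partial_proper h H (G H g)" "\<And>v a. snd (g v) = Some a \<Longrightarrow> G H g v = Some a"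
      "\<And>v. snd (A' H g v) < k \<Longrightarrow> G H g v = None \<Longrightarrow> card (uncoloured H (G H g) v) < (\<delta> + 1) div 2"
      unfolding G_def by (simp_all add: Lb_def)
    have "snd (g v) = None" if "G H g v = None" for v using c(2)[of v] that by (cases "snd (g v)") auto
    then show ?thesis using c(1,3) arb by blast
  qed
  ultimately show ?thesis by blast
qed

text \<open>Each pass halves the bound on the uncoloured neighbours of an uncoloured vertex. The
  factorial condition provides both families: functions on k points for slots and classes, and
  functions on q \<le> k points for the colour grid.\<close>

lemma degree_plus_one_colouring:
  assumes t: "(m + 1) * (4 * q * t * t) < fact t" "t \<ge> 1" and q: "h < q * q" and J: "h < 2 ^ J"
  shows "\<exists>G. local_op ((J + 1) * (3 * (4 * q * t * t))) G \<and>
    (\<forall>H \<psi>. sym H \<longrightarrow> degree_le H h \<longrightarrow> (\<forall>v. \<psi> v < m) \<longrightarrow> proper_on H \<psi> \<longrightarrow>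
      (\<forall>v. G H \<psi> v \<le> h) \<and> proper_on H (G H \<psi>))"
proof -
  define k where "k = 4 * q * t * t"
  have q1: "q \<ge> 1" using q by (cases q) auto
  have k1: "k \<ge> 1" using q1 t unfolding k_def by simp
  have "q * 1 \<le> q * (4 * t * t)" using t(2) by (intro mult_le_mono2) simp
  then have "q \<le> k" unfolding k_def by (simp add: ac_simps)
  then have "(m + 1) * q \<le> (m + 1) * k" by (rule mult_le_mono2)
  then have "(m + 1) * q < fact t" using t(1) unfolding k_def by linarith
  then obtain f where f: "low_agreement m q t f" using exists_low_agreement[OF q1] by blast
  obtain f' where f': "low_agreement m k t f'" using exists_low_agreement[OF k1] t(1) unfolding k_def by blast
  note phase = colouring_phase[OF f f' k_def t(2) q]
  define ok where "ok i e F \<longleftrightarrow> local_op (i * (3 * k)) F \<and>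
      (\<forall>H \<psi>. sym H \<longrightarrow> degree_le H h \<longrightarrow> (\<forall>v. \<psi> v < m) \<longrightarrow> proper_on H \<psi> \<longrightarrow>
        partial_proper h H (F H \<psi>) \<and> (\<forall>v. F H \<psi> v = None \<longrightarrow> card (uncoloured H (F H \<psi>) v) < e))"
    for i e and F :: "(nat \<times> nat) set \<Rightarrow> (nat \<Rightarrow> nat) \<Rightarrow> nat \<Rightarrow> nat option"
  have step: "\<exists>G. ok (i + 1) ((d + 1) div 2) G" if F: "ok i (d + 1) F" for i d F
  proof -
    obtain P :: "(nat \<times> nat) set \<Rightarrow> (nat \<Rightarrow> nat \<times> nat option) \<Rightarrow> nat \<Rightarrow> nat option"
      where P: "local_op (3 * k) P" "\<And>H g. sym H \<Longrightarrow> degree_le H h \<Longrightarrow> (\<forall>v. fst (g v) < m) \<Longrightarrow>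
        proper_on H (fst \<circ> g) \<Longrightarrow> partial_proper h H (snd \<circ> g) \<Longrightarrow>
        (\<forall>v. snd (g v) = None \<longrightarrow> card (uncoloured H (snd \<circ> g) v) \<le> d) \<Longrightarrow>
        partial_proper h H (P H g) \<and> (\<forall>v. P H g v = None \<longrightarrow> card (uncoloured H (P H g) v) < (d + 1) div 2)"
      using phase[of d] by blast
    define G where "G H \<psi> = P H (\<lambda>v. (\<psi> v, F H \<psi> v))" for H \<psi>
    have "local_op (i * (3 * k)) F" using F unfolding ok_def by blast
    then have "local_op (i * (3 * k)) (\<lambda>H \<psi> v. (\<psi> v, F H \<psi> v))"
      by (rule local_op_pair[OF local_op_input])
    from local_op_comp[OF this P(1)] have "local_op ((i + 1) * (3 * k)) G"
      unfolding G_def by (simp add: algebra_simps)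
    moreover have "partial_proper h H (G H \<psi>) \<and>
        (\<forall>v. G H \<psi> v = None \<longrightarrow> card (uncoloured H (G H \<psi>) v) < (d + 1) div 2)"
      if "sym H" "degree_le H h" "\<forall>v. \<psi> v < m" "proper_on H \<psi>" for H \<psi>
    proof -
      have "partial_proper h H (F H \<psi>)"
        "\<And>v. F H \<psi> v = None \<Longrightarrow> card (uncoloured H (F H \<psi>) v) < d + 1"
        using F that unfolding ok_def by blast+
      then show ?thesis
        unfolding G_def by (intro P(2)) (use that in \<open>simp_all add: comp_def less_Suc_eq_le\<close>)
    qed
    ultimately show ?thesis unfolding ok_def by blast
  qed
  \<comment> \<open>The bound in \<open>ok\<close> is strict, so d + 1 stands for at most d; (d + 1)
    div 2 \<le> d div 2 + 1 restores this form after a pass.\<close>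
  have "\<exists>F. ok i (h div 2 ^ i + 1) F" for i
  proof (induction i)
    case 0
    have "card (uncoloured H c v) < h + 1" if "degree_le H h" for H c v
    proof -
      have "card (uncoloured H c v) \<le> card (nbrs H v)"
        using that unfolding degree_le_def uncoloured_def by (intro card_mono) auto
      then show ?thesis using that unfolding degree_le_def by (meson le_trans less_add_one le_less_trans)
    qed
    then have "ok 0 (h div 2 ^ 0 + 1) (\<lambda>H \<psi> v. None)"
      unfolding ok_def by (simp add: local_op_def partial_proper_def)
    then show ?case by blast
  next
    case (Suc i)
    then obtain F where "ok i (h div 2 ^ i + 1) F" by blast
    then obtain G where G: "ok (Suc i) ((h div 2 ^ i + 1) div 2) G" using step[of i _ F] by auto
    have "h div 2 ^ Suc i = h div 2 ^ i div 2" by (simp only: power_Suc2 div_mult2_eq)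
    then have "(h div 2 ^ i + 1) div 2 \<le> h div 2 ^ Suc i + 1" by linarith
    then have "ok (Suc i) (h div 2 ^ Suc i + 1) G" using G unfolding ok_def by (meson less_le_trans)
    then show ?case by blast
  qed
  then obtain F where F: "ok J (h div 2 ^ J + 1) F" by blast
  \<comment> \<open>After J passes no uncoloured vertex has an uncoloured neighbour. One more pass
    gives the strict bound 0, which no vertex can meet, so none is left uncoloured.\<close>
  obtain G where G: "ok (J + 1) ((h div 2 ^ J + 1) div 2) G" using step[OF F] by blast
  have zero: "(h div 2 ^ J + 1) div 2 = 0" using J by simp
  have "(\<forall>v. the (G H \<psi> v) \<le> h) \<and> proper_on H (\<lambda>v. the (G H \<psi> v))"
    if "sym H" "degree_le H h" "\<forall>v. \<psi> v < m" "proper_on H \<psi>" for H \<psi>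
  proof -
    have pp: "partial_proper h H (G H \<psi>)" and "\<And>v. G H \<psi> v \<noteq> None"
      using G that unfolding zero ok_def by auto
    then have "G H \<psi> v = Some (the (G H \<psi> v))" for v by simp
    then show ?thesis using pp unfolding partial_proper_def proper_on_def by metis
  qed
  moreover have "local_op ((J + 1) * (3 * k)) G" using G unfolding ok_def by blast
  ultimately show ?thesis
    using local_op_map[of _ G the] unfolding k_def
    by (intro exI[of _ "\<lambda>H \<psi> v. the (G H \<psi> v)"]) simp
qed

section \<open>Clique connectors\<close>

text \<open>The sets are cliques although this is not stated: every member u of C has C in
  \<open>K u\<close>, so C lies within u and its neighbours. The conditions also concern numbers
  that are no vertices.\<close>

definition clique_cover :: "(nat \<times> nat) set \<Rightarrow> nat \<Rightarrow> nat \<Rightarrow> (nat \<Rightarrow> nat set set) \<Rightarrow> bool" where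
  "clique_cover E D S K \<longleftrightarrow>
     (\<forall>v. finite (K v) \<and> card (K v) \<le> D \<and>
        (\<forall>C\<in>K v. v \<in> C \<and> C \<subseteq> insert v (nbrs E v) \<and> card C \<le> S \<and> (\<forall>u\<in>C. C \<in> K u))) \<and>
     (\<forall>u w. (u, w) \<in> E \<longrightarrow> (\<exists>C\<in>K u. w \<in> C))"

text \<open>Ordering by ID lets all members of C derive the same blocks from the colours within
  C.\<close>

definition rank_in :: "(nat \<Rightarrow> nat) \<Rightarrow> nat set \<Rightarrow> nat \<Rightarrow> nat" where
  "rank_in \<phi> C u = card {w \<in> C. \<phi> w = \<phi> u \<and> w < u}"

text \<open>The block graph, formed inside each current colour class. Intersecting with E makes it a
  subgraph for every relation E and family K, as the simulation requires.\<close>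

definition connector :: "(nat \<times> nat) set \<Rightarrow> (nat \<Rightarrow> nat set set) \<Rightarrow> (nat \<Rightarrow> nat) \<Rightarrow> nat \<Rightarrow> (nat \<times> nat) set" where
  "connector E K \<phi> t = {(u, w) \<in> E. u \<noteq> w \<and> \<phi> u = \<phi> w \<and>
     (\<exists>C\<in>K u. w \<in> C \<and> rank_in \<phi> C u div t = rank_in \<phi> C w div t)}"

definition class_clique_le :: "(nat \<Rightarrow> nat set set) \<Rightarrow> (nat \<Rightarrow> nat) \<Rightarrow> nat \<Rightarrow> bool" where
  "class_clique_le K \<phi> s \<longleftrightarrow> (\<forall>v. \<forall>C\<in>K v. \<forall>c. card {u \<in> C. \<phi> u = c} \<le> s)"

lemma inj_on_rank_in:
  assumes "finite C"
  shows "inj_on (rank_in \<phi> C) {w \<in> C. \<phi> w = c}"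
proof -
  have "rank_in \<phi> C u < rank_in \<phi> C w" if "u \<in> C" "w \<in> C" "\<phi> u = c" "\<phi> w = c" "u < w" for u w
    unfolding rank_in_def using assms that by (intro psubset_card_mono) auto
  then show ?thesis by (intro inj_onI) (metis (mono_tags, lifting) mem_Collect_eq nat_neq_iff)
qed

lemma sym_connector:
  assumes "sym E" "clique_cover E D S K"
  shows "sym (connector E K \<phi> t)"
proof (rule symI)
  fix u w assume "(u, w) \<in> connector E K \<phi> t"
  then obtain C where "(u, w) \<in> E" "u \<noteq> w" "\<phi> u = \<phi> w" "C \<in> K u" "w \<in> C"
    "rank_in \<phi> C u div t = rank_in \<phi> C w div t" unfolding connector_def by auto
  moreover from this have "(w, u) \<in> E" "C \<in> K w" "u \<in> C"
    using assms unfolding sym_def clique_cover_def by blast+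
  ultimately show "(w, u) \<in> connector E K \<phi> t" unfolding connector_def by auto
qed

lemma finite_cover_clique:
  assumes "degree_le E \<Delta>" "clique_cover E D S K" "C \<in> K v"
  shows "finite C"
proof (rule finite_subset)
  show "C \<subseteq> insert v (nbrs E v)" using assms unfolding clique_cover_def by blast
  show "finite (insert v (nbrs E v))" using assms unfolding degree_le_def by simp
qed

text \<open>In each of its at most D cliques a vertex shares its block with at most t - 1 others.
  The minimum with \<Delta> keeps all later logarithms in terms of the maximum degree.\<close>

lemma degree_connector:
  assumes "degree_le E \<Delta>" "clique_cover E D S K" "t \<ge> 1"
  shows "degree_le (connector E K \<phi> t) (min \<Delta> (D * (t - 1)))"
  unfolding degree_le_def
proof (intro allI conjI)
  fix u
  let ?N = "nbrs (connector E K \<phi> t) u"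
  have sub: "?N \<subseteq> nbrs E u" unfolding nbrs_def connector_def by auto
  have fin: "finite (nbrs E u)" "card (nbrs E u) \<le> \<Delta>" using assms unfolding degree_le_def by auto
  show "finite ?N" by (rule finite_subset[OF sub fin(1)])
  have "card ?N \<le> \<Delta>" using card_mono[OF fin(1) sub] fin(2) by simp
  define B where "B C = {w \<in> C. \<phi> w = \<phi> u \<and> rank_in \<phi> C w div t = rank_in \<phi> C u div t} - {u}" for C
  have K: "finite (K u)" "card (K u) \<le> D" using assms unfolding clique_cover_def by auto
  have finC: "finite C" if "C \<in> K u" for C using finite_cover_clique[OF assms(1,2) that] .
  have cB: "card (B C) \<le> t - 1" if C: "C \<in> K u" for C
  proof -
    let ?X = "{w \<in> C. \<phi> w = \<phi> u \<and> rank_in \<phi> C w div t = rank_in \<phi> C u div t}"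
    let ?b = "rank_in \<phi> C u div t"
    have "inj_on (rank_in \<phi> C) ?X" by (rule inj_on_subset[OF inj_on_rank_in[OF finC[OF C]]]) auto
    moreover have "rank_in \<phi> C ` ?X \<subseteq> {?b * t..<?b * t + t}"
    proof clarify
      fix w assume "rank_in \<phi> C w div t = ?b"
      then show "rank_in \<phi> C w \<in> {?b * t..<?b * t + t}"
        using assms(3) dividend_less_div_times[of t "rank_in \<phi> C w"] div_times_less_eq_dividend[of "rank_in \<phi> C w" t]
        by (auto simp: algebra_simps)
    qed
    ultimately have "card ?X \<le> t" using card_inj_on_le[of "rank_in \<phi> C" ?X "{?b * t..<?b * t + t}"] by simp
    moreover have "u \<in> C" using assms(2) C unfolding clique_cover_def by blast
    then have "u \<in> ?X" by simp
    moreover have "finite ?X" using finC[OF C] by simp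
    ultimately show ?thesis unfolding B_def by simp
  qed
  have "?N \<subseteq> (\<Union>C\<in>K u. B C)" unfolding nbrs_def connector_def B_def by auto
  then have "card ?N \<le> card (\<Union>C\<in>K u. B C)"
    using K finC by (intro card_mono) (auto simp: B_def)
  also have "\<dots> \<le> (\<Sum>C\<in>K u. card (B C))" by (rule card_UN_le[OF K(1)])
  also have "\<dots> \<le> (\<Sum>C\<in>K u. t - 1)" by (rule sum_mono[OF cB])
  also have "\<dots> \<le> D * (t - 1)" using K(2) by simp
  finally show "card ?N \<le> min \<Delta> (D * (t - 1))" using \<open>card ?N \<le> \<Delta>\<close> by simp
qed

text \<open>Members of C with equal \<phi> in one block are pairwise adjacent in the connector, so
  \<chi> separates them: each new class has at most one member per block. The pair of colours is
  recovered from its code by div and mod with P.\<close>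

lemma class_clique_le_refine:
  assumes E: "degree_le E \<Delta>" and K: "clique_cover E D S K" and t: "t \<ge> 1"
    and s: "class_clique_le K \<phi> s"
    and chi: "\<And>v. \<chi> v < P" "proper_on (connector E K \<phi> t) \<chi>"
  shows "class_clique_le K (\<lambda>v. \<phi> v * P + \<chi> v) ((s + t - 1) div t)"
  unfolding class_clique_le_def
proof (intro allI ballI)
  fix v C c assume C: "C \<in> K v"
  let ?X = "{u \<in> C. \<phi> u * P + \<chi> u = c}"
  have finC: "finite C" using finite_cover_clique[OF E K C] .
  have X: "\<phi> u = c div P" "\<chi> u = c mod P" if "u \<in> ?X" for u
    using that chi(1)[of u] by auto
  have "inj_on (\<lambda>u. rank_in \<phi> C u div t) ?X"
  proof (rule inj_onI)
    fix u w assume uw: "u \<in> ?X" "w \<in> ?X" "rank_in \<phi> C u div t = rank_in \<phi> C w div t"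
    have CK: "C \<in> K u" "C \<subseteq> insert u (nbrs E u)" using K C uw unfolding clique_cover_def by blast+
    show "u = w"
    proof (rule ccontr)
      assume "u \<noteq> w"
      then have "(u, w) \<in> E" using CK uw unfolding nbrs_def by auto
      then have "(u, w) \<in> connector E K \<phi> t"
        using CK uw X[OF uw(1)] X[OF uw(2)] \<open>u \<noteq> w\<close> unfolding connector_def by auto
      then show False using chi(2) X[OF uw(1)] X[OF uw(2)] unfolding proper_on_def by metis
    qed
  qed
  \<comment> \<open>Ranks below s fall into blocks numbered from 0, as many as s / t rounded
    up.\<close>
  moreover have "(\<lambda>u. rank_in \<phi> C u div t) ` ?X \<subseteq> {..<(s + t - 1) div t}"
  proof (rule image_subsetI)
    fix u assume u: "u \<in> ?X"
    have "rank_in \<phi> C u < card {w \<in> C. \<phi> w = \<phi> u}"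
      unfolding rank_in_def using u finC by (intro psubset_card_mono) auto
    also have "\<dots> \<le> s" using s C unfolding class_clique_le_def by blast
    finally have r: "rank_in \<phi> C u < s" .
    then have "rank_in \<phi> C u div t \<le> (s - 1) div t" by (intro div_le_mono) simp
    also have "\<dots> < (s - 1 + t) div t" using t by simp
    also have "s - 1 + t = s + t - 1" using r by simp
    finally show "rank_in \<phi> C u div t \<in> {..<(s + t - 1) div t}" by simp
  qed
  ultimately show "card ?X \<le> (s + t - 1) div t"
    using card_inj_on_le[of "\<lambda>u. rank_in \<phi> C u div t" ?X "{..<(s + t - 1) div t}"] by simp
qed

text \<open>Ranks in a clique at v involve only colours of v and its neighbours, so one round beyond
  the computation of F suffices.\<close>

lemma locally_determined_connector:
  assumes K: "locally_determined 2 K" "\<And>E v C. C \<in> K E v \<Longrightarrow> v \<in> C \<and> C \<subseteq> insert v (nbrs E v)"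
    and F: "locally_determined r F" "1 \<le> r"
  shows "locally_determined (r + 1) (\<lambda>E. nbrs (connector E (K E) (F E) t))"
proof (rule locally_determined_nbr_inputs[OF F(1) K(1) F(2)])
  fix E E' v
  assume view: "local_view E 2 v = local_view E' 2 v"
    and F: "\<And>u. u \<in> insert v (nbrs E v) \<Longrightarrow> F E u = F E' u" and KE: "K E v = K E' v"
  have nb: "nbrs E v = nbrs E' v" using local_view_nbrs[OF view] by simp
  have rank: "rank_in (F E) C u = rank_in (F E') C u" if "C \<in> K E v" "u \<in> C" for C u
    unfolding rank_in_def
  proof (intro arg_cong[where f = card] Collect_cong conj_cong refl)
    fix w assume w: "w \<in> C"
    have "w \<in> insert v (nbrs E v)" "u \<in> insert v (nbrs E v)" using w that K(2)[OF that(1)] by blast+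
    then show "(F E w = F E u) = (F E' w = F E' u)"
      by (simp only: F)
  qed
  have "w \<in> nbrs (connector E (K E) (F E) t) v \<longleftrightarrow> w \<in> nbrs (connector E' (K E') (F E') t) v" for w
  proof -
    have "(v, w) \<in> E \<longleftrightarrow> (v, w) \<in> E'" using nb unfolding nbrs_def by blast
    moreover have "(F E v = F E w) = (F E' v = F E' w)" if "(v, w) \<in> E"
      using F[of v] F[of w] that unfolding nbrs_def by simp
    moreover have "(w \<in> C \<and> rank_in (F E) C v div t = rank_in (F E) C w div t) =
      (w \<in> C \<and> rank_in (F E') C v div t = rank_in (F E') C w div t)" if "C \<in> K E v" "v \<in> C" for C
      using rank[OF that(1)] that by auto
    moreover have "v \<in> C" if "C \<in> K E v" for C using K(2)[OF that] by blast
    ultimately show ?thesis unfolding nbrs_def connector_def using KE by auto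
  qed
  then show "nbrs (connector E (K E) (F E) t) v = nbrs (connector E' (K E') (F E') t) v" by blast
qed

text \<open>The colouring \<Psi> is proper on E, hence on every connector, and serves as input in
  all iterations. An iteration pays one round for the connector besides its colouring.\<close>

lemma iterated_connectors:
  assumes K: "locally_determined 2 K" "\<And>E v C. C \<in> K E v \<Longrightarrow> v \<in> C \<and> C \<subseteq> insert v (nbrs E v)"
    and \<Psi>: "locally_determined r \<Psi>" "1 \<le> r"
    and valid: "\<And>E. valid E \<Longrightarrow> sym E \<and> degree_le E \<Delta> \<and> clique_cover E D S (K E) \<and>
      (\<forall>v. \<Psi> E v < M) \<and> proper_on E (\<Psi> E)"
    and \<tau>: "(M + 1) * (4 * q * \<tau> * \<tau>) < fact \<tau>" "\<tau> \<ge> 1" and h: "h < q * q" "h < 2 ^ J"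
    and ts: "\<And>t. t \<in> set ts \<Longrightarrow> t \<ge> 1 \<and> min \<Delta> (D * (t - 1)) \<le> h"
  shows "\<exists>F. locally_determined (r + length ts * ((J + 1) * (3 * (4 * q * \<tau> * \<tau>)) + 1)) F \<and>
    (\<forall>E. valid E \<longrightarrow> (\<forall>v. F E v < (\<Prod>t\<leftarrow>ts. D * (t - 1) + 1)) \<and>
       class_clique_le (K E) (F E) (foldl (\<lambda>s t. (s + t - 1) div t) S ts))"
  using ts
proof (induction ts rule: rev_induct)
  case Nil
  have "class_clique_le (K E) (\<lambda>v. 0) S" if "valid E" for E
    unfolding class_clique_le_def
  proof (intro allI ballI)
    fix v C and c :: nat assume C: "C \<in> K E v"
    have E: "degree_le E \<Delta>" "clique_cover E D S (K E)" using valid that by blast+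
    have "card {u \<in> C. 0 = c} \<le> card C" using finite_cover_clique[OF E C] by (intro card_mono) auto
    also have "\<dots> \<le> S" using E C unfolding clique_cover_def by blast
    finally show "card {u \<in> C. 0 = c} \<le> S" .
  qed
  then show ?case
    by (intro exI[of _ "\<lambda>E v. 0"]) (simp add: locally_determined_def)
next
  case (snoc t ts)
  define \<rho> where "\<rho> = (J + 1) * (3 * (4 * q * \<tau> * \<tau>))"
  define R where "R = r + length ts * (\<rho> + 1)"
  define P where "P = D * (t - 1) + 1"
  define s where "s = foldl (\<lambda>s t. (s + t - 1) div t) S ts"
  \<comment> \<open>Colours are counted with the degree bound of this block size, rounds with the
    uniform bound h.\<close>
  define h' where "h' = min \<Delta> (D * (t - 1))"
  have t: "t \<ge> 1" "h' \<le> h" using snoc.prems unfolding h'_def by auto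
  obtain F where F: "locally_determined R F"
    "\<And>E. valid E \<Longrightarrow> (\<forall>v. F E v < (\<Prod>t\<leftarrow>ts. D * (t - 1) + 1)) \<and> class_clique_le (K E) (F E) s"
    using snoc.IH snoc.prems unfolding R_def \<rho>_def s_def by auto
  obtain G where G: "local_op \<rho> G" "\<And>H \<psi>. sym H \<Longrightarrow> degree_le H h' \<Longrightarrow> (\<forall>v. \<psi> v < M) \<Longrightarrow> proper_on H \<psi> \<Longrightarrow>
      (\<forall>v. G H \<psi> v \<le> h') \<and> proper_on H (G H \<psi>)"
    using degree_plus_one_colouring[OF \<tau>, of h' J] t h unfolding \<rho>_def by (meson le_less_trans)
  define H where "H E = connector E (K E) (F E) t" for E
  define \<chi> where "\<chi> E = G (H E) (\<Psi> E)" for E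
  define F' where "F' E v = F E v * P + \<chi> E v" for E v
  have R1: "1 \<le> R" "r \<le> R + 1" using \<Psi>(2) unfolding R_def by auto
  have "locally_determined (R + 1) (\<lambda>E. nbrs (H E))"
    unfolding H_def using K F(1) R1(1) by (intro locally_determined_connector) blast+
  moreover have "H E \<subseteq> E" for E unfolding H_def connector_def by auto
  ultimately have loc: "locally_determined (R + 1 + \<rho>) \<chi>"
    unfolding \<chi>_def by (rule locally_determined_subgraph[OF _ _ locally_determined_mono[OF \<Psi>(1) R1(2)] G(1)])
  have "locally_determined (R + 1 + \<rho>) F'"
    using loc locally_determined_mono[OF F(1), of "R + 1 + \<rho>"]
    unfolding locally_determined_def F'_def by (metis add.assoc le_add1)
  moreover have "(\<forall>v. F' E v < (\<Prod>t\<leftarrow>ts @ [t]. D * (t - 1) + 1)) \<and>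
       class_clique_le (K E) (F' E) (foldl (\<lambda>s t. (s + t - 1) div t) S (ts @ [t]))" if "valid E" for E
  proof -
    have E: "sym E" "degree_le E \<Delta>" "clique_cover E D S (K E)" "\<forall>v. \<Psi> E v < M" "proper_on E (\<Psi> E)"
      using valid[OF that] by auto
    have "proper_on (H E) (\<Psi> E)" using E(5) unfolding proper_on_def H_def connector_def by auto
    then have chi: "(\<forall>v. \<chi> E v \<le> h')" "proper_on (H E) (\<chi> E)"
      using G(2)[of "H E" "\<Psi> E"] sym_connector[OF E(1,3)] degree_connector[OF E(2,3) t(1)] E(4)
      unfolding \<chi>_def H_def h'_def by blast+
    have lt: "\<chi> E v < P" for v using chi(1) unfolding P_def h'_def by (meson le_less_trans less_add_one min.cobounded2)
    have "F' E v < (\<Prod>t\<leftarrow>ts. D * (t - 1) + 1) * P" for v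
    proof -
      have "F' E v < Suc (F E v) * P" unfolding F'_def using lt[of v] by simp
      also have "\<dots> \<le> (\<Prod>t\<leftarrow>ts. D * (t - 1) + 1) * P" using F(2)[OF that] by (intro mult_le_mono1) (simp add: Suc_le_eq)
      finally show ?thesis .
    qed
    moreover have "class_clique_le (K E) (F' E) ((s + t - 1) div t)"
      using class_clique_le_refine[OF E(2,3) t(1), of "F E" s "\<chi> E" P] lt F(2)[OF that] chi(2) unfolding F'_def H_def by blast
    ultimately show ?thesis unfolding P_def s_def by simp
  qed
  moreover have "R + 1 + \<rho> = r + length (ts @ [t]) * (\<rho> + 1)" unfolding R_def by simp
  ultimately show ?case unfolding \<rho>_def[symmetric] by (intro exI[of _ F'] conjI) (simp only:, blast)
qed

section \<open>Choosing the block sizes\<close>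

text \<open>The colours of the last two steps, with blocks t and s, where s is S / t rounded up.
  With a = t - 1 and p = s - 1 the product is D^2 a p + D a + D p + 1. Since a \<le> p and D \<ge>
  2, it is at most D^2 (a p + p + 1) = D^2 (t p + 1), and t p \<le> S - 1.\<close>

lemma sqrt_block_bound:
  fixes D S t :: nat
  assumes D: "D \<ge> 2" and t: "t \<ge> 1" "t * t \<le> S"
  shows "(D * (t - 1) + 1) * (D * ((S + t - 1) div t - 1) + 1) \<le> D * D * S"
proof -
  define p where "p = (S + t - 1) div t - 1"
  define a where "a = t - 1"
  have ta: "t = a + 1" using t unfolding a_def by simp
  have S1: "S \<ge> 1" using t by (cases S) auto
  have eq: "(S + t - 1) div t = (S - 1) div t + 1"
    using S1 t by (metis Nat.add_diff_assoc2 div_add_self2 not_one_le_zero)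
  then have p: "p = (S - 1) div t" unfolding p_def by simp
  have pt: "t * p \<le> S - 1" unfolding p by (rule times_div_less_eq_dividend)
  have "a \<le> p"
  proof -
    have "t * a \<le> S - 1" using t(2) S1 unfolding ta by (simp add: algebra_simps)
    then have "t * a div t \<le> (S - 1) div t" by (rule div_le_mono)
    then show ?thesis unfolding p using t by simp
  qed
  obtain d where d: "D = d + 2" using D by (metis le_add_diff_inverse2)
  have "(D * a + 1) * (D * p + 1) = D * D * (a * p) + D * a + D * p + 1" by (simp add: algebra_simps)
  also have "\<dots> \<le> D * D * (a * p) + D * p + D * p + D * D" using \<open>a \<le> p\<close> D by (intro add_mono) auto
  also have "\<dots> \<le> D * D * (a * p) + D * D * p + D * D" unfolding d by (simp add: algebra_simps)
  also have "\<dots> = D * D * (t * p + 1)" unfolding ta by (simp add: algebra_simps)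
  also have "\<dots> \<le> D * D * S" using pt S1 by (intro mult_le_mono2) linarith
  finally show ?thesis unfolding p_def a_def .
qed

text \<open>Colours spent times clique size left grows at most by the factor D. After multiplication
  by b, the identity D (b - 1) + 1 = D b - (D - 1) leaves a slack of (D - 1) S, while rounding up
  costs at most (D (b - 1) + 1)(b - 1); S \<ge> 2 b^2 makes the slack sufficient.\<close>

lemma block_step_bound:
  fixes D S b :: nat
  assumes D: "D \<ge> 2" and b: "b \<ge> 1" "2 * b * b \<le> S"
  shows "(D * (b - 1) + 1) * ((S + b - 1) div b) \<le> D * S"
proof -
  define s where "s = (S + b - 1) div b"
  obtain a where a: "b = a + 1" using b by (metis le_add_diff_inverse2)
  obtain d where d: "D = d + 2" using D by (metis le_add_diff_inverse2)
  have "b * s \<le> S + a" unfolding s_def a using times_div_less_eq_dividend[of b "S + b - 1"] a by simp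
  then have "b * ((D * a + 1) * s) \<le> (D * a + 1) * (S + a)"
    by (metis mult.left_commute mult_le_mono2)
  also have "\<dots> \<le> b * (D * S)"
  proof -
    have "(D * a + 1) * a \<le> (D - 1) * S"
    proof -
      have "(D * a + 1) * a \<le> (D - 1) * (2 * b * b)" unfolding a d by (simp add: algebra_simps)
      also have "\<dots> \<le> (D - 1) * S" using b by (intro mult_le_mono2)
      finally show ?thesis .
    qed
    then show ?thesis unfolding a d by (simp add: algebra_simps)
  qed
  finally have "b * ((D * a + 1) * s) \<le> b * (D * S)" .
  then have "(D * a + 1) * s \<le> D * S" using b(1) by (simp only: mult_le_cancel1)
  moreover have "b - 1 = a" using a by simp
  ultimately show ?thesis unfolding s_def by simp
qed

text \<open>Blocks of size b are used while S > 2 b^2, each paying one factor D of the budget; then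
  a balanced pair finishes within D^2 S. The bound S \<le> b^(x + 1) ensures that two steps remain
  when the pair is needed.\<close>

lemma exists_block_sizes:
  fixes D S b x :: nat
  assumes D: "D \<ge> 2" and b: "b \<ge> 1" and "x \<ge> 1" "S \<ge> 1" "S \<le> b ^ (x + 1)"
  shows "\<exists>ts. length ts \<le> x + 1 \<and> (\<forall>t\<in>set ts. 1 \<le> t \<and> t \<le> 4 * b) \<and>
    foldl (\<lambda>s t. (s + t - 1) div t) S ts \<le> 1 \<and> (\<Prod>t\<leftarrow>ts. D * (t - 1) + 1) \<le> D ^ (x + 1) * S"
  using assms(3-5)
proof (induction x arbitrary: S)
  case 0
  then show ?case by simp
next
  case (Suc x)
  show ?case
  proof (cases "S \<le> 2 * b * b")
    case True
    \<comment> \<open>The second block takes everything that the first leaves of a clique in a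
      class, so the final size is 1.\<close>
    define t where "t = nat \<lfloor>sqrt (real S)\<rfloor>"
    have t: "real t \<le> sqrt (real S)" "sqrt (real S) < real t + 1"
      unfolding t_def by (simp_all add: of_nat_floor)
    have "real t * real t \<le> sqrt (real S) * sqrt (real S)" using t(1) by (intro mult_mono) auto
    then have tt: "t * t \<le> S" by (simp flip: of_nat_mult)
    have "sqrt (real S) * sqrt (real S) < (real t + 1) * (real t + 1)" using t(2) by (intro mult_strict_mono) auto
    then have "real S < real ((t + 1) * (t + 1))" by (simp add: algebra_simps)
    then have tS: "S < (t + 1) * (t + 1)" by (simp only: of_nat_less_iff)
    have t1: "t \<ge> 1" using tS Suc.prems by (cases t) auto
    have t2b: "t \<le> 2 * b"
    proof (rule ccontr)
      assume "\<not> t \<le> 2 * b"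
      then have "(2 * b) * (2 * b) < t * t" by (intro mult_strict_mono) auto
      then show False using tt True b by simp
    qed
    define s where "s = (S + t - 1) div t"
    have s1: "s \<ge> 1" unfolding s_def using t1 Suc.prems by (simp add: div_greater_zero_iff Suc_leI)
    have "(t + 1) * (t + 1) = t * t + 2 * t + 1" "t * (t + 3) = t * t + 3 * t"
      by (simp_all add: algebra_simps)
    \<comment> \<open>The second block exceeds t by at most 2; with t \<le> 2 b this is where the
      bound 4 b comes from.\<close>
    then have "S + t - 1 < t * (t + 3)" using tS t1 by linarith
    then have "s < t + 3" unfolding s_def using t1 by (simp add: div_less_iff_less_mult mult.commute)
    then have s4: "s \<le> 4 * b" using t2b b by linarith
    have "(s + s - 1) div s \<le> 1"
    proof -
      have "(s + s - 1) div s < 2" using s1 by (simp add: div_less_iff_less_mult)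
      then show ?thesis by simp
    qed
    moreover have "(D * (t - 1) + 1) * (D * (s - 1) + 1) \<le> D ^ (Suc x + 1) * S"
    proof -
      have "(D * (t - 1) + 1) * (D * (s - 1) + 1) \<le> D * D * S"
        unfolding s_def by (rule sqrt_block_bound[OF D t1 tt])
      also have "\<dots> \<le> D ^ (Suc x + 1) * S" using D by (intro mult_le_mono1) simp
      finally show ?thesis .
    qed
    ultimately show ?thesis
      using t1 t2b s1 s4 unfolding s_def by (intro exI[of _ "[t, (S + t - 1) div t]"]) simp
  next
    case False
    define s where "s = (S + b - 1) div b"
    \<comment> \<open>With only two steps left S is at most b^2, which belongs to the other
      case.\<close>
    have "x \<ge> 1"
    proof (rule ccontr)
      assume "\<not> x \<ge> 1"
      then have "x = 0" by simp
      then have "S \<le> b * b" using Suc.prems by simp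
      then show False using False by simp
    qed
    moreover have "s \<ge> 1" unfolding s_def using b Suc.prems by (simp add: div_greater_zero_iff Suc_leI)
    moreover have "s \<le> b ^ (x + 1)"
    proof -
      have "S + b - 1 < b * (b ^ (x + 1) + 1)" using Suc.prems b by simp
      then have "s < b ^ (x + 1) + 1" unfolding s_def using b by (simp add: div_less_iff_less_mult mult.commute)
      then show ?thesis by simp
    qed
    ultimately obtain ts where ts: "length ts \<le> x + 1" "\<forall>t\<in>set ts. 1 \<le> t \<and> t \<le> 4 * b"
      "foldl (\<lambda>s t. (s + t - 1) div t) s ts \<le> 1" "(\<Prod>t\<leftarrow>ts. D * (t - 1) + 1) \<le> D ^ (x + 1) * s"
      using Suc.IH by blast
    have "(D * (b - 1) + 1) * (\<Prod>t\<leftarrow>ts. D * (t - 1) + 1) \<le> (D * (b - 1) + 1) * (D ^ (x + 1) * s)"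
      using ts(4) by (rule mult_le_mono2)
    also have "\<dots> = D ^ (x + 1) * ((D * (b - 1) + 1) * s)" by (simp only: ac_simps)
    also have "\<dots> \<le> D ^ (x + 1) * (D * S)"
      unfolding s_def using False by (intro mult_le_mono2 block_step_bound[OF D b]) simp
    also have "\<dots> = D ^ (Suc x + 1) * S" by simp
    finally show ?thesis using ts b unfolding s_def by (intro exI[of _ "b # ts"]) simp
  qed
qed

text \<open>Every edge lies in a clique of the cover, so a colouring whose classes meet each clique
  at most once is proper.\<close>

lemma clique_cover_colouring:
  fixes D S b x N T :: nat
  assumes D: "D \<ge> 2" and S: "S \<ge> 1" and x: "x \<ge> 1" and b: "b \<ge> 1" "S \<le> b ^ (x + 1)" and N: "N \<ge> 1"
    and K: "locally_determined 2 K" "\<And>E v C. C \<in> K E v \<Longrightarrow> v \<in> C \<and> C \<subseteq> insert v (nbrs E v)"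
    and \<tau>: "(linial_colours \<Delta> N T + 1) * (4 * q * \<tau> * \<tau>) < fact \<tau>" "\<tau> \<ge> 1"
    and h: "min \<Delta> (D * (4 * b - 1)) < q * q" "min \<Delta> (D * (4 * b - 1)) < 2 ^ J"
  shows "\<exists>F. locally_determined (T + 2 + (x + 1) * ((J + 1) * (3 * (4 * q * \<tau> * \<tau>)) + 1)) F \<and>
    (\<forall>E. sym E \<longrightarrow> irrefl E \<longrightarrow> E \<subseteq> {..<N} \<times> {..<N} \<longrightarrow> degree_le E \<Delta> \<longrightarrow> clique_cover E D S (K E) \<longrightarrow>
       (\<forall>v. F E v < D ^ (x + 1) * S) \<and> proper_on E (F E))"
proof -
  define valid where "valid E \<longleftrightarrow> sym E \<and> irrefl E \<and> E \<subseteq> {..<N} \<times> {..<N} \<and> degree_le E \<Delta> \<and>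
    clique_cover E D S (K E)" for E
  define M where "M = linial_colours \<Delta> N T"
  define \<rho> where "\<rho> = (J + 1) * (3 * (4 * q * \<tau> * \<tau>))"
  \<comment> \<open>The IDs are the initial colours. Colours below N are demanded at every natural
    number, so numbers beyond the ID range, which carry no edge, get the default 0.\<close>
  define g where "g v = (if v < N then v else 0)" for v
  obtain G where G: "local_op T G" "\<And>H \<psi>. degree_le H \<Delta> \<Longrightarrow> (\<forall>v. \<psi> v < N) \<Longrightarrow> proper_on H \<psi> \<Longrightarrow>
     (\<forall>v. G H \<psi> v < M) \<and> proper_on H (G H \<psi>)"
    using linial_iterated[of T \<Delta> N] unfolding M_def by blast
  define \<Psi> where "\<Psi> E = G E g" for E
  have "locally_determined T \<Psi>"
    using G(1) unfolding local_op_def locally_determined_def \<Psi>_def by blast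
  then have \<Psi>: "locally_determined (T + 2) \<Psi>" by (rule locally_determined_mono) simp
  have val: "sym E \<and> degree_le E \<Delta> \<and> clique_cover E D S (K E) \<and> (\<forall>v. \<Psi> E v < M) \<and> proper_on E (\<Psi> E)"
    if "valid E" for E
  proof -
    have E: "degree_le E \<Delta>" "E \<subseteq> {..<N} \<times> {..<N}" "irrefl E" using that unfolding valid_def by auto
    have "proper_on E g" using E(2,3) unfolding proper_on_def g_def irrefl_def by auto
    moreover have "\<forall>v. g v < N" using N unfolding g_def by auto
    ultimately show ?thesis using G(2)[OF E(1)] that unfolding valid_def \<Psi>_def by blast
  qed
  obtain ts where ts: "length ts \<le> x + 1" "\<forall>t\<in>set ts. 1 \<le> t \<and> t \<le> 4 * b"
    "foldl (\<lambda>s t. (s + t - 1) div t) S ts \<le> 1" "(\<Prod>t\<leftarrow>ts. D * (t - 1) + 1) \<le> D ^ (x + 1) * S"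
    using exists_block_sizes[OF D b(1) x S b(2)] by blast
  have ts': "t \<ge> 1 \<and> min \<Delta> (D * (t - 1)) \<le> min \<Delta> (D * (4 * b - 1))" if "t \<in> set ts" for t
  proof -
    have "D * (t - 1) \<le> D * (4 * b - 1)" using ts(2) that by (intro mult_le_mono2 diff_le_mono) blast
    then show ?thesis using ts(2) that by (metis min.mono order_refl)
  qed
  have "\<exists>F. locally_determined (T + 2 + length ts * (\<rho> + 1)) F \<and>
    (\<forall>E. valid E \<longrightarrow> (\<forall>v. F E v < (\<Prod>t\<leftarrow>ts. D * (t - 1) + 1)) \<and>
       class_clique_le (K E) (F E) (foldl (\<lambda>s t. (s + t - 1) div t) S ts))"
    unfolding \<rho>_def
    by (rule iterated_connectors[OF K \<Psi> _ val \<tau>[folded M_def] h ts']) simp_all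
  then obtain F where F: "locally_determined (T + 2 + length ts * (\<rho> + 1)) F"
    "\<And>E. valid E \<Longrightarrow> (\<forall>v. F E v < (\<Prod>t\<leftarrow>ts. D * (t - 1) + 1)) \<and>
       class_clique_le (K E) (F E) (foldl (\<lambda>s t. (s + t - 1) div t) S ts)"
    by blast
  have "locally_determined (T + 2 + (x + 1) * (\<rho> + 1)) F"
    by (rule locally_determined_mono[OF F(1)]) (use ts(1) in \<open>intro add_left_mono mult_le_mono1\<close>)
  moreover have "(\<forall>v. F E v < D ^ (x + 1) * S) \<and> proper_on E (F E)" if "valid E" for E
  proof -
    have le1: "class_clique_le (K E) (F E) 1"
      using F(2)[OF that] ts(3) unfolding class_clique_le_def by (meson le_trans)
    have "F E u \<noteq> F E w" if uw: "(u, w) \<in> E" for u w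
    proof
      assume e: "F E u = F E w"
      have E: "degree_le E \<Delta>" "clique_cover E D S (K E)" using val[OF \<open>valid E\<close>] by auto
      obtain C where C: "C \<in> K E u" "w \<in> C" using E(2) uw unfolding clique_cover_def by blast
      have "u \<noteq> w" using uw \<open>valid E\<close> unfolding valid_def irrefl_def by auto
      then have "2 = card {u, w}" by simp
      also have "\<dots> \<le> card {v \<in> C. F E v = F E u}"
        using finite_cover_clique[OF E C(1)] K(2)[OF C(1)] C(2) e by (intro card_mono) auto
      also have "\<dots> \<le> 1" using le1 C(1) unfolding class_clique_le_def by blast
      finally show False by simp
    qed
    moreover have "F E v < D ^ (x + 1) * S" for v using F(2)[OF that] ts(4) by (meson less_le_trans)
    ultimately show ?thesis unfolding proper_on_def by blast
  qed
  ultimately have "locally_determined (T + 2 + (x + 1) * (\<rho> + 1)) F \<and>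
    (\<forall>E. valid E \<longrightarrow> (\<forall>v. F E v < D ^ (x + 1) * S) \<and> proper_on E (F E))" by blast
  then show ?thesis unfolding \<rho>_def valid_def by blast
qed

section \<open>Round counts\<close>

lemma half_le_ln_2: "ln (2::real) \<ge> 1 / 2"
  using exp_half_le2 by (subst ln_ge_iff) auto

text \<open>The constants come from splitting off 1024 = 2^10 and from ln 2 \<ge> 1 / 2. The small
  slope is what lets two colour reductions halve a logarithm.\<close>

lemma log2_le_linear:
  fixes z :: real assumes "z > 0" shows "log 2 z \<le> 10 + z / 512"
proof -
  note ln2 = half_le_ln_2
  have "ln (z / 1024) \<le> z / 1024" using ln_le_minus_one[of "z / 1024"] assms by simp
  also have "\<dots> \<le> (z / 512) * ln 2" using ln2 assms by (simp add: field_simps)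
  finally have "log 2 (z / 1024) \<le> z / 512"
    unfolding log_def using ln2 by (simp add: divide_le_eq)
  moreover have "log 2 (1024::real) = 10" using log_pow_cancel[of 2 10] by simp
  ultimately show ?thesis using assms by (simp add: log_divide)
qed

lemma log2_le_self:
  fixes z :: real assumes "z > 0" shows "log 2 z \<le> z"
proof -
  have ln2: "ln (2::real) \<ge> 1 / 2" "ln (2::real) \<le> 1"
    using half_le_ln_2 ln_le_minus_one[of "2::real"] by simp_all
  have "ln (z / 2) \<le> z / 2 - 1" using assms by (intro ln_le_minus_one) simp
  then have "ln z \<le> z / 2" using ln2 assms by (simp add: ln_div)
  also have "\<dots> \<le> z * ln 2" using ln2 assms by simp
  finally show ?thesis unfolding log_def using ln2 by (simp add: divide_le_eq)
qed

text \<open>Shows that the LEAST in \<open>log_star\<close> is attained: y \<le> n + 1 \<le> 2^n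
  gives log y \<le> n, so an integer bound falls with each step until y \<le> 1.\<close>

lemma log_star_exists: "\<exists>k. ((\<lambda>y. log 2 y) ^^ k) y \<le> (1::real)" if "y \<le> real n"
  using that
proof (induction n arbitrary: y)
  case 0
  then show ?case by (intro exI[of _ 0]) simp
next
  case (Suc n)
  show ?case
  proof (cases "y \<le> 1")
    case True
    then show ?thesis by (intro exI[of _ 0]) simp
  next
    case False
    have "Suc n \<le> 2 ^ n" by (induction n) auto
    then have "real (Suc n) \<le> 2 ^ n" by (metis of_nat_le_iff of_nat_numeral of_nat_power)
    then have "y \<le> 2 ^ n" using Suc.prems by linarith
    then have "y \<le> 2 powr real n" by (simp add: powr_realpow)
    then have "log 2 y \<le> real n" using False by (simp add: log_le_iff)
    then obtain k where "((\<lambda>y. log 2 y) ^^ k) (log 2 y) \<le> 1" using Suc.IH by blast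
    then show ?thesis by (intro exI[of _ "Suc k"]) (simp add: funpow_swap1)
  qed
qed

lemma log_star_le_one: "((\<lambda>y. log 2 y) ^^ log_star n) (real n) \<le> 1"
  unfolding log_star_def using log_star_exists[OF order_refl] by (rule LeastI_ex)

section \<open>The number of colours after \<open>2 * log_star n + 1\<close> reductions\<close>

lemma linial_colours_ge_1: "N \<ge> 1 \<Longrightarrow> linial_colours \<Delta> N i \<ge> 1"
  by (cases i) auto

text \<open>The new number of colours is the square of \<Delta> t + 1 with t \<le> a + B + 5, so its
  logarithm depends on a only through log a.\<close>

lemma log_linial_step:
  fixes \<Delta> N i :: nat
  assumes N: "N \<ge> 1"
  defines "a \<equiv> log 2 (real (linial_colours \<Delta> N i))" and "B \<equiv> log 2 (real \<Delta> + 2)"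
  shows "log 2 (real (linial_colours \<Delta> N (Suc i))) \<le> 2 * B + 2 * log 2 (a + B + 5)"
proof -
  define m where "m = linial_colours \<Delta> N i"
  define t where "t = linial_param \<Delta> m"
  have m: "m \<ge> 1" unfolding m_def by (rule linial_colours_ge_1[OF N])
  have t3: "t \<ge> 3" unfolding t_def linial_param_def by simp
  have "real t \<le> log 2 (real ((m + 1) * (\<Delta> + 1))) + 4"
    unfolding t_def linial_param_def using lg_le[of "(m + 1) * (\<Delta> + 1)"] by simp
  also have "log 2 (real ((m + 1) * (\<Delta> + 1))) \<le> log 2 (2 * real m * (real \<Delta> + 2))"
  proof -
    have "real ((m + 1) * (\<Delta> + 1)) = (real m + 1) * (real \<Delta> + 1)" by (simp add: algebra_simps)
    also have "\<dots> \<le> 2 * real m * (real \<Delta> + 2)" using m by (intro mult_mono) auto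
    finally show ?thesis by (intro log_mono) (simp_all only: of_nat_0_less_iff, simp_all)
  qed
  also have "\<dots> = 1 + a + B" using m unfolding a_def B_def m_def by (simp add: log_mult)
  finally have t: "real t \<le> a + B + 5" by simp
  have "real (\<Delta> * t + 1) \<le> (real \<Delta> + 2) * real t" using t3 by (simp add: algebra_simps)
  then have "log 2 (real (\<Delta> * t + 1)) \<le> log 2 ((real \<Delta> + 2) * real t)"
    by (intro log_mono) (auto intro: add_pos_nonneg)
  also have "\<dots> = B + log 2 (real t)" using t3 unfolding B_def by (simp add: log_mult)
  also have "\<dots> \<le> B + log 2 (a + B + 5)" using t t3 by (intro add_left_mono log_mono) auto
  finally have "log 2 (real (\<Delta> * t + 1)) \<le> B + log 2 (a + B + 5)" .
  moreover have "log 2 (real (linial_colours \<Delta> N (Suc i))) = 2 * log 2 (real (\<Delta> * t + 1))"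
    unfolding linial_colours.simps m_def[symmetric] t_def[symmetric]
    by (simp add: log_nat_power)
  ultimately show ?thesis by simp
qed

text \<open>Two Linial steps replace the logarithm a of the number of colours by half of log a,
  as long as a exceeds a multiple of the degree bound; the iterated logarithms of n therefore
  dominate every second a.\<close>

lemma linial_colours_bound:
  fixes c :: nat
  shows "\<exists>\<kappa>::nat. \<forall>n \<Delta> N. n \<ge> 1 \<longrightarrow> N \<ge> 1 \<longrightarrow> real N \<le> (2 * real n) ^ c \<longrightarrow>
    linial_colours \<Delta> N (2 * log_star n + 1) \<le> (\<Delta> + 2) ^ \<kappa>"
proof -
  \<comment> \<open>The summand 2^140 gives y = log a \<ge> 140 above the threshold \<kappa> E, from
    where 6 (10 + 6 y / 512) \<le> y / 2; the summand 2 c + 1 covers the exponent of the ID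
    range.\<close>
  define \<kappa> :: nat where "\<kappa> = 2 ^ 140 + (2 * c + 1)"
  define c' :: real where "c' = 2 * real c + 1"
  have \<kappa>: "real \<kappa> \<ge> 2 ^ 140" "c' \<le> real \<kappa>" unfolding \<kappa>_def c'_def by simp_all
  have "linial_colours \<Delta> N (2 * log_star n + 1) \<le> (\<Delta> + 2) ^ \<kappa>"
    if n: "n \<ge> 1" and N: "N \<ge> 1" "real N \<le> (2 * real n) ^ c" for n \<Delta> N
  proof -
    define a where "a i = log 2 (real (linial_colours \<Delta> N i))" for i
    define E where "E = real \<Delta> + 2"
    define B where "B = log 2 E"
    have E2: "E \<ge> 2" unfolding E_def by simp
    have B1: "B \<ge> 1" unfolding B_def using E2 by simp
    have BE: "B \<le> E" unfolding B_def using E2 by (intro log2_le_self) simp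
    have a0: "a i \<ge> 0" for i
    proof -
      have "real (linial_colours \<Delta> N i) \<ge> 1" using linial_colours_ge_1[OF N(1), of \<Delta> i] by simp
      then show ?thesis unfolding a_def by simp
    qed
    have step: "a (Suc i) \<le> 2 * B + 2 * log 2 (a i + B + 5)" for i
      using log_linial_step[OF N(1)] unfolding a_def B_def E_def .
    \<comment> \<open>Once a is at most \<kappa> E, a single step brings it down to \<kappa> B, the
      logarithm of (\<Delta> + 2)^\<kappa>.\<close>
    have small: "a (Suc i) \<le> real \<kappa> * B" if "a i \<le> real \<kappa> * E" for i
    proof -
      have "a i + B + 5 \<le> (real \<kappa> + 6) * E" using that BE E2 by (simp add: algebra_simps)
      then have "log 2 (a i + B + 5) \<le> log 2 ((real \<kappa> + 6) * E)" using a0[of i] B1 by (intro log_mono) auto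
      also have "\<dots> = log 2 (real \<kappa> + 6) + B" using E2 unfolding B_def by (subst log_mult) auto
      also have "log 2 (real \<kappa> + 6) \<le> 10 + (real \<kappa> + 6) / 512" by (rule log2_le_linear) simp
      finally have "a (Suc i) \<le> 4 * B + (20 + (real \<kappa> + 6) / 256)" using step[of i] by simp
      also have "\<dots> \<le> 4 * B + (20 + (real \<kappa> + 6) / 256) * B"
        using B1 mult_left_mono[of 1 B "20 + (real \<kappa> + 6) / 256"] by simp
      also have "\<dots> = (24 + (real \<kappa> + 6) / 256) * B" by (simp add: algebra_simps)
      also have "\<dots> \<le> real \<kappa> * B"
      proof (rule mult_right_mono)
        have "real \<kappa> \<ge> 100" by (rule order_trans[OF _ \<kappa>(1)]) simp
        then show "24 + (real \<kappa> + 6) / 256 \<le> real \<kappa>" by (simp add: field_simps)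
      qed (use B1 in simp)
      finally show ?thesis .
    qed
    have small': "a (Suc i) \<le> real \<kappa> * E" if "a i \<le> real \<kappa> * E" for i
      using small[OF that] mult_left_mono[OF BE, of "real \<kappa>"] by simp
    have big: "a i \<ge> 2 ^ 140 \<and> a (Suc i) \<le> 6 * log 2 (a i)" if "a i > real \<kappa> * E" for i
    proof -
      have "2 ^ 140 * 1 \<le> real \<kappa> * E" using \<kappa>(1) E2 by (intro mult_mono) auto
      then have a140: "a i \<ge> 2 ^ 140" using that by simp
      have "6 * E \<le> real \<kappa> * E" using \<kappa>(1) E2 by (intro mult_right_mono) auto
      then have "6 * E \<le> a i" using that by simp
      then have le: "a i + B + 5 \<le> 2 * a i" and "E \<le> a i" using BE E2 by linarith+
      then have "B \<le> log 2 (a i)" unfolding B_def using E2 by (intro log_mono) auto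
      moreover have "log 2 (a i + B + 5) \<le> log 2 (2 * a i)" using le a0[of i] B1 by (intro log_mono) auto
      moreover have "log 2 (2 * a i) = 1 + log 2 (a i)" using a140 by (subst log_mult) auto
      moreover have "1 \<le> log 2 (a i)" using a140 by simp
      ultimately have "a (Suc i) \<le> 6 * log 2 (a i)" using step[of i] by linarith
      then show ?thesis using a140 by blast
    qed
    have two: "a (Suc (Suc i)) \<le> log 2 (a i) / 2" if "a i > real \<kappa> * E" "a (Suc i) > real \<kappa> * E" for i
    proof -
      let ?y = "log 2 (a i)"
      have "log 2 (2 ^ 140) \<le> ?y" using big[OF that(1)] by (intro log_mono) auto
      then have y: "?y \<ge> 140" using log_pow_cancel[of 2 140] by simp
      have "a (Suc (Suc i)) \<le> 6 * log 2 (a (Suc i))" using big[OF that(2)] by simp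
      also have "\<dots> \<le> 6 * log 2 (6 * ?y)"
        using big[OF that(1)] big[OF that(2)] by (intro mult_left_mono log_mono) auto
      also have "\<dots> \<le> 6 * (10 + (6 * ?y) / 512)" using y by (intro mult_left_mono log2_le_linear) auto
      also have "\<dots> \<le> ?y / 2" using y by simp
      finally show ?thesis .
    qed
    define L where "L k = ((\<lambda>y. log 2 y) ^^ k) (real n)" for k
    \<comment> \<open>The factor c' survives the induction because the halving in \<open>two\<close>
      absorbs the summand log c' \<le> c'.\<close>
    have "a (2 * k) \<le> max (real \<kappa> * E) (c' * max 1 (L k))" for k
    proof (induction k)
      case 0
      have "log 2 (real N) \<le> log 2 ((2 * real n) ^ c)" using N by (intro log_mono) auto
      also have "\<dots> = real c * log 2 (2 * real n)" using n by (intro log_nat_power) simp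
      also have "\<dots> \<le> real c * (2 * real n)" using n by (intro mult_left_mono log2_le_self) auto
      also have "\<dots> \<le> c' * max 1 (L 0)" unfolding c'_def L_def using n by (simp add: algebra_simps)
      finally show ?case unfolding a_def by simp
    next
      case (Suc k)
      show ?case
      proof (cases "a (2 * k) \<le> real \<kappa> * E \<or> a (Suc (2 * k)) \<le> real \<kappa> * E")
        case True
        then have "a (Suc (Suc (2 * k))) \<le> real \<kappa> * E" using small' by blast
        then show ?thesis by simp
      next
        case False
        have "c' * 1 \<le> real \<kappa> * E" using \<kappa> E2 by (intro mult_mono) (auto simp: c'_def)
        then have ak: "a (2 * k) \<le> c' * L k" "L k \<ge> 1"
          using Suc False by (auto simp: max_def split: if_splits)
        have c1: "c' \<ge> 1" unfolding c'_def by simp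
        have "log 2 (a (2 * k)) \<le> log 2 (c' * L k)"
          using ak(1) big[of "2 * k"] False by (intro log_mono) auto
        also have "\<dots> = log 2 c' + L (Suc k)" using ak c1 unfolding L_def by (subst log_mult) auto
        also have "log 2 c' \<le> c'" using c1 by (intro log2_le_self) auto
        finally have "a (Suc (Suc (2 * k))) \<le> (c' + L (Suc k)) / 2" using two[of "2 * k"] False by simp
        also have "\<dots> \<le> (c' * max 1 (L (Suc k)) + c' * max 1 (L (Suc k))) / 2"
        proof -
          have "c' * 1 \<le> c' * max 1 (L (Suc k))" using c1 by (intro mult_left_mono) auto
          moreover have "1 * max 1 (L (Suc k)) \<le> c' * max 1 (L (Suc k))" using c1 by (intro mult_right_mono) auto
          ultimately show ?thesis by simp
        qed
        finally show ?thesis by simp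
      qed
    qed
    moreover have "L (log_star n) \<le> 1" unfolding L_def by (rule log_star_le_one)
    moreover have "c' * 1 \<le> real \<kappa> * E" using \<kappa> E2 by (intro mult_mono) (auto simp: c'_def)
    ultimately have "a (2 * log_star n) \<le> real \<kappa> * E"
      by (metis max.absorb1)
    \<comment> \<open>The additional odd step replaces the linear bound in E by its
      logarithm.\<close>
    then have "a (Suc (2 * log_star n)) \<le> real \<kappa> * B" by (rule small)
    also have "\<dots> = log 2 (E ^ \<kappa>)" unfolding B_def using E2 by (simp add: log_nat_power)
    finally have le: "a (Suc (2 * log_star n)) \<le> log 2 (E ^ \<kappa>)" .
    have "(1::real) < 2" "0 < E ^ \<kappa>" using E2 by simp_all
    moreover have "0 < real (linial_colours \<Delta> N (Suc (2 * log_star n)))"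
      using linial_colours_ge_1[OF N(1), of \<Delta> "Suc (2 * log_star n)"] by linarith
    ultimately have "real (linial_colours \<Delta> N (Suc (2 * log_star n))) \<le> E ^ \<kappa>"
      using le unfolding a_def by (metis log_le_cancel_iff)
    also have "E ^ \<kappa> = real ((\<Delta> + 2) ^ \<kappa>)" unfolding E_def by (simp add: add.commute)
    finally show ?thesis by (simp only: of_nat_le_iff Suc_eq_plus1)
  qed
  then show ?thesis by blast
qed

text \<open>The block graphs have h + 1 \<le> 4 D b, so q is of order sqrt (D b). The cube of the
  logarithm consists of one factor for the J + 1 passes and two for the agreement bound \<tau>,
  squared in k = 4 q \<tau>^2.\<close>

lemma colouring_parameters:
  fixes \<Delta> D b M \<kappa> :: nat
  assumes D: "D \<ge> 1" and b: "b \<ge> 1" and M: "M \<le> (\<Delta> + 2) ^ \<kappa>"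
  defines "h \<equiv> min \<Delta> (D * (4 * b - 1))"
  shows "\<exists>q \<tau> J. (M + 1) * (4 * q * \<tau> * \<tau>) < fact \<tau> \<and> \<tau> \<ge> 1 \<and> h < q * q \<and> h < 2 ^ J \<and>
    real ((J + 1) * (3 * (4 * q * \<tau> * \<tau>)) + 1) \<le>
      (144 * (real \<kappa> + 10)\<^sup>2 + 1) * sqrt (real D * real b) * log 2 (real \<Delta> + 2) ^ 3"
proof -
  define B where "B = log 2 (real \<Delta> + 2)"
  define Y where "Y = sqrt (real D * real b)"
  define q where "q = nat \<lceil>sqrt (real h + 1)\<rceil>"
  define J where "J = lg (h + 1)"
  \<comment> \<open>With \<open>\<tau> - 2 = lg X + 2\<close> the factorial of \<tau> - 2 exceeds X,
    and the remaining factors \<tau> (\<tau> - 1) pay for \<tau>^2 \<le> 2 \<tau> (\<tau> - 1);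
    hence 8 = 4 * 2.\<close>
  define X where "X = 8 * (M + 1) * q"
  define \<tau> where "\<tau> = lg X + 4"
  have B1: "B \<ge> 1" unfolding B_def by simp
  have DB: "1 * 1 \<le> real D * real b" using D b by (intro mult_mono) auto
  then have Y1: "Y \<ge> 1" unfolding Y_def by simp
  have q: "sqrt (real h + 1) \<le> real q" "real q \<le> sqrt (real h + 1) + 1"
    unfolding q_def using of_nat_ceiling[of "sqrt (real h + 1)"] by (auto simp: real_nat_ceiling_ge)
  have sq1: "sqrt (real h + 1) \<ge> 1" by simp
  have q1: "q \<ge> 1" using q(1) sq1 by linarith
  have "sqrt (real h + 1) * sqrt (real h + 1) \<le> real q * real q" using q(1) by (intro mult_mono) auto
  then have "real (h + 1) \<le> real (q * q)" by simp
  then have hq: "h < q * q" by (simp only: of_nat_le_iff)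
  have hJ: "h < 2 ^ J" unfolding J_def using le_two_power_lg[of "h + 1"] by simp
  have "(M + 1) * (4 * q * \<tau> * \<tau>) \<le> X * (\<tau> * (\<tau> - 1))"
  proof -
    have "\<tau> * \<tau> \<le> 2 * (\<tau> * (\<tau> - 1))" unfolding \<tau>_def by (simp add: algebra_simps)
    then have "(M + 1) * (4 * q) * (\<tau> * \<tau>) \<le> (M + 1) * (4 * q) * (2 * (\<tau> * (\<tau> - 1)))" by (rule mult_le_mono2)
    then show ?thesis unfolding X_def by (simp add: algebra_simps)
  qed
  also have "\<dots> < fact (\<tau> - 2) * (\<tau> * (\<tau> - 1))"
    using less_fact_lg[of X] unfolding \<tau>_def by (intro mult_strict_right_mono) simp_all
  also have "\<dots> = fact \<tau>"
  proof -
    have e: "fact \<tau> = \<tau> * (fact (\<tau> - 1) :: nat)" "fact (\<tau> - 1) = (\<tau> - 1) * (fact (\<tau> - 1 - 1) :: nat)"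
      using fact_reduce[of \<tau>, where 'a = nat] fact_reduce[of "\<tau> - 1", where 'a = nat] unfolding \<tau>_def by simp_all
    have "\<tau> - 1 - 1 = \<tau> - 2" by simp
    then show ?thesis using e by (metis mult.assoc mult.commute)
  qed
  finally have fact: "(M + 1) * (4 * q * \<tau> * \<tau>) < fact \<tau>" .
  have hD: "h \<le> \<Delta>" unfolding h_def by simp
  have qY: "real q \<le> 4 * Y"
  proof -
    have "D * (4 * b - 1) + 1 \<le> 4 * (D * b)" using D b by (cases b) (auto simp: algebra_simps)
    then have "h + 1 \<le> 4 * (D * b)" unfolding h_def by linarith
    then have "real (h + 1) \<le> real (4 * (D * b))" by (simp only: of_nat_le_iff)
    then have "sqrt (real h + 1) \<le> sqrt (4 * (real D * real b))" by simp
    also have "\<dots> = 2 * Y" unfolding Y_def by (simp add: real_sqrt_mult)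
    finally show ?thesis using q(2) sq1 by linarith
  qed
  have J: "real J \<le> B + 1"
  proof -
    have "real J \<le> log 2 (real (h + 1)) + 1" unfolding J_def by (rule lg_le) simp
    also have "log 2 (real (h + 1)) \<le> B" unfolding B_def using hD by (intro log_mono) auto
    finally show ?thesis by simp
  qed
  have \<tau>B: "real \<tau> \<le> (real \<kappa> + 10) * B"
  proof -
    have "sqrt (real h + 1) \<le> sqrt ((real h + 1) * (real h + 1))"
      by (intro real_sqrt_le_mono) (simp add: algebra_simps)
    then have "sqrt (real h + 1) \<le> real h + 1" by simp
    then have qD: "real q \<le> real \<Delta> + 2" using q(2) hD by simp
    have "real M \<le> real ((\<Delta> + 2) ^ \<kappa>)" using M by (simp only: of_nat_le_iff)
    then have "real M \<le> (real \<Delta> + 2) ^ \<kappa>" by (simp add: add.commute)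
    moreover have "1 \<le> (real \<Delta> + 2) ^ \<kappa>" by (rule one_le_power) simp
    ultimately have M2: "real M + 1 \<le> 2 * (real \<Delta> + 2) ^ \<kappa>" by linarith
    have "real X = 8 * (real M + 1) * real q" unfolding X_def by simp
    also have "\<dots> \<le> 8 * (2 * (real \<Delta> + 2) ^ \<kappa>) * (real \<Delta> + 2)"
      using M2 qD by (intro mult_mono) auto
    also have "\<dots> = 16 * (real \<Delta> + 2) ^ (\<kappa> + 1)" by simp
    finally have X: "real X \<le> 16 * (real \<Delta> + 2) ^ (\<kappa> + 1)" .
    have X1: "X \<ge> 1" unfolding X_def using q1 by simp
    have "real \<tau> \<le> log 2 (real X) + 5" unfolding \<tau>_def using lg_le[OF X1] by simp
    also have "log 2 (real X) \<le> log 2 (16 * (real \<Delta> + 2) ^ (\<kappa> + 1))" using X X1 by (intro log_mono) auto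
    also have "\<dots> = log 2 16 + log 2 ((real \<Delta> + 2) ^ (\<kappa> + 1))" by (subst log_mult) auto
    also have "log 2 ((real \<Delta> + 2) ^ (\<kappa> + 1)) = (real \<kappa> + 1) * B" unfolding B_def by (subst log_nat_power) auto
    also have "log 2 (16::real) = 4" using log_pow_cancel[of 2 4] by simp
    finally have "real \<tau> \<le> 9 * 1 + (real \<kappa> + 1) * B" by simp
    also have "\<dots> \<le> 9 * B + (real \<kappa> + 1) * B" using B1 by simp
    finally show ?thesis by (simp add: algebra_simps)
  qed
  have "real ((J + 1) * (3 * (4 * q * \<tau> * \<tau>)) + 1) = (real J + 1) * (12 * real q * (real \<tau> * real \<tau>)) + 1"
    by (simp add: algebra_simps)
  \<comment> \<open>J + 1 \<le> 3 B, so 144 = 3 * 12 * 4; the summand 1 is the connector round,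
    enlarged to Y B^3 in the next line.\<close>
  also have "\<dots> \<le> (3 * B) * (12 * (4 * Y) * (((real \<kappa> + 10) * B) * ((real \<kappa> + 10) * B))) + 1 * 1 * 1"
    using J B1 qY \<tau>B Y1 by (intro add_mono mult_mono) auto
  also have "\<dots> \<le> (3 * B) * (12 * (4 * Y) * (((real \<kappa> + 10) * B) * ((real \<kappa> + 10) * B))) + 1 * Y * B ^ 3"
    using Y1 B1 by (intro add_mono mult_mono) auto
  also have "\<dots> = (144 * (real \<kappa> + 10)\<^sup>2 + 1) * Y * B ^ 3"
    by (simp add: algebra_simps power2_eq_square power3_eq_cube)
  finally show ?thesis using fact hq hJ unfolding Y_def B_def
    by (intro exI[of _ q] exI[of _ \<tau>] exI[of _ J]) (simp add: \<tau>_def)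
qed

text \<open>\<open>Cst\<close> is fixed before n, \<Delta>, D, S and x, as an asymptotic bound
  demands, whereas F may depend on these parameters, which all vertices know.\<close>

lemma clique_cover_colouring_rounds:
  fixes c :: nat
  shows "\<exists>Cst::real. Cst \<ge> 1 \<and> (\<forall>n \<Delta> D S N x K. n \<ge> 1 \<longrightarrow> D \<ge> 2 \<longrightarrow> S \<ge> 1 \<longrightarrow> x \<ge> 1 \<longrightarrow> N \<ge> 1 \<longrightarrow>
    real N \<le> (2 * real n) ^ c \<longrightarrow> locally_determined 2 K \<longrightarrow>
    (\<forall>E v. \<forall>C\<in>K E v. v \<in> C \<and> C \<subseteq> insert v (nbrs E v)) \<longrightarrow>
    (\<exists>F R. locally_determined R F \<and>
      real R \<le> Cst * (real x * sqrt (real D * real S powr (1 / real (x + 1))) * log 2 (real \<Delta> + 2) ^ 3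
        + real (log_star n)) \<and>
      (\<forall>E. sym E \<longrightarrow> irrefl E \<longrightarrow> E \<subseteq> {..<N} \<times> {..<N} \<longrightarrow> degree_le E \<Delta> \<longrightarrow> clique_cover E D S (K E) \<longrightarrow>
         (\<forall>v. F E v < D ^ (x + 1) * S) \<and> proper_on E (F E))))"
proof -
  obtain \<kappa> :: nat where \<kappa>: "\<And>n \<Delta> N. n \<ge> 1 \<Longrightarrow> N \<ge> 1 \<Longrightarrow> real N \<le> (2 * real n) ^ c \<Longrightarrow>
    linial_colours \<Delta> N (2 * log_star n + 1) \<le> (\<Delta> + 2) ^ \<kappa>"
    using linial_colours_bound by blast
  define C1 where "C1 = 144 * (real \<kappa> + 10)\<^sup>2 + 1"
  have C1: "C1 \<ge> 1" unfolding C1_def by simp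
  have main: "\<exists>F R. locally_determined R F \<and>
      real R \<le> (4 * C1 + 3) * (real x * sqrt (real D * real S powr (1 / real (x + 1))) * log 2 (real \<Delta> + 2) ^ 3
        + real (log_star n)) \<and>
      (\<forall>E. sym E \<longrightarrow> irrefl E \<longrightarrow> E \<subseteq> {..<N} \<times> {..<N} \<longrightarrow> degree_le E \<Delta> \<longrightarrow> clique_cover E D S (K E) \<longrightarrow>
         (\<forall>v. F E v < D ^ (x + 1) * S) \<and> proper_on E (F E))"
    if n: "n \<ge> 1" and D: "D \<ge> 2" and S: "S \<ge> 1" and x: "x \<ge> 1" and N: "N \<ge> 1" "real N \<le> (2 * real n) ^ c"
      and K: "locally_determined 2 K" "\<forall>E v. \<forall>C\<in>K E v. v \<in> C \<and> C \<subseteq> insert v (nbrs E v)" for n \<Delta> D S N x K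
  proof -
    define s where "s = real S powr (1 / real (x + 1))"
    define Y where "Y = sqrt (real D * s)"
    define B where "B = log 2 (real \<Delta> + 2)"
    define b where "b = nat \<lceil>s\<rceil>"
    define T where "T = 2 * log_star n + 1"
    have s1: "s \<ge> 1" unfolding s_def using S by (intro ge_one_powr_ge_zero) auto
    have B1: "B \<ge> 1" unfolding B_def by simp
    have bs: "s \<le> real b" unfolding b_def by (rule real_nat_ceiling_ge)
    have "real b \<le> s + 1" unfolding b_def using s1 by linarith
    then have bs2: "real b \<le> 2 * s" using s1 by simp
    have b1: "b \<ge> 1" using bs s1 by linarith
    have "real S = s ^ (x + 1)"
      unfolding s_def using S by (simp add: powr_realpow[symmetric] powr_powr del: power_Suc)
    also have "\<dots> \<le> real b ^ (x + 1)" using bs s1 by (intro power_mono) auto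
    finally have "real S \<le> real (b ^ (x + 1))" by simp
    then have Sb: "S \<le> b ^ (x + 1)" by (simp only: of_nat_le_iff)
    have "linial_colours \<Delta> N T \<le> (\<Delta> + 2) ^ \<kappa>" unfolding T_def by (rule \<kappa>[OF n N])
    from colouring_parameters[OF _ b1 this, of D] obtain q \<tau> J where p:
      "(linial_colours \<Delta> N T + 1) * (4 * q * \<tau> * \<tau>) < fact \<tau>" "\<tau> \<ge> 1"
      "min \<Delta> (D * (4 * b - 1)) < q * q" "min \<Delta> (D * (4 * b - 1)) < 2 ^ J"
      "real ((J + 1) * (3 * (4 * q * \<tau> * \<tau>)) + 1) \<le> C1 * sqrt (real D * real b) * B ^ 3"
      using D unfolding C1_def B_def by auto
    define \<rho> where "\<rho> = (J + 1) * (3 * (4 * q * \<tau> * \<tau>)) + 1"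
    define R where "R = T + 2 + (x + 1) * \<rho>"
    obtain F where F: "locally_determined R F"
      "\<forall>E. sym E \<longrightarrow> irrefl E \<longrightarrow> E \<subseteq> {..<N} \<times> {..<N} \<longrightarrow> degree_le E \<Delta> \<longrightarrow> clique_cover E D S (K E) \<longrightarrow>
         (\<forall>v. F E v < D ^ (x + 1) * S) \<and> proper_on E (F E)"
      using clique_cover_colouring[OF D S x b1 Sb N(1) K(1) _ p(1-4)] K(2) unfolding R_def \<rho>_def by auto
    have "1 * 1 \<le> real D * s" using D s1 by (intro mult_mono) auto
    then have Y1: "Y \<ge> 1" unfolding Y_def by simp
    have "sqrt (real D * real b) \<le> sqrt (4 * (real D * s))"
      using bs2 s1 mult_left_mono[OF bs2, of "real D"] D by (intro real_sqrt_le_mono) (simp add: mult_nonneg_nonneg)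
    also have "\<dots> = 2 * Y" unfolding Y_def by (simp add: real_sqrt_mult)
    finally have "C1 * sqrt (real D * real b) * B ^ 3 \<le> C1 * (2 * Y) * B ^ 3"
      using C1 B1 by (intro mult_right_mono mult_left_mono) auto
    then have \<rho>: "real \<rho> \<le> C1 * (2 * Y) * B ^ 3" using p(5) unfolding \<rho>_def by linarith
    define Z where "Z = real x * Y * B ^ 3"
    have "1 * 1 * 1 \<le> Z" unfolding Z_def using x Y1 B1 by (intro mult_mono one_le_power) auto
    then have Z1: "Z \<ge> 1" by simp
    \<comment> \<open>The estimates x + 1 \<le> 2 x and sqrt (D b) \<le> 2 Y give the coefficient 4
      C1; the 3 in the final constant absorbs the rounds T + 2.\<close>
    have "real R = 2 * real (log_star n) + 3 + (real x + 1) * real \<rho>"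
      unfolding R_def T_def by (simp add: algebra_simps)
    also have "\<dots> \<le> 2 * real (log_star n) + 3 + (2 * real x) * (C1 * (2 * Y) * B ^ 3)"
      using x \<rho> by (intro add_left_mono mult_mono) auto
    also have "\<dots> = 2 * real (log_star n) + 3 + 4 * C1 * Z" unfolding Z_def by simp
    also have "\<dots> \<le> (4 * C1 + 3) * real (log_star n) + (3 * Z + 4 * C1 * Z)"
    proof -
      have "2 * real (log_star n) \<le> (4 * C1 + 3) * real (log_star n)" using C1 by (intro mult_right_mono) auto
      then show ?thesis using Z1 by linarith
    qed
    also have "\<dots> = (4 * C1 + 3) * (Z + real (log_star n))" by (simp add: algebra_simps)
    finally show ?thesis using F unfolding Z_def Y_def B_def s_def by blast
  qed
  show ?thesis
    by (intro exI[of _ "4 * C1 + 3"] conjI allI impI) (use C1 in linarith, rule main, assumption+)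
qed

section \<open>Vertex colouring\<close>

text \<open>Maximality refers to UNIV because a view reveals edges but not the vertex set; at
  vertices of V both notions agree by \<open>max_cliques_at_vertex\<close>.\<close>

definition max_cliques_at :: "(nat \<times> nat) set \<Rightarrow> nat \<Rightarrow> nat set set" where
  "max_cliques_at E v = {C. is_maximal_clique UNIV E C \<and> v \<in> C}"

lemma max_cliques_at_subset:
  "C \<in> max_cliques_at E v \<Longrightarrow> v \<in> C \<and> C \<subseteq> insert v (nbrs E v)"
proof -
  assume "C \<in> max_cliques_at E v"
  then have "is_clique UNIV E C" "v \<in> C" unfolding max_cliques_at_def is_maximal_clique_def by simp_all
  then show ?thesis unfolding is_clique_def nbrs_def by auto
qed

text \<open>A set containing a clique through v contains v itself, so maximality is decided by the
  cliques through v.\<close>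

lemma is_maximal_clique_cong:
  assumes "\<And>C. v \<in> C \<Longrightarrow> is_clique V E C \<longleftrightarrow> is_clique V' E' C"
  shows "{C. is_maximal_clique V E C \<and> v \<in> C} = {C. is_maximal_clique V' E' C \<and> v \<in> C}"
proof (rule Collect_cong)
  fix C
  show "(is_maximal_clique V E C \<and> v \<in> C) = (is_maximal_clique V' E' C \<and> v \<in> C)"
  proof (cases "v \<in> C")
    case True
    have "(is_clique V E K \<and> C \<subseteq> K) = (is_clique V' E' K \<and> C \<subseteq> K)" for K
      using assms[of K] True by blast
    then show ?thesis unfolding is_maximal_clique_def using assms[OF True] by simp
  qed simp
qed

text \<open>An edge inside a clique through v starts at v or at a neighbour of v, so two rounds show
  it.\<close>

lemma local_max_cliques_at: "locally_determined 2 max_cliques_at"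
proof -
  have cl: "is_clique UNIV E' C"
    if eq: "local_view E 2 v = local_view E' 2 v" and C: "is_clique UNIV E C" "v \<in> C" for E E' v C
    unfolding is_clique_def
  proof (intro conjI ballI impI)
    fix a b assume ab: "a \<in> C" "b \<in> C" "a \<noteq> b"
    then have e: "(a, b) \<in> E" using C unfolding is_clique_def by blast
    show "(a, b) \<in> E'"
    proof (cases "a = v")
      case True
      then show ?thesis using local_view_edgeD[OF eq, of a 0 b] e by simp
    next
      case False
      then have "(v, a) \<in> E ^^ 1" using C ab unfolding is_clique_def by auto
      then show ?thesis using local_view_edgeD[OF eq, of a 1 b] e by simp
    qed
  qed simp
  have "max_cliques_at E v = max_cliques_at E' v" if eq: "local_view E 2 v = local_view E' 2 v" for E E' v
  proof -
    have "is_clique UNIV E C \<longleftrightarrow> is_clique UNIV E' C" if "v \<in> C" for C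
      using cl[OF eq] cl[OF eq[symmetric]] that by blast
    then show ?thesis unfolding max_cliques_at_def by (rule is_maximal_clique_cong)
  qed
  then show ?thesis unfolding locally_determined_def by blast
qed

section \<open>The maximal cliques of a finite simple graph\<close>

context
  fixes V :: "nat set" and E :: "(nat \<times> nat) set"
  assumes G: "simple_graph V E"
begin

lemma finite_vertices: "finite V" and edges_subset: "E \<subseteq> V \<times> V" and sym_edges: "sym E"
  and irrefl_edges: "irrefl E" and vertices_nonempty: "V \<noteq> {}"
  using G unfolding simple_graph_def by auto

lemma nbrs_subset: "nbrs E v \<subseteq> V"
  using edges_subset unfolding nbrs_def by auto

lemma nbrs_outside: "v \<notin> V \<Longrightarrow> nbrs E v = {}"
  using edges_subset unfolding nbrs_def by auto

lemma degree_le_max_degree: "degree_le E (max_degree V E)"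
  unfolding degree_le_def
proof (intro allI conjI)
  fix v
  show "finite (nbrs E v)" by (rule finite_subset[OF nbrs_subset finite_vertices])
  show "card (nbrs E v) \<le> max_degree V E"
  proof (cases "v \<in> V")
    case True
    then show ?thesis unfolding max_degree_def using finite_vertices by (intro Max_ge) auto
  next
    case False
    then show ?thesis by (simp add: nbrs_outside)
  qed
qed

lemma card_clique_le:
  assumes "is_clique V E C" shows "card C \<le> clique_number V E"
proof -
  have "{card K |K. is_clique V E K} \<subseteq> card ` Pow V" unfolding is_clique_def by auto
  then have "finite {card K |K. is_clique V E K}" using finite_vertices by (meson finite_Pow_iff finite_imageI finite_subset)
  then show ?thesis unfolding clique_number_def using assms by (intro Max_ge) auto
qed

lemma clique_number_ge_1: "clique_number V E \<ge> 1"
proof -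
  obtain v where "v \<in> V" using vertices_nonempty by auto
  then have "is_clique V E {v}" unfolding is_clique_def by auto
  then show ?thesis using card_clique_le[of "{v}"] by simp
qed

lemma clique_subset_vertices:
  assumes "is_clique UNIV E C" "v \<in> C" "v \<in> V" shows "is_clique V E C"
proof -
  have "b \<in> V" if "b \<in> C" for b
    using assms that edges_subset unfolding is_clique_def by (cases "b = v") auto
  then show ?thesis using assms(1) unfolding is_clique_def by auto
qed

lemma max_cliques_at_vertex:
  assumes "v \<in> V" shows "max_cliques_at E v = {C. is_maximal_clique V E C \<and> v \<in> C}"
proof -
  have "is_clique UNIV E C \<longleftrightarrow> is_clique V E C" if "v \<in> C" for C
    using clique_subset_vertices[OF _ that assms] unfolding is_clique_def by auto
  then show ?thesis unfolding max_cliques_at_def by (rule is_maximal_clique_cong)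
qed

lemma clique_cover_max_cliques:
  assumes "diversity V E \<ge> 1"
  shows "clique_cover E (diversity V E) (clique_number V E) (max_cliques_at E)"
  unfolding clique_cover_def
proof (intro conjI allI ballI impI)
  fix v
  have finN: "finite (insert v (nbrs E v))" using degree_le_max_degree unfolding degree_le_def by simp
  have sub: "max_cliques_at E v \<subseteq> Pow (insert v (nbrs E v))" using max_cliques_at_subset by blast
  show "finite (max_cliques_at E v)" by (rule finite_subset[OF sub]) (use finN in simp)
  \<comment> \<open>A number outside V is isolated and lies only in its own singleton, which D \<ge>
    1 and S \<ge> 1 admit.\<close>
  have outside: "max_cliques_at E v \<subseteq> {{v}}" if "v \<notin> V"
    using max_cliques_at_subset[of _ E v] nbrs_outside[OF that] by blast
  show "card (max_cliques_at E v) \<le> diversity V E"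
  proof (cases "v \<in> V")
    case True
    have "card (max_cliques_at E v) = vertex_diversity V E v"
      unfolding vertex_diversity_def max_cliques_at_vertex[OF True] ..
    also have "\<dots> \<le> diversity V E"
      unfolding diversity_def using True finite_vertices by (intro Max_ge) auto
    finally show ?thesis .
  next
    case False
    then have "card (max_cliques_at E v) \<le> card {{v}}" using outside by (intro card_mono) auto
    then show ?thesis using assms by simp
  qed
next
  fix v C assume C: "C \<in> max_cliques_at E v"
  show "v \<in> C" "C \<subseteq> insert v (nbrs E v)" using max_cliques_at_subset[OF C] by auto
  show "card C \<le> clique_number V E"
  proof (cases "v \<in> V")
    case True
    then show ?thesis
      using C clique_subset_vertices[of C v] unfolding max_cliques_at_def is_maximal_clique_def
      by (intro card_clique_le) simp
  next
    case False
    then have "C = {v}" using max_cliques_at_subset[OF C] nbrs_outside by auto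
    then show ?thesis using clique_number_ge_1 by simp
  qed
  fix u assume "u \<in> C"
  then show "C \<in> max_cliques_at E u" using C unfolding max_cliques_at_def by simp
next
  fix u w assume uw: "(u, w) \<in> E"
  \<comment> \<open>The edge extends to a maximal clique because only finitely many cliques pass
    through u.\<close>
  let ?A = "{K. is_clique UNIV E K \<and> u \<in> K}"
  have "?A \<subseteq> Pow (insert u (nbrs E u))" unfolding is_clique_def nbrs_def by auto
  moreover have "finite (Pow (insert u (nbrs E u)))" using degree_le_max_degree unfolding degree_le_def by simp
  ultimately have "finite ?A" by (rule finite_subset)
  moreover have "{u, w} \<in> ?A" using uw sym_edges unfolding is_clique_def sym_def by auto
  ultimately obtain C where C: "C \<in> ?A" "{u, w} \<subseteq> C" "\<forall>K\<in>?A. C \<subseteq> K \<longrightarrow> C = K"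
    using finite_has_maximal2[of ?A "{u, w}"] by blast
  have "K = C" if "is_clique UNIV E K" "C \<subseteq> K" for K
    using C that by blast
  then have "is_maximal_clique UNIV E C" using C(1) unfolding is_maximal_clique_def by simp
  then show "\<exists>C\<in>max_cliques_at E u. w \<in> C" using C(1,2) unfolding max_cliques_at_def by (intro bexI[of _ C]) auto
qed

end

text \<open>A vertex receives a view, not a graph. It evaluates F on some graph with this view;
  locality makes the outcome independent of the choice.\<close>

definition run_on_view ::
  "((nat \<times> nat) set \<Rightarrow> nat \<Rightarrow> 'a) \<Rightarrow> nat \<Rightarrow> nat \<times> (nat \<times> nat) set \<Rightarrow> 'a" where
  "run_on_view F r w = F (SOME E. local_view E r (fst w) = w) (fst w)"

lemma run_on_view:
  assumes "locally_determined R F" "R \<le> r"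
  shows "run_on_view F r (local_view E r v) = F E v"
proof -
  have fst: "fst (local_view E r v) = v" unfolding local_view_def by simp
  have "local_view (SOME E'. local_view E' r v = local_view E r v) r v = local_view E r v"
    by (rule someI[of _ E]) (rule refl)
  then show ?thesis
    unfolding run_on_view_def fst
    using locally_determined_mono[OF assms] unfolding locally_determined_def by blast
qed

lemma le_nat_ceiling: "real R \<le> z \<Longrightarrow> R \<le> nat \<lceil>z\<rceil>"
  by linarith

lemma vertex_colouring:
  fixes c :: nat and xf :: "nat \<Rightarrow> nat"
  assumes c: "c \<ge> 1" and xf: "\<And>S. xf S \<ge> 1"
  shows "\<exists>(C::real) (A :: nat \<Rightarrow> nat \<Rightarrow> nat \<Rightarrow> nat \<Rightarrow> nat \<times> (nat \<times> nat) set \<Rightarrow> nat).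
    \<forall>V E. simple_graph V E \<and> V \<subseteq> {..card V ^ c} \<and> diversity V E \<ge> 2 \<longrightarrow>
      (let n = card V; \<Delta> = max_degree V E; D = diversity V E; S = clique_number V E; x = xf S;
           r = nat \<lceil>C * (real x * sqrt (real D * real S powr (1 / real (x + 1)))
                        * (log 2 (real \<Delta> + 2)) ^ 3 + real (log_star n))\<rceil>
       in proper_vertex_coloring V E (\<lambda>v. A n \<Delta> D S (local_view E r v)) (D ^ (x + 1) * S))"
proof -
  from clique_cover_colouring_rounds[of c] obtain C :: real where C: "C \<ge> 1 \<and> (\<forall>n \<Delta> D S N x K. n \<ge> 1 \<longrightarrow> D \<ge> 2 \<longrightarrow>
    S \<ge> 1 \<longrightarrow> x \<ge> 1 \<longrightarrow> N \<ge> 1 \<longrightarrow>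
    real N \<le> (2 * real n) ^ c \<longrightarrow> locally_determined 2 K \<longrightarrow>
    (\<forall>E v. \<forall>C\<in>K E v. v \<in> C \<and> C \<subseteq> insert v (nbrs E v)) \<longrightarrow>
    (\<exists>F R. locally_determined R F \<and>
      real R \<le> C * (real x * sqrt (real D * real S powr (1 / real (x + 1))) * log 2 (real \<Delta> + 2) ^ 3
        + real (log_star n)) \<and>
      (\<forall>E. sym E \<longrightarrow> irrefl E \<longrightarrow> E \<subseteq> {..<N} \<times> {..<N} \<longrightarrow> degree_le E \<Delta> \<longrightarrow> clique_cover E D S (K E) \<longrightarrow>
         (\<forall>v. F E v < D ^ (x + 1) * S) \<and> proper_on E (F E))))" ..
  define rr where "rr n \<Delta> D S = nat \<lceil>C * (real (xf S) * sqrt (real D * real S powr (1 / real (xf S + 1)))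
                        * (log 2 (real \<Delta> + 2)) ^ 3 + real (log_star n))\<rceil>" for n \<Delta> D S
  define good where "good n \<Delta> D S F \<longleftrightarrow> (\<exists>R\<le>rr n \<Delta> D S. locally_determined R F) \<and>
      (\<forall>E. sym E \<longrightarrow> irrefl E \<longrightarrow> E \<subseteq> {..<n ^ c + 1} \<times> {..<n ^ c + 1} \<longrightarrow> degree_le E \<Delta> \<longrightarrow>
         clique_cover E D S (max_cliques_at E) \<longrightarrow> (\<forall>v. F E v < D ^ (xf S + 1) * S) \<and> proper_on E (F E))"
    for n \<Delta> D S and F :: "(nat \<times> nat) set \<Rightarrow> nat \<Rightarrow> nat"
  \<comment> \<open>F is chosen from global parameters alone, so all vertices run the same
    algorithm; seeing farther than its R rounds does not change the result.\<close>
  define A where "A n \<Delta> D S w = run_on_view (SOME F. good n \<Delta> D S F) (rr n \<Delta> D S) w" for n \<Delta> D S w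
  have "proper_vertex_coloring V E (\<lambda>v. A (card V) (max_degree V E) (diversity V E) (clique_number V E)
      (local_view E (rr (card V) (max_degree V E) (diversity V E) (clique_number V E)) v))
      (diversity V E ^ (xf (clique_number V E) + 1) * clique_number V E)"
    if G: "simple_graph V E" and V: "V \<subseteq> {..card V ^ c}" and D: "diversity V E \<ge> 2" for V E
  proof -
    let ?n = "card V" and ?D = "diversity V E" and ?S = "clique_number V E" and ?\<Delta> = "max_degree V E"
    have n: "?n \<ge> 1" using finite_vertices[OF G] vertices_nonempty[OF G] by (simp add: Suc_le_eq card_gt_0_iff)
    \<comment> \<open>The ID 0 is allowed, so there are n^c + 1 possible IDs; the base 2 n absorbs
      the additional one.\<close>
    have N: "real (?n ^ c + 1) \<le> (2 * real ?n) ^ c"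
    proof -
      have "1 \<le> ?n ^ c" using n by (rule one_le_power)
      then have "?n ^ c + 1 \<le> 2 * ?n ^ c" by simp
      also have "\<dots> \<le> 2 ^ c * ?n ^ c" using c by (intro mult_le_mono1) (metis power_increasing power_one_right one_le_numeral)
      finally have "real (?n ^ c + 1) \<le> real (2 ^ c * ?n ^ c)" by (simp only: of_nat_le_iff)
      then show ?thesis by (simp add: power_mult_distrib)
    qed
    have sub: "\<forall>E v. \<forall>C\<in>max_cliques_at E v. v \<in> C \<and> C \<subseteq> insert v (nbrs E v)"
      using max_cliques_at_subset by simp
    have S: "?S \<ge> 1" by (rule clique_number_ge_1[OF G])
    have "\<exists>F R. locally_determined R F \<and>
      real R \<le> C * (real (xf ?S) * sqrt (real ?D * real ?S powr (1 / real (xf ?S + 1))) * log 2 (real ?\<Delta> + 2) ^ 3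
        + real (log_star ?n)) \<and>
      (\<forall>E. sym E \<longrightarrow> irrefl E \<longrightarrow> E \<subseteq> {..<?n ^ c + 1} \<times> {..<?n ^ c + 1} \<longrightarrow> degree_le E ?\<Delta> \<longrightarrow>
        clique_cover E ?D ?S (max_cliques_at E) \<longrightarrow> (\<forall>v. F E v < ?D ^ (xf ?S + 1) * ?S) \<and> proper_on E (F E))"
      by (rule C[THEN conjunct2, rule_format])
        (use n D S xf N local_max_cliques_at sub in \<open>simp_all only: le_add2\<close>)
    then obtain F R where F: "locally_determined R F"
      "real R \<le> C * (real (xf ?S) * sqrt (real ?D * real ?S powr (1 / real (xf ?S + 1))) * log 2 (real ?\<Delta> + 2) ^ 3
        + real (log_star ?n))"
      "\<forall>E. sym E \<longrightarrow> irrefl E \<longrightarrow> E \<subseteq> {..<?n ^ c + 1} \<times> {..<?n ^ c + 1} \<longrightarrow> degree_le E ?\<Delta> \<longrightarrow>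
        clique_cover E ?D ?S (max_cliques_at E) \<longrightarrow> (\<forall>v. F E v < ?D ^ (xf ?S + 1) * ?S) \<and> proper_on E (F E)"
      by blast
    have "good ?n ?\<Delta> ?D ?S F" unfolding good_def rr_def using F le_nat_ceiling by blast
    then have good: "good ?n ?\<Delta> ?D ?S (SOME F. good ?n ?\<Delta> ?D ?S F)"
      by (rule someI[of "good ?n ?\<Delta> ?D ?S"])
    define F' where "F' = (SOME F. good ?n ?\<Delta> ?D ?S F)"
    have "A ?n ?\<Delta> ?D ?S (local_view E (rr ?n ?\<Delta> ?D ?S) v) = F' E v" for v
      using good unfolding A_def F'_def good_def by (auto intro: run_on_view)
    moreover have "E \<subseteq> {..<?n ^ c + 1} \<times> {..<?n ^ c + 1}" using edges_subset[OF G] V by fastforce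
    then have "(\<forall>v. F' E v < ?D ^ (xf ?S + 1) * ?S) \<and> proper_on E (F' E)"
      using good sym_edges[OF G] irrefl_edges[OF G] degree_le_max_degree[OF G]
        clique_cover_max_cliques[OF G] D unfolding good_def F'_def by simp
    ultimately show ?thesis unfolding proper_vertex_coloring_def proper_on_def by auto
  qed
  then show ?thesis unfolding rr_def Let_def by blast
qed

section \<open>Edge colouring\<close>

text \<open>Edges become vertices of the line graph and need numbers as IDs. Sorting the endpoints
  makes both compute the same number, which stays polynomial in the IDs by
  \<open>edge_code_less\<close>.\<close>

definition edge_code :: "nat \<Rightarrow> nat \<Rightarrow> nat" where
  "edge_code u w = prod_encode (min u w, max u w)"

definition ends :: "nat \<Rightarrow> nat set" where
  "ends e = {fst (prod_decode e), snd (prod_decode e)}"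

definition line_graph :: "(nat \<times> nat) set \<Rightarrow> (nat \<times> nat) set" where
  "line_graph E = {(e, f). e \<noteq> f \<and>
     (\<exists>u w w'. (u, w) \<in> E \<and> (u, w') \<in> E \<and> e = edge_code u w \<and> f = edge_code u w')}"

lemma ends_edge_code: "ends (edge_code u w) = {u, w}"
  unfolding ends_def edge_code_def by (auto simp: min_def max_def)

lemma edge_code_commute: "edge_code u w = edge_code w u"
  unfolding edge_code_def by (simp add: min.commute max.commute)

lemma edge_code_eq_iff: "edge_code u w = edge_code u' w' \<longleftrightarrow> u = u' \<and> w = w' \<or> u = w' \<and> w = u'"
proof
  assume "edge_code u w = edge_code u' w'"
  then have "{u, w} = {u', w'}" using ends_edge_code by metis
  then show "u = u' \<and> w = w' \<or> u = w' \<and> w = u'" by (auto simp: doubleton_eq_iff)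
qed (auto simp: edge_code_commute)

lemma edge_code_less:
  assumes "u \<le> k" "w \<le> k"
  shows "edge_code u w < (2 * k + 1)\<^sup>2"
proof -
  let ?a = "min u w" and ?b = "max u w"
  have "edge_code u w = triangle (?a + ?b) + ?a" unfolding edge_code_def prod_encode_def by simp
  also have "triangle (?a + ?b) \<le> (?a + ?b) * Suc (?a + ?b)" unfolding triangle_def by simp
  also have "(?a + ?b) * Suc (?a + ?b) + ?a < (?a + ?b + 1)\<^sup>2" by (simp add: power2_eq_square)
  also have "\<dots> \<le> (2 * k + 1)\<^sup>2" using assms by (intro power_mono) auto
  finally show ?thesis by simp
qed

section \<open>Views of the line graph\<close>

lemma line_graphE:
  assumes "(e, f) \<in> line_graph E"
  obtains u w w' where "(u, w) \<in> E" "(u, w') \<in> E" "e = edge_code u w" "f = edge_code u w'" "w \<noteq> w'"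
  using assms unfolding line_graph_def by auto

text \<open>Adjacent edges meet in an endpoint of the previous one, so each step in the line graph
  moves at most one step farther from u.\<close>

lemma line_graph_reach:
  assumes "sym E" "(u, w) \<in> E" "(edge_code u w, f) \<in> line_graph E ^^ k"
  shows "\<exists>c d j. f = edge_code c d \<and> (c, d) \<in> E \<and> j \<le> k \<and> (u, c) \<in> E ^^ j"
  using assms(3)
proof (induction k arbitrary: f)
  case 0
  then have "f = edge_code u w \<and> (u, w) \<in> E \<and> (0::nat) \<le> 0 \<and> (u, u) \<in> E ^^ 0" using assms(2) by simp
  then show ?case by blast
next
  case (Suc k)
  then obtain g where g: "(edge_code u w, g) \<in> line_graph E ^^ k" "(g, f) \<in> line_graph E" by auto
  obtain c d j where c: "g = edge_code c d" "(c, d) \<in> E" "j \<le> k" "(u, c) \<in> E ^^ j"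
    using Suc.IH[OF g(1)] by blast
  obtain a b b' where a: "(a, b) \<in> E" "(a, b') \<in> E" "g = edge_code a b" "f = edge_code a b'"
    using g(2) by (rule line_graphE)
  have "a = c \<or> a = d" using c(1) a(3) edge_code_eq_iff by auto
  then obtain i where i: "i \<le> Suc k" "(u, a) \<in> E ^^ i"
  proof
    assume "a = c"
    then show ?thesis using that[of j] c by simp
  next
    assume "a = d"
    then show ?thesis using that[of "Suc j"] c by auto
  qed
  then show ?case using a by blast
qed

text \<open>An endpoint of an edge simulates the line graph with one additional round: the endpoint
  shared by two line-graph neighbours may be the far end of an edge already reached.\<close>

lemma line_graph_view:
  assumes sym: "sym E" "sym E'" and uw: "(u, w) \<in> E"
    and view: "local_view E (r + 1) u = local_view E' (r + 1) u"
  shows "local_view (line_graph E) r (edge_code u w) = local_view (line_graph E') r (edge_code u w)"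
proof -
  have edge: "(f, g) \<in> line_graph E'"
    if A: "sym E" "(u, w) \<in> E" "local_view E (r + 1) u = local_view E' (r + 1) u" "k < r"
      "(edge_code u w, f) \<in> line_graph E ^^ k" "(f, g) \<in> line_graph E" for E E' k f g
  proof -
    obtain c d j where c: "f = edge_code c d" "(c, d) \<in> E" "j \<le> k" "(u, c) \<in> E ^^ j"
      using line_graph_reach[OF A(1,2,5)] by blast
    obtain a b b' where a: "(a, b) \<in> E" "(a, b') \<in> E" "f = edge_code a b" "g = edge_code a b'" "b \<noteq> b'"
      using A(6) by (rule line_graphE)
    have "a = c \<or> a = d" using c(1) a(3) edge_code_eq_iff by auto
    then obtain i where i: "i < r + 1" "(u, a) \<in> E ^^ i"
    proof
      assume "a = c"
      then show ?thesis using that[of j] c \<open>k < r\<close> by simp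
    next
      assume "a = d"
      then show ?thesis using that[of "Suc j"] c \<open>k < r\<close> by auto
    qed
    then have "(a, b) \<in> E'" "(a, b') \<in> E'" using local_view_edgeD[OF A(3)] a(1,2) by blast+
    moreover have "f \<noteq> g" using \<open>(f, g) \<in> line_graph E\<close> unfolding line_graph_def by simp
    ultimately show ?thesis using a(3,4) unfolding line_graph_def by blast
  qed
  have path: "(edge_code u w, f) \<in> line_graph E' ^^ k"
    if A: "sym E" "(u, w) \<in> E" "local_view E (r + 1) u = local_view E' (r + 1) u" "k \<le> r"
      "(edge_code u w, f) \<in> line_graph E ^^ k" for E E' k f
    using A(4,5)
  proof (induction k arbitrary: f)
    case (Suc k)
    then obtain g where g: "(edge_code u w, g) \<in> line_graph E ^^ k" "(g, f) \<in> line_graph E" by auto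
    then have "(g, f) \<in> line_graph E'" using edge[OF A(1-3), of k] Suc.prems by simp
    moreover have "(edge_code u w, g) \<in> line_graph E' ^^ k" using Suc g by simp
    ultimately show ?case by auto
  qed simp
  have sub: "{(f, g) \<in> line_graph E. \<exists>k<r. (edge_code u w, f) \<in> line_graph E ^^ k} \<subseteq>
      {(f, g) \<in> line_graph E'. \<exists>k<r. (edge_code u w, f) \<in> line_graph E' ^^ k}"
    if "sym E" "(u, w) \<in> E" "local_view E (r + 1) u = local_view E' (r + 1) u" for E E'
  proof clarify
    fix f g k assume k: "(f, g) \<in> line_graph E" "k < r" "(edge_code u w, f) \<in> line_graph E ^^ k"
    have "(f, g) \<in> line_graph E'" by (rule edge[OF that k(2,3,1)])
    moreover have "(edge_code u w, f) \<in> line_graph E' ^^ k" by (rule path[OF that _ k(3)]) (use k in simp)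
    ultimately show "(f, g) \<in> line_graph E' \<and> (\<exists>k<r. (edge_code u w, f) \<in> line_graph E' ^^ k)" using k(2) by blast
  qed
  have uw': "(u, w) \<in> E'" by (rule local_view_edgeD[OF view, of u 0]) (use uw in simp_all)
  show ?thesis
    unfolding local_view_def using sub[OF sym(1) uw view] sub[OF sym(2) uw' view[symmetric]] by auto
qed

text \<open>The stars are expressed through the line graph and the codes only, since the cover has
  to be a function of the graph on which the colouring runs.\<close>

definition star_cliques :: "(nat \<times> nat) set \<Rightarrow> nat \<Rightarrow> nat set set" where
  "star_cliques L e = (\<lambda>a. {f \<in> insert e (nbrs L e). a \<in> ends f}) ` ends e"

lemma star_cliques_subset: "C \<in> star_cliques L e \<Longrightarrow> e \<in> C \<and> C \<subseteq> insert e (nbrs L e)"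
  unfolding star_cliques_def by auto

lemma local_star_cliques: "locally_determined 2 star_cliques"
  unfolding locally_determined_def
proof (intro allI impI)
  fix L L' :: "(nat \<times> nat) set" and e assume "local_view L 2 e = local_view L' 2 e"
  then have "nbrs L e = nbrs L' e" by (rule local_view_nbrs) simp
  then show "star_cliques L e = star_cliques L' e" unfolding star_cliques_def by simp
qed

lemma sym_line_graph: "sym (line_graph E)"
  unfolding line_graph_def by (rule symI) auto

lemma irrefl_line_graph: "irrefl (line_graph E)"
  unfolding line_graph_def irrefl_def by auto

text \<open>The local description at one edge yields the entire star of a, so all edges at a compute
  the same clique.\<close>

lemma star_eq:
  assumes "sym E" "(a, x) \<in> E"
  shows "{f \<in> insert (edge_code a x) (nbrs (line_graph E) (edge_code a x)). a \<in> ends f} =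
    edge_code a ` nbrs E a" (is "?L = ?R")
proof (intro equalityI subsetI)
  fix f assume f: "f \<in> ?L"
  show "f \<in> ?R"
  proof (cases "f = edge_code a x")
    case True
    then show ?thesis using assms unfolding nbrs_def by auto
  next
    case False
    then have "(edge_code a x, f) \<in> line_graph E" using f unfolding nbrs_def by simp
    then obtain u w w' where u: "(u, w) \<in> E" "(u, w') \<in> E" "f = edge_code u w'"
      by (rule line_graphE) blast
    have "a \<in> {u, w'}" using f u(3) ends_edge_code by auto
    then consider "a = u" | "a = w'" by auto
    then show ?thesis
    proof cases
      case 1
      then show ?thesis using u unfolding nbrs_def by auto
    next
      case 2
      then have "f = edge_code a u" "(a, u) \<in> E"
        using u assms(1) edge_code_commute unfolding sym_def by auto
      then show ?thesis unfolding nbrs_def by auto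
    qed
  qed
next
  fix f assume "f \<in> ?R"
  then obtain y where y: "f = edge_code a y" "(a, y) \<in> E" unfolding nbrs_def by auto
  then have "f = edge_code a x \<or> (edge_code a x, f) \<in> line_graph E"
    using assms(2) unfolding line_graph_def by blast
  then show "f \<in> ?L" using y ends_edge_code unfolding nbrs_def by auto
qed

lemma edge_code_cases:
  obtains (edge) u w where "e = edge_code u w" "(u, w) \<in> E" | (other) "nbrs (line_graph E) e = {}"
proof (cases "\<exists>u w. e = edge_code u w \<and> (u, w) \<in> E")
  case True
  then show ?thesis using edge by blast
next
  case False
  then have "nbrs (line_graph E) e = {}" unfolding nbrs_def line_graph_def by blast
  then show ?thesis by (rule other)
qed

lemma star_cliques_edge:
  assumes "sym E" "(u, w) \<in> E"
  shows "star_cliques (line_graph E) (edge_code u w) = {edge_code u ` nbrs E u, edge_code w ` nbrs E w}"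
proof -
  have "(w, u) \<in> E" using assms unfolding sym_def by blast
  then show ?thesis
    unfolding star_cliques_def ends_edge_code
    using star_eq[OF assms] star_eq[OF assms(1), of w u] edge_code_commute[of u w] by simp
qed

lemma star_cliques_other:
  assumes "nbrs (line_graph E) e = {}"
  shows "star_cliques (line_graph E) e = {{e}}"
  unfolding star_cliques_def assms by (auto simp: ends_def)

lemma card_star: "degree_le E \<Delta> \<Longrightarrow> card (edge_code u ` nbrs E u) \<le> \<Delta>"
  unfolding degree_le_def by (meson card_image_le le_trans)

text \<open>The degree of the line graph enters the round count only through a logarithm, so
  counting two full stars is precise enough.\<close>

lemma degree_line_graph:
  assumes E: "sym E" and deg: "degree_le E \<Delta>"
  shows "degree_le (line_graph E) (2 * \<Delta>)"
  unfolding degree_le_def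
proof (intro allI)
  fix e
  show "finite (nbrs (line_graph E) e) \<and> card (nbrs (line_graph E) e) \<le> 2 * \<Delta>"
  proof (cases rule: edge_code_cases[of e E])
    case (edge u w)
    let ?S = "edge_code u ` nbrs E u \<union> edge_code w ` nbrs E w"
    have "nbrs (line_graph E) e \<subseteq> ?S"
    proof
      fix f assume "f \<in> nbrs (line_graph E) e"
      then have "(e, f) \<in> line_graph E" unfolding nbrs_def by simp
      then obtain a b b' where a: "(a, b) \<in> E" "(a, b') \<in> E" "e = edge_code a b" "f = edge_code a b'"
        by (rule line_graphE)
      then have "a = u \<or> a = w" using edge(1) edge_code_eq_iff by auto
      then show "f \<in> ?S" using a unfolding nbrs_def by auto
    qed
    moreover have fin: "finite ?S" using deg unfolding degree_le_def by simp
    moreover have "card ?S \<le> \<Delta> + \<Delta>"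
      using card_Un_le[of "edge_code u ` nbrs E u" "edge_code w ` nbrs E w"] card_star[OF deg, of u] card_star[OF deg, of w]
      by linarith
    ultimately show ?thesis using card_mono[OF fin, of "nbrs (line_graph E) e"] finite_subset[of "nbrs (line_graph E) e" ?S] by simp
  next
    case other
    then show ?thesis by simp
  qed
qed

text \<open>An edge lies in the stars of its two endpoints, whence D = 2 and S = \<Delta>. A number
  that codes no edge has the single clique {e}, whose size 1 is at most \<Delta>.\<close>

lemma clique_cover_stars:
  assumes E: "sym E" and deg: "degree_le E \<Delta>" and \<Delta>: "\<Delta> \<ge> 1"
  shows "clique_cover (line_graph E) 2 \<Delta> (star_cliques (line_graph E))"
  unfolding clique_cover_def
proof (intro conjI allI ballI impI)
  fix e
  have ends: "finite (ends e)" "card (ends e) \<le> 2"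
    unfolding ends_def by (simp_all add: card_insert_if)
  show "finite (star_cliques (line_graph E) e)" using ends unfolding star_cliques_def by simp
  show "card (star_cliques (line_graph E) e) \<le> 2"
    using ends card_image_le[OF ends(1)] unfolding star_cliques_def by (meson le_trans)
next
  fix e C assume C: "C \<in> star_cliques (line_graph E) e"
  show "e \<in> C" "C \<subseteq> insert e (nbrs (line_graph E) e)" using star_cliques_subset[OF C] by auto
  show "card C \<le> \<Delta>"
  proof (cases rule: edge_code_cases[of e E])
    case (edge u w)
    then show ?thesis using C star_cliques_edge[OF E edge(2)] card_star[OF deg] by auto
  next
    case other
    then show ?thesis using C star_cliques_other[of E e] \<Delta> by simp
  qed
  fix f assume f: "f \<in> C"
  show "C \<in> star_cliques (line_graph E) f"
  proof (cases rule: edge_code_cases[of e E])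
    case (edge u w)
    then obtain a where "C = edge_code a ` nbrs E a" using C star_cliques_edge[OF E edge(2)] by auto
    moreover from this obtain y where "f = edge_code a y" "(a, y) \<in> E" using f unfolding nbrs_def by auto
    ultimately show ?thesis using star_cliques_edge[OF E, of a y] by simp
  next
    case other
    then show ?thesis using C f star_cliques_other[of E e] by simp
  qed
next
  fix e f assume "(e, f) \<in> line_graph E"
  then obtain u w w' where u: "(u, w) \<in> E" "(u, w') \<in> E" "e = edge_code u w" "f = edge_code u w'"
    by (rule line_graphE)
  have "f \<in> edge_code u ` nbrs E u" using u unfolding nbrs_def by auto
  then show "\<exists>C\<in>star_cliques (line_graph E) e. f \<in> C"
    using star_cliques_edge[OF E u(1)] u(3) by simp
qed

text \<open>The reconstructed graph is required to be symmetric because the transfer of views in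
  \<open>line_graph_view\<close> needs it.\<close>

definition run_on_line_view ::
  "((nat \<times> nat) set \<Rightarrow> nat \<Rightarrow> 'a) \<Rightarrow> nat \<Rightarrow> nat \<times> (nat \<times> nat) set \<Rightarrow> nat \<Rightarrow> 'a" where
  "run_on_line_view F r v w =
     F (line_graph (SOME E. sym E \<and> local_view E r (fst v) = v)) (edge_code (fst v) w)"

lemma run_on_line_view:
  assumes F: "locally_determined R F" "R + 1 \<le> r" and E: "sym E" "(u, w) \<in> E"
  shows "run_on_line_view F r (local_view E r u) w = F (line_graph E) (edge_code u w)"
proof -
  define E' where "E' = (SOME E'. sym E' \<and> local_view E' r u = local_view E r u)"
  have fst: "fst (local_view E r u) = u" unfolding local_view_def by simp
  have "\<exists>E'. sym E' \<and> local_view E' r u = local_view E r u" using E by blast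
  then have E': "sym E'" "local_view E' r u = local_view E r u"
    using someI_ex[of "\<lambda>E'. sym E' \<and> local_view E' r u = local_view E r u"] unfolding E'_def by blast+
  have "local_view E (R + 1) u = local_view E' (R + 1) u"
    by (rule local_view_mono[OF E'(2)[symmetric] F(2)])
  then have "local_view (line_graph E) R (edge_code u w) = local_view (line_graph E') R (edge_code u w)"
    by (rule line_graph_view[OF E(1) E'(1) E(2)])
  then have "F (line_graph E) (edge_code u w) = F (line_graph E') (edge_code u w)"
    using F(1) unfolding locally_determined_def by blast
  then show ?thesis unfolding run_on_line_view_def fst E'_def by simp
qed

text \<open>The square root halves the exponent of \<Delta>. The factor 16 = 2 * 2^3 comes from sqrt
  2 \<le> 2 and from log (2 \<Delta> + 2) \<le> 2 log (\<Delta> + 2), cubed; the summand 1 pays for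
  the additional round of the simulation.\<close>

lemma line_graph_round_bound:
  fixes \<Delta> x l R :: nat and C :: real
  assumes C: "C \<ge> 1" and \<Delta>: "\<Delta> \<ge> 1" and x: "x \<ge> 1"
    and R: "real R \<le> C * (real x * sqrt (real 2 * real \<Delta> powr (1 / real (x + 1))) * log 2 (real (2 * \<Delta>) + 2) ^ 3
        + real l)"
  shows "real (R + 1) \<le> (16 * C + 1) * (real x * real \<Delta> powr (1 / real (2 * x + 2)) * log 2 (real \<Delta> + 2) ^ 3
        + real l)"
proof -
  define p where "p = real \<Delta> powr (1 / real (2 * x + 2))"
  define B where "B = log 2 (real \<Delta> + 2)"
  define Z where "Z = real x * p * B ^ 3"
  have p1: "p \<ge> 1" unfolding p_def using \<Delta> by (intro ge_one_powr_ge_zero) auto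
  have B1: "B \<ge> 1" unfolding B_def by simp
  have "1 * 1 * 1 \<le> Z" unfolding Z_def using x p1 B1 by (intro mult_mono one_le_power) auto
  then have Z1: "Z \<ge> 1" by simp
  have "sqrt (real \<Delta> powr (1 / real (x + 1))) = p"
  proof -
    have "p * p = real \<Delta> powr (1 / real (2 * x + 2) + 1 / real (2 * x + 2))"
      unfolding p_def by (rule powr_add[symmetric])
    also have "1 / real (2 * x + 2) + 1 / real (2 * x + 2) = 1 / real (x + 1)" by (simp add: field_simps)
    finally show ?thesis using p1 by (metis abs_of_nonneg order_trans real_sqrt_mult_self real_sqrt_mult zero_le_one)
  qed
  then have "sqrt (real 2 * real \<Delta> powr (1 / real (x + 1))) = sqrt 2 * p" by (simp add: real_sqrt_mult)
  also have "\<dots> \<le> 2 * p" using p1 sqrt2_less_2 by (intro mult_right_mono) auto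
  finally have sq: "sqrt (real 2 * real \<Delta> powr (1 / real (x + 1))) \<le> 2 * p" .
  have "log 2 (real (2 * \<Delta>) + 2) \<le> log 2 ((real \<Delta> + 2) ^ 2)"
    by (intro log_mono) (auto simp: power2_eq_square algebra_simps)
  also have "\<dots> = 2 * B" unfolding B_def by (subst log_nat_power) auto
  finally have "log 2 (real (2 * \<Delta>) + 2) ^ 3 \<le> (2 * B) ^ 3" by (intro power_mono) auto
  then have "real x * sqrt (real 2 * real \<Delta> powr (1 / real (x + 1))) * log 2 (real (2 * \<Delta>) + 2) ^ 3
      \<le> real x * (2 * p) * (2 * B) ^ 3"
    using sq p1 by (intro mult_mono mult_left_mono) auto
  also have "\<dots> = 16 * Z" unfolding Z_def by (simp add: power_mult_distrib)
  finally have "real R \<le> C * (16 * Z + real l)" using R C by (smt (verit) mult_left_mono)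
  then have "real (R + 1) \<le> C * (16 * Z + real l) + Z" using Z1 by simp
  also have "\<dots> \<le> (16 * C + 1) * Z + (16 * C + 1) * real l"
  proof -
    have "C * real l \<le> (16 * C + 1) * real l" using C by (intro mult_right_mono) auto
    then show ?thesis by (simp add: algebra_simps)
  qed
  finally show ?thesis unfolding Z_def p_def B_def by (simp add: algebra_simps)
qed

lemma edge_colouring:
  fixes c :: nat and xf :: "nat \<Rightarrow> nat"
  assumes c: "c \<ge> 1" and xf: "\<And>d. xf d \<ge> 1"
  shows "\<exists>(C::real) (B :: nat \<Rightarrow> nat \<Rightarrow> nat \<times> (nat \<times> nat) set \<Rightarrow> nat \<Rightarrow> nat).
    \<forall>V E. simple_graph V E \<and> V \<subseteq> {..card V ^ c} \<and> max_degree V E \<ge> 1 \<longrightarrow>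
      (let n = card V; \<Delta> = max_degree V E; x = xf \<Delta>;
           r = nat \<lceil>C * (real x * real \<Delta> powr (1 / real (2 * x + 2))
                        * (log 2 (real \<Delta> + 2)) ^ 3 + real (log_star n))\<rceil>
       in proper_edge_coloring V E (\<lambda>v. B n \<Delta> (local_view E r v)) (2 ^ (x + 1) * \<Delta>))"
proof -
  from clique_cover_colouring_rounds[of "4 * c"] obtain C :: real where C: "C \<ge> 1 \<and> (\<forall>n \<Delta> D S N x K. n \<ge> 1 \<longrightarrow> D \<ge> 2 \<longrightarrow>
    S \<ge> 1 \<longrightarrow> x \<ge> 1 \<longrightarrow> N \<ge> 1 \<longrightarrow>
    real N \<le> (2 * real n) ^ (4 * c) \<longrightarrow> locally_determined 2 K \<longrightarrow>
    (\<forall>E v. \<forall>C\<in>K E v. v \<in> C \<and> C \<subseteq> insert v (nbrs E v)) \<longrightarrow>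
    (\<exists>F R. locally_determined R F \<and>
      real R \<le> C * (real x * sqrt (real D * real S powr (1 / real (x + 1))) * log 2 (real \<Delta> + 2) ^ 3
        + real (log_star n)) \<and>
      (\<forall>E. sym E \<longrightarrow> irrefl E \<longrightarrow> E \<subseteq> {..<N} \<times> {..<N} \<longrightarrow> degree_le E \<Delta> \<longrightarrow> clique_cover E D S (K E) \<longrightarrow>
         (\<forall>v. F E v < D ^ (x + 1) * S) \<and> proper_on E (F E))))" ..
  define N where "N n = (2 * n ^ c + 1)\<^sup>2" for n :: nat
  define rr where "rr n \<Delta> = nat \<lceil>(16 * C + 1) * (real (xf \<Delta>) * real \<Delta> powr (1 / real (2 * xf \<Delta> + 2))
                        * (log 2 (real \<Delta> + 2)) ^ 3 + real (log_star n))\<rceil>" for n \<Delta>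
  define good where "good n \<Delta> F \<longleftrightarrow> (\<exists>R. R + 1 \<le> rr n \<Delta> \<and> locally_determined R F) \<and>
      (\<forall>L. sym L \<longrightarrow> irrefl L \<longrightarrow> L \<subseteq> {..<N n} \<times> {..<N n} \<longrightarrow> degree_le L (2 * \<Delta>) \<longrightarrow>
         clique_cover L 2 \<Delta> (star_cliques L) \<longrightarrow> (\<forall>v. F L v < 2 ^ (xf \<Delta> + 1) * \<Delta>) \<and> proper_on L (F L))"
    for n \<Delta> and F :: "(nat \<times> nat) set \<Rightarrow> nat \<Rightarrow> nat"
  define B where "B n \<Delta> v = run_on_line_view (SOME F. good n \<Delta> F) (rr n \<Delta>) v" for n \<Delta> v
  have "proper_edge_coloring V E (\<lambda>v. B (card V) (max_degree V E)
      (local_view E (rr (card V) (max_degree V E)) v)) (2 ^ (xf (max_degree V E) + 1) * max_degree V E)"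
    if G: "simple_graph V E" and V: "V \<subseteq> {..card V ^ c}" and D1: "max_degree V E \<ge> 1" for V E
  proof -
    let ?n = "card V" and ?\<Delta> = "max_degree V E" and ?L = "line_graph E"
    have n: "?n \<ge> 1" using finite_vertices[OF G] vertices_nonempty[OF G] by (simp add: Suc_le_eq card_gt_0_iff)
    have N: "real (N ?n) \<le> (2 * real ?n) ^ (4 * c)"
    proof -
      have nc: "1 \<le> ?n ^ c" using n by (rule one_le_power)
      then have "N ?n \<le> (3 * ?n ^ c)\<^sup>2" unfolding N_def by (intro power_mono) auto
      also have "\<dots> = 9 * (?n ^ c)\<^sup>2" by (simp add: power_mult_distrib)
      \<comment> \<open>Edge codes are quadratic in n^c; the exponent 4 c leaves room for the
        constant 9 \<le> 16^c.\<close>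
      also have "\<dots> \<le> 16 ^ c * (?n ^ c) ^ 4"
      proof (intro mult_le_mono)
        have "(16::nat) ^ 1 \<le> 16 ^ c" using c by (intro power_increasing) auto
        then show "9 \<le> (16::nat) ^ c" by simp
        show "(?n ^ c)\<^sup>2 \<le> (?n ^ c) ^ 4" using nc by (intro power_increasing) auto
      qed
      also have "\<dots> = (2 * ?n) ^ (4 * c)"
      proof -
        have "(2 * ?n) ^ (4 * c) = ((2 * ?n) ^ 4) ^ c" by (rule power_mult)
        also have "\<dots> = (16 * ?n ^ 4) ^ c" by (simp add: power_mult_distrib)
        also have "\<dots> = 16 ^ c * (?n ^ 4) ^ c" by (rule power_mult_distrib)
        also have "(?n ^ 4) ^ c = (?n ^ c) ^ 4" by (simp only: power_mult[symmetric] mult.commute)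
        finally show ?thesis by (rule sym)
      qed
      finally have "real (N ?n) \<le> real ((2 * ?n) ^ (4 * c))" by (simp only: of_nat_le_iff)
      then show ?thesis by simp
    qed
    have N1: "N ?n \<ge> 1" unfolding N_def by simp
    have sub: "\<forall>E v. \<forall>C\<in>star_cliques E v. v \<in> C \<and> C \<subseteq> insert v (nbrs E v)"
      using star_cliques_subset by simp
    have "\<exists>F R. locally_determined R F \<and>
      real R \<le> C * (real (xf ?\<Delta>) * sqrt (real 2 * real ?\<Delta> powr (1 / real (xf ?\<Delta> + 1))) * log 2 (real (2 * ?\<Delta>) + 2) ^ 3
        + real (log_star ?n)) \<and>
      (\<forall>E. sym E \<longrightarrow> irrefl E \<longrightarrow> E \<subseteq> {..<N ?n} \<times> {..<N ?n} \<longrightarrow> degree_le E (2 * ?\<Delta>) \<longrightarrow>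
        clique_cover E 2 ?\<Delta> (star_cliques E) \<longrightarrow> (\<forall>v. F E v < 2 ^ (xf ?\<Delta> + 1) * ?\<Delta>) \<and> proper_on E (F E))"
      by (rule C[THEN conjunct2, rule_format])
        (use n D1 xf N N1 local_star_cliques sub in \<open>simp_all only: order_refl\<close>)
    then obtain F R where F: "locally_determined R F"
      "real R \<le> C * (real (xf ?\<Delta>) * sqrt (real 2 * real ?\<Delta> powr (1 / real (xf ?\<Delta> + 1))) * log 2 (real (2 * ?\<Delta>) + 2) ^ 3
        + real (log_star ?n))"
      "\<forall>E. sym E \<longrightarrow> irrefl E \<longrightarrow> E \<subseteq> {..<N ?n} \<times> {..<N ?n} \<longrightarrow> degree_le E (2 * ?\<Delta>) \<longrightarrow>
        clique_cover E 2 ?\<Delta> (star_cliques E) \<longrightarrow> (\<forall>v. F E v < 2 ^ (xf ?\<Delta> + 1) * ?\<Delta>) \<and> proper_on E (F E)"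
      by blast
    have "R + 1 \<le> rr ?n ?\<Delta>"
      unfolding rr_def using C F(2) D1 xf by (intro le_nat_ceiling line_graph_round_bound) auto
    then have "good ?n ?\<Delta> F" unfolding good_def using F(1,3) by blast
    then have good: "good ?n ?\<Delta> (SOME F. good ?n ?\<Delta> F)" by (rule someI[of "good ?n ?\<Delta>"])
    define F' where "F' = (SOME F. good ?n ?\<Delta> F)"
    have B: "B ?n ?\<Delta> (local_view E (rr ?n ?\<Delta>) u) w = F' ?L (edge_code u w)" if "(u, w) \<in> E" for u w
    proof -
      obtain R where "R + 1 \<le> rr ?n ?\<Delta>" "locally_determined R F'"
        using good unfolding good_def F'_def by blast
      then show ?thesis unfolding B_def F'_def[symmetric] by (intro run_on_line_view sym_edges[OF G] that)
    qed
    have "?L \<subseteq> {..<N ?n} \<times> {..<N ?n}"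
    proof (rule subrelI)
      fix e f assume "(e, f) \<in> ?L"
      then obtain u w w' where u: "(u, w) \<in> E" "(u, w') \<in> E" "e = edge_code u w" "f = edge_code u w'"
        by (rule line_graphE)
      then have "u \<le> ?n ^ c" "w \<le> ?n ^ c" "w' \<le> ?n ^ c" using edges_subset[OF G] V by auto
      then show "(e, f) \<in> {..<N ?n} \<times> {..<N ?n}" using u(3,4) edge_code_less unfolding N_def by simp
    qed
    then have L: "\<forall>v. F' ?L v < 2 ^ (xf ?\<Delta> + 1) * ?\<Delta>" "proper_on ?L (F' ?L)"
      using good sym_line_graph irrefl_line_graph degree_line_graph[OF sym_edges[OF G] degree_le_max_degree[OF G]]
        clique_cover_stars[OF sym_edges[OF G] degree_le_max_degree[OF G] D1] unfolding good_def F'_def by simp_all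
    have sw: "(w, u) \<in> E" if "(u, w) \<in> E" for u w using that sym_edges[OF G] unfolding sym_def by blast
    show ?thesis
      unfolding proper_edge_coloring_def
    proof (intro conjI ballI impI)
      fix p assume "p \<in> E"
      then show "case p of (u, w) \<Rightarrow>
          B ?n ?\<Delta> (local_view E (rr ?n ?\<Delta>) u) w < 2 ^ (xf ?\<Delta> + 1) * ?\<Delta> \<and>
          B ?n ?\<Delta> (local_view E (rr ?n ?\<Delta>) u) w = B ?n ?\<Delta> (local_view E (rr ?n ?\<Delta>) w) u"
        using B sw L(1) edge_code_commute by (cases p) simp
    next
      fix u w w' assume w: "w \<in> nbrs E u" "w' \<in> nbrs E u" "w \<noteq> w'"
      then have E: "(u, w) \<in> E" "(u, w') \<in> E" unfolding nbrs_def by auto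
      have "edge_code u w \<noteq> edge_code u w'" using w(3) edge_code_eq_iff by auto
      then have "(edge_code u w, edge_code u w') \<in> ?L" using E unfolding line_graph_def by blast
      then show "B ?n ?\<Delta> (local_view E (rr ?n ?\<Delta>) u) w \<noteq> B ?n ?\<Delta> (local_view E (rr ?n ?\<Delta>) u) w'"
        using L(2) B[OF E(1)] B[OF E(2)] unfolding proper_on_def by simp
    qed
  qed
  then show ?thesis unfolding rr_def Let_def by blast
qed

theorem mainTheorem8:
  shows
  "(\<forall>c::nat. c \<ge> 1 \<longrightarrow>
     (\<forall>xf :: nat \<Rightarrow> nat. (\<forall>S. xf S \<ge> 1) \<and> (\<lambda>S. real (xf S)) \<in> o(\<lambda>S. ln (real S)) \<longrightarrow>
       (\<exists>(C::real) (kp::nat) (S0::nat)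
          (A :: nat \<Rightarrow> nat \<Rightarrow> nat \<Rightarrow> nat \<Rightarrow> nat \<times> (nat \<times> nat) set \<Rightarrow> nat).
          \<forall>V E. simple_graph V E \<and> V \<subseteq> {..card V ^ c} \<and>
                diversity V E \<ge> 2 \<and> clique_number V E \<ge> S0 \<longrightarrow>
            (let n = card V; \<Delta> = max_degree V E; D = diversity V E;
                 S = clique_number V E; x = xf S;
                 r = nat \<lceil>C * (real x * sqrt (real D * real S powr (1 / real (x + 1)))
                              * (log 2 (real \<Delta> + 2)) ^ kp + real (log_star n))\<rceil>
             in proper_vertex_coloring V E (\<lambda>v. A n \<Delta> D S (local_view E r v)) (D ^ (x + 1) * S)))))
   \<and>
   (\<forall>c::nat. c \<ge> 1 \<longrightarrow>
     (\<forall>xf :: nat \<Rightarrow> nat. (\<forall>d. xf d \<ge> 1) \<and> (\<lambda>d. real (xf d)) \<in> o(\<lambda>d. ln (real d)) \<longrightarrow>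
       (\<exists>(C::real) (kp::nat) (D0::nat)
          (B :: nat \<Rightarrow> nat \<Rightarrow> nat \<times> (nat \<times> nat) set \<Rightarrow> nat \<Rightarrow> nat).
          \<forall>V E. simple_graph V E \<and> V \<subseteq> {..card V ^ c} \<and> max_degree V E \<ge> D0 \<longrightarrow>
            (let n = card V; \<Delta> = max_degree V E; x = xf \<Delta>;
                 r = nat \<lceil>C * (real x * real \<Delta> powr (1 / real (2 * x + 2))
                              * (log 2 (real \<Delta> + 2)) ^ kp + real (log_star n))\<rceil>
             in proper_edge_coloring V E (\<lambda>v. B n \<Delta> (local_view E r v)) (2 ^ (x + 1) * \<Delta>)))))"
proof (intro conjI allI impI)
  fix c :: nat and xf :: "nat \<Rightarrow> nat"
  assume c: "c \<ge> 1" and xf: "(\<forall>S. xf S \<ge> 1) \<and> (\<lambda>S. real (xf S)) \<in> o(\<lambda>S. ln (real S))"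
  have "xf S \<ge> 1" for S using xf by blast
  from vertex_colouring[of c xf, OF c this] obtain C A where A:
    "\<forall>V E. simple_graph V E \<and> V \<subseteq> {..card V ^ c} \<and> diversity V E \<ge> 2 \<longrightarrow>
      (let n = card V; \<Delta> = max_degree V E; D = diversity V E; S = clique_number V E; x = xf S;
           r = nat \<lceil>C * (real x * sqrt (real D * real S powr (1 / real (x + 1)))
                        * (log 2 (real \<Delta> + 2)) ^ 3 + real (log_star n))\<rceil>
       in proper_vertex_coloring V E (\<lambda>v. A n \<Delta> D S (local_view E r v)) (D ^ (x + 1) * S))"
    by (elim exE)
  show "\<exists>(C::real) (kp::nat) (S0::nat)
          (A :: nat \<Rightarrow> nat \<Rightarrow> nat \<Rightarrow> nat \<Rightarrow> nat \<times> (nat \<times> nat) set \<Rightarrow> nat).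
          \<forall>V E. simple_graph V E \<and> V \<subseteq> {..card V ^ c} \<and>
                diversity V E \<ge> 2 \<and> clique_number V E \<ge> S0 \<longrightarrow>
            (let n = card V; \<Delta> = max_degree V E; D = diversity V E;
                 S = clique_number V E; x = xf S;
                 r = nat \<lceil>C * (real x * sqrt (real D * real S powr (1 / real (x + 1)))
                              * (log 2 (real \<Delta> + 2)) ^ kp + real (log_star n))\<rceil>
             in proper_vertex_coloring V E (\<lambda>v. A n \<Delta> D S (local_view E r v)) (D ^ (x + 1) * S))"
    \<comment> \<open>The exponent 3 counts the logarithmic factors of
      \<open>colouring_parameters\<close>.\<close>
    by (intro exI[of _ C] exI[of _ 3] exI[of _ 0] exI[of _ A] allI impI, rule A[rule_format]) simp
next
  fix c :: nat and xf :: "nat \<Rightarrow> nat"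
  assume c: "c \<ge> 1" and xf: "(\<forall>d. xf d \<ge> 1) \<and> (\<lambda>d. real (xf d)) \<in> o(\<lambda>d. ln (real d))"
  have "xf d \<ge> 1" for d using xf by blast
  from edge_colouring[of c xf, OF c this] obtain C B where B:
    "\<forall>V E. simple_graph V E \<and> V \<subseteq> {..card V ^ c} \<and> max_degree V E \<ge> 1 \<longrightarrow>
      (let n = card V; \<Delta> = max_degree V E; x = xf \<Delta>;
           r = nat \<lceil>C * (real x * real \<Delta> powr (1 / real (2 * x + 2))
                        * (log 2 (real \<Delta> + 2)) ^ 3 + real (log_star n))\<rceil>
       in proper_edge_coloring V E (\<lambda>v. B n \<Delta> (local_view E r v)) (2 ^ (x + 1) * \<Delta>))"
    by (elim exE)
  show "\<exists>(C::real) (kp::nat) (D0::nat)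
          (B :: nat \<Rightarrow> nat \<Rightarrow> nat \<times> (nat \<times> nat) set \<Rightarrow> nat \<Rightarrow> nat).
          \<forall>V E. simple_graph V E \<and> V \<subseteq> {..card V ^ c} \<and> max_degree V E \<ge> D0 \<longrightarrow>
            (let n = card V; \<Delta> = max_degree V E; x = xf \<Delta>;
                 r = nat \<lceil>C * (real x * real \<Delta> powr (1 / real (2 * x + 2))
                              * (log 2 (real \<Delta> + 2)) ^ kp + real (log_star n))\<rceil>
             in proper_edge_coloring V E (\<lambda>v. B n \<Delta> (local_view E r v)) (2 ^ (x + 1) * \<Delta>))"
    \<comment> \<open>The threshold 1 provides an edge, so that the stars have a positive size
      bound.\<close>
    by (intro exI[of _ C] exI[of _ 3] exI[of _ 1] exI[of _ B]) (rule B)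
qed

end
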